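(* Let $g_{11},g_{22},\mu>0$ and $g_{12}>\sqrt{g_{11}g_{22}}$, let $A>0$, and let $U=(u_1,u_2)\in X$ be an energy minimizing domain wall solution of $$-u_1''+g_{11}(u_1^2-a^2)u_1+g_{12}u_1u_2^2=0,\qquad -u_2''+g_{22}(u_2^2-b^2)u_2+g_{12}u_1^2u_2=0$$ with $U(x)\to(a,0)$ as $x\to\infty$ and $U(x)\to(0,b)$ as $x\to-\infty$, where $a=\sqrt{\mu}/\sqrt[4]{g_{11}}$, $b=\sqrt{\mu}/\sqrt[4]{g_{22}}$. Then there exist a constant $C=C(A)$ and $\varepsilon_0>0$ such that for every $\varepsilon\in(0,\varepsilon_0)$ there is $\delta>0$ with the following property: if $\Psi_0\in\mathcal{D}\cap L^\infty(\mathbb{R})$ satisfies $\rho_A(\Psi_0,U)\le\delta$, $\Psi(x,t)$ is the solution of the Hamiltonian system with $\Psi(\cdot,0)=\Psi_0$, and $\alpha(t),\theta_1(t),\theta_2(t)$ are real functions satisfying $$\sup_{t\in\mathbb{R}}\rho_A\left(\Psi(\cdot,t),\begin{pmatrix}e^{i\theta_1(t)}u_1(\cdot+\alpha(t))\\ e^{i\theta_2(t)}u_2(\cdot+\alpha(t))\end{pmatrix}\right)\le\varepsilon ,$$ then $|\alpha(t)|\le C\varepsilon\max\{1,|t|\}$ for all $t\in\mathbb{R}$.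
   Context: Here $W(\psi_1,\psi_2)=\frac12\bigl(\sqrt{g_{11}}|\psi_1|^2+\sqrt{g_{22}}|\psi_2|^2-\mu\bigr)^2+\bigl(g_{12}-\sqrt{g_{11}g_{22}}\bigr)|\psi_1|^2|\psi_2|^2$ and $E(\Psi)=\frac12\int_{-\infty}^{\infty}\bigl(|\psi_1'|^2+|\psi_2'|^2+W(\psi_1,\psi_2)\bigr)\,dx\in[0,\infty]$. $X$ is the set of $U\in H^1_{loc}(\mathbb{R};\mathbb{R}^2)$ with $U(x)\to(a,0)$ as $x\to+\infty$ and $U(x)\to(0,b)$ as $x\to-\infty$; "energy minimizing" means $E(U)=\inf_XE$. $\mathcal{D}=\{\Psi\in H^1_{loc}(\mathbb{R};\mathbb{C}^2):E(\Psi)<\infty\}$. $\rho_A(\Psi,\Phi)=\sum_{j=1,2}\bigl[\|\psi_j'-\varphi_j'\|_{L^2(\mathbb{R})}+\||\psi_j|-|\varphi_j|\|_{L^2(\mathbb{R})}+\|\psi_j-\varphi_j\|_{L^\infty(-A,A)}\bigr]$. The Hamiltonian system is $$i\partial_t\psi_1=-\partial_x^2\psi_1+\bigl(g_{11}(|\psi_1|^2-a^2)+g_{12}|\psi_2|^2\bigr)\psi_1,\qquad i\partial_t\psi_2=-\partial_x^2\psi_2+\bigl(g_{22}(|\psi_2|^2-b^2)+g_{12}|\psi_1|^2\bigr)\psi_2 .$$ Known well-posedness (Zhidkov): for each $\Psi_0\in\mathcal{D}\cap L^\infty(\mathbb{R})$ there is a unique global-in-time solution with initial data $\Psi_0$;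 the map $t\mapsto\Psi(\cdot,t)$ is continuous with respect to $\rho_A$, and $E(\Psi(\cdot,t))=E(\Psi_0)$ for all $t$. The solution in the claim is this one. *)

theory Defs
  imports "HOL-Analysis.Analysis" "HOL-Probability.Essential_Supremum"
begin

text \<open>
  Two-component functions on the line are maps \<open>real \<Rightarrow> 'a \<times> 'a\<close> with \<open>'a = real\<close> or
  \<open>'a = complex\<close>; the components are obtained with \<open>fst\<close> and \<open>snd\<close>.
\<close>

subsection \<open>Weak derivatives and the space \<open>H\<^sup>1\<^sub>l\<^sub>o\<^sub>c\<close>\<close>

definition L2loc :: "(real \<Rightarrow> 'a::euclidean_space) set" where
  "L2loc = {f. f \<in> borel_measurable lborel \<and>
     (\<forall>R>0. set_integrable lborel {-R..R} (\<lambda>x. (norm (f x))\<^sup>2))}"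

definition test_function :: "(real \<Rightarrow> real) \<Rightarrow> bool" where
  "test_function \<phi> \<longleftrightarrow> \<phi> C1_differentiable_on UNIV \<and> compact (closure {x. \<phi> x \<noteq> 0})"

definition is_weak_deriv :: "(real \<Rightarrow> 'a::euclidean_space) \<Rightarrow> (real \<Rightarrow> 'a) \<Rightarrow> bool" where
  "is_weak_deriv f g \<longleftrightarrow> (\<forall>\<phi>. test_function \<phi> \<longrightarrow>
     (LBINT x. deriv \<phi> x *\<^sub>R f x) = - (LBINT x. \<phi> x *\<^sub>R g x))"

text \<open>
  In one dimension every \<open>H\<^sup>1\<^sub>l\<^sub>o\<^sub>c\<close> class has exactly one continuous representative. The
  elements of \<open>H1loc\<close> are these representatives, so that pointwise values and limits make sense.
\<close>

definition H1loc :: "(real \<Rightarrow> 'a::euclidean_space) set" where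
  "H1loc = {f. continuous_on UNIV f \<and> f \<in> L2loc \<and> (\<exists>g\<in>L2loc. is_weak_deriv f g)}"

text \<open>
  For \<open>f \<in> H1loc\<close> the weak derivative is determined up to a null set; it is only ever used
  under integrals.
\<close>

definition weak_deriv :: "(real \<Rightarrow> 'a::euclidean_space) \<Rightarrow> real \<Rightarrow> 'a" where
  "weak_deriv f = (SOME g. g \<in> L2loc \<and> is_weak_deriv f g)"

subsection \<open>Norms with values in \<open>[0, \<infinity>]\<close>\<close>

definition L2_enorm :: "(real \<Rightarrow> 'a::real_normed_vector) \<Rightarrow> ennreal" where
  "L2_enorm f = (let I = (\<integral>\<^sup>+ x. ennreal ((norm (f x))\<^sup>2) \<partial>lborel)
     in if I = \<infinity> then \<infinity> else ennreal (sqrt (enn2real I)))"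

definition Linf_enorm :: "real set \<Rightarrow> (real \<Rightarrow> 'a::real_normed_vector) \<Rightarrow> ennreal" where
  "Linf_enorm S f = esssup (restrict_space lborel S) (\<lambda>x. ennreal (norm (f x)))"

definition Linf :: "(real \<Rightarrow> 'a::real_normed_vector) set" where
  "Linf = {f. f \<in> borel_measurable lborel \<and> Linf_enorm UNIV f < \<infinity>}"

subsection \<open>Energy\<close>

definition potential_W ::
  "real \<Rightarrow> real \<Rightarrow> real \<Rightarrow> real \<Rightarrow> 'a::real_normed_vector \<times> 'a \<Rightarrow> real" where
  "potential_W g11 g22 g12 \<mu> p =
     1/2 * (sqrt g11 * (norm (fst p))\<^sup>2 + sqrt g22 * (norm (snd p))\<^sup>2 - \<mu>)\<^sup>2
     + (g12 - sqrt (g11 * g22)) * (norm (fst p))\<^sup>2 * (norm (snd p))\<^sup>2"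

text \<open>
  The integrand is nonnegative when \<open>g12 \<ge> sqrt (g11 * g22)\<close>, so \<open>ennreal\<close> does not truncate it.
\<close>

definition energy ::
  "real \<Rightarrow> real \<Rightarrow> real \<Rightarrow> real \<Rightarrow> (real \<Rightarrow> 'a::euclidean_space \<times> 'a) \<Rightarrow> ennreal" where
  "energy g11 g22 g12 \<mu> \<Psi> = ennreal (1/2) *
     (\<integral>\<^sup>+ x. ennreal ((norm (fst (weak_deriv \<Psi> x)))\<^sup>2 + (norm (snd (weak_deriv \<Psi> x)))\<^sup>2
                + potential_W g11 g22 g12 \<mu> (\<Psi> x)) \<partial>lborel)"

definition finite_energy_space ::
  "real \<Rightarrow> real \<Rightarrow> real \<Rightarrow> real \<Rightarrow> (real \<Rightarrow> complex \<times> complex) set" where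
  "finite_energy_space g11 g22 g12 \<mu> = {\<Psi> \<in> H1loc. energy g11 g22 g12 \<mu> \<Psi> < \<infinity>}"

subsection \<open>Domain walls\<close>

definition wall_space :: "real \<Rightarrow> real \<Rightarrow> (real \<Rightarrow> real \<times> real) set" where
  "wall_space a b = {U \<in> H1loc. (U \<longlongrightarrow> (a, 0)) at_top \<and> (U \<longlongrightarrow> (0, b)) at_bot}"

definition energy_minimizing ::
  "real \<Rightarrow> real \<Rightarrow> real \<Rightarrow> real \<Rightarrow> real \<Rightarrow> real \<Rightarrow> (real \<Rightarrow> real \<times> real) \<Rightarrow> bool" where
  "energy_minimizing g11 g22 g12 \<mu> a b U \<longleftrightarrow>
     energy g11 g22 g12 \<mu> U = (INF V\<in>wall_space a b. energy g11 g22 g12 \<mu> V)"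

definition wall_ode ::
  "real \<Rightarrow> real \<Rightarrow> real \<Rightarrow> real \<Rightarrow> real \<Rightarrow> (real \<Rightarrow> real) \<Rightarrow> (real \<Rightarrow> real) \<Rightarrow> bool" where
  "wall_ode g11 g22 g12 a b u1 u2 \<longleftrightarrow> (\<exists>u1' u2' u1'' u2''. \<forall>x.
     (u1 has_real_derivative u1' x) (at x) \<and> (u1' has_real_derivative u1'' x) (at x) \<and>
     (u2 has_real_derivative u2' x) (at x) \<and> (u2' has_real_derivative u2'' x) (at x) \<and>
     - u1'' x + g11 * ((u1 x)\<^sup>2 - a\<^sup>2) * u1 x + g12 * u1 x * (u2 x)\<^sup>2 = 0 \<and>
     - u2'' x + g22 * ((u2 x)\<^sup>2 - b\<^sup>2) * u2 x + g12 * (u1 x)\<^sup>2 * u2 x = 0)"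

text \<open>The profile with phases \<open>s\<close>, \<open>t\<close> and translation \<open>\<alpha>\<close>; \<open>modulated 0 0 0 U\<close> is \<open>U\<close> itself,
  regarded as a complex-valued function.\<close>

definition modulated ::
  "real \<Rightarrow> real \<Rightarrow> real \<Rightarrow> (real \<Rightarrow> real \<times> real) \<Rightarrow> real \<Rightarrow> complex \<times> complex" where
  "modulated s t \<alpha> U x =
     (exp (\<i> * complex_of_real s) * complex_of_real (fst (U (x + \<alpha>))),
      exp (\<i> * complex_of_real t) * complex_of_real (snd (U (x + \<alpha>))))"

subsection \<open>The distance \<open>\<rho>\<^sub>A\<close>\<close>

definition rho_component ::
  "real \<Rightarrow> (complex \<times> complex \<Rightarrow> complex) \<Rightarrow> (real \<Rightarrow> complex \<times> complex) \<Rightarrow>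
   (real \<Rightarrow> complex \<times> complex) \<Rightarrow> ennreal" where
  "rho_component A pr \<Psi> \<Phi> =
     L2_enorm (\<lambda>x. pr (weak_deriv \<Psi> x) - pr (weak_deriv \<Phi> x))
     + L2_enorm (\<lambda>x. cmod (pr (\<Psi> x)) - cmod (pr (\<Phi> x)))
     + Linf_enorm {-A<..<A} (\<lambda>x. pr (\<Psi> x) - pr (\<Phi> x))"

definition rho ::
  "real \<Rightarrow> (real \<Rightarrow> complex \<times> complex) \<Rightarrow> (real \<Rightarrow> complex \<times> complex) \<Rightarrow> ennreal" where
  "rho A \<Psi> \<Phi> = rho_component A fst \<Psi> \<Phi> + rho_component A snd \<Psi> \<Phi>"

subsection \<open>The Hamiltonian system\<close>

definition nonlinearity ::
  "real \<Rightarrow> real \<Rightarrow> real \<Rightarrow> real \<Rightarrow> real \<Rightarrow> complex \<times> complex \<Rightarrow> complex \<times> complex" where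
  "nonlinearity g11 g22 g12 a b p =
     (complex_of_real (g11 * ((cmod (fst p))\<^sup>2 - a\<^sup>2) + g12 * (cmod (snd p))\<^sup>2) * fst p,
      complex_of_real (g22 * ((cmod (snd p))\<^sup>2 - b\<^sup>2) + g12 * (cmod (fst p))\<^sup>2) * snd p)"

text \<open>
  The equation \<open>\<i> \<partial>\<^sub>t \<psi> = - \<partial>\<^sub>x\<^sup>2 \<psi> + N\<close> for one component, in the weak sense natural for
  functions that are only \<open>H\<^sup>1\<^sub>l\<^sub>o\<^sub>c\<close> in space: for every test function \<open>\<phi>\<close> and every time \<open>t\<close>,
  \<open>\<i> d/dt \<integral> \<psi> \<phi> = \<integral> (\<partial>\<^sub>x \<psi> \<phi>' + N \<phi>)\<close>. The arguments are \<open>\<psi>\<close>, \<open>\<partial>\<^sub>x \<psi>\<close>, \<open>N\<close>, as functions of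
  \<open>t\<close> and \<open>x\<close>.
\<close>

definition weak_schroedinger ::
  "(real \<Rightarrow> real \<Rightarrow> complex) \<Rightarrow> (real \<Rightarrow> real \<Rightarrow> complex) \<Rightarrow> (real \<Rightarrow> real \<Rightarrow> complex) \<Rightarrow> bool" where
  "weak_schroedinger \<psi> d\<psi> N \<longleftrightarrow> (\<forall>\<phi> t. test_function \<phi> \<longrightarrow>
     (\<exists>D. ((\<lambda>s. LBINT x. \<phi> x *\<^sub>R \<psi> s x) has_vector_derivative D) (at t) \<and>
          \<i> * D = (LBINT x. deriv \<phi> x *\<^sub>R d\<psi> t x + \<phi> x *\<^sub>R N t x)))"

text \<open>
  The global solution with initial datum \<open>\<Psi>0\<close> in the class of Zhidkov's well-posedness theorem:
  \<open>\<Psi> t\<close> is the state at time \<open>t\<close>, and \<open>t \<mapsto> \<Psi> t\<close> is continuous for all distances \<open>\<rho>\<^sub>R\<close>.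
  Solutions in this class are unique, and their energy is conserved.
\<close>

definition hamiltonian_solution ::
  "real \<Rightarrow> real \<Rightarrow> real \<Rightarrow> real \<Rightarrow> real \<Rightarrow> real \<Rightarrow> (real \<Rightarrow> complex \<times> complex) \<Rightarrow>
   (real \<Rightarrow> real \<Rightarrow> complex \<times> complex) \<Rightarrow> bool" where
  "hamiltonian_solution g11 g22 g12 \<mu> a b \<Psi>0 \<Psi> \<longleftrightarrow>
     \<Psi> 0 = \<Psi>0 \<and>
     (\<forall>t. \<Psi> t \<in> finite_energy_space g11 g22 g12 \<mu> \<inter> Linf) \<and>
     (\<forall>R>0. \<forall>t. ((\<lambda>s. rho R (\<Psi> s) (\<Psi> t)) \<longlongrightarrow> 0) (at t)) \<and>
     weak_schroedinger (\<lambda>t x. fst (\<Psi> t x)) (\<lambda>t x. fst (weak_deriv (\<Psi> t) x))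
       (\<lambda>t x. fst (nonlinearity g11 g22 g12 a b (\<Psi> t x))) \<and>
     weak_schroedinger (\<lambda>t x. snd (\<Psi> t x)) (\<lambda>t x. snd (weak_deriv (\<Psi> t) x))
       (\<lambda>t x. snd (nonlinearity g11 g22 g12 a b (\<Psi> t x)))"

end

theory Submission
  imports Defs
begin

text \<open>
  Write \<open>U = (u, v)\<close> and \<open>u'' = V u\<close> with \<open>V = g11 (u\<^sup>2 - a\<^sup>2) + g12 v\<^sup>2\<close>. The position of the wall is
  read off from the linear functional \<open>Z\<^sub>s(t) = \<integral> \<phi>(x + \<alpha>(s)) \<psi>\<^sub>1(x, t) dx\<close>, where \<open>\<phi> = \<Phi>'\<close> has compact
  support and \<open>\<integral> \<phi> V = 0\<close>, \<open>\<integral> \<phi> u \<noteq> 0\<close>, \<open>\<integral> \<phi> u' \<noteq> 0\<close>. Far from \<open>[-A, A]\<close> the distance \<open>\<rho>\<^sub>A\<close> controls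
  \<open>r = \<psi>\<^sub>1 - e\<^sup>i\<^sup>\<theta> u(\<cdot> + \<alpha>)\<close> only through \<open>r'\<close> and \<open>|\<psi>\<^sub>1|\<close>, so \<open>r\<close> is small only up to a bounded additive
  constant; the conditions \<open>\<integral> \<phi> = \<integral> \<phi> V = 0\<close> make \<open>\<phi>\<close> blind to that constant, both in \<open>Z\<^sub>s\<close> and in its
  time derivative. With \<open>\<beta> = \<alpha>(t) - \<alpha>(s)\<close> this gives \<open>|Z\<^sub>s(t)|\<^sup>2 = M(\<beta>)\<^sup>2 + O(\<epsilon>)\<close> with
  \<open>M(\<beta>) = \<integral> \<phi> u(\<cdot> + \<beta>)\<close>. Since \<open>\<i> dZ\<^sub>s/dt\<close> is, up to an error \<open>O(\<epsilon> + |\<beta>|)\<close>, a real multiple of the phase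
  \<open>e\<^sup>i\<^sup>\<theta>\<close>, also \<open>d|Z\<^sub>s|\<^sup>2/dt = O(\<epsilon> + |\<beta>|)\<close>. As \<open>M\<^sup>2\<close> has nonzero derivative at \<open>0\<close>, a continuity
  argument yields \<open>|\<alpha>(t) - \<alpha>(s)| = O(\<epsilon>)\<close> for \<open>|t - s| \<le> h\<close> with \<open>h\<close> independent of \<open>\<epsilon>\<close>, and iteration
  gives the linear bound. The initial position is \<open>O(\<epsilon>)\<close> because the \<open>L\<^sup>2\<close> norm of
  \<open>|u(\<cdot> + \<alpha>)| - |u|\<close> controls \<open>\<alpha>\<close>.
\<close>

subsection \<open>Test functions and weak derivatives\<close>

lemma deriv_vanishes_outside:
  fixes f f' :: "real \<Rightarrow> real"
  assumes d: "\<And>x. (f has_real_derivative f' x) (at x)"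
    and z: "\<And>x. x \<notin> {l..h} \<Longrightarrow> f x = 0"
    and x: "x \<notin> {l..h}"
  shows "f' x = 0"
proof -
  have "((\<lambda>_. 0) has_real_derivative f' x) (at x)"
  proof (rule has_field_derivative_transform_within_open[OF d])
    show "open (- {l..h})" by auto
  qed (use x z in auto)
  then show ?thesis
    using DERIV_const DERIV_unique by blast
qed

lemma test_functionI:
  fixes f f' :: "real \<Rightarrow> real"
  assumes d: "\<And>x. (f has_real_derivative f' x) (at x)"
    and c: "continuous_on UNIV f'"
    and z: "\<And>x. x \<notin> {l..h} \<Longrightarrow> f x = 0"
  shows "test_function f"
proof -
  have "{x. f x \<noteq> 0} \<subseteq> {l..h}"
    using z by blast
  then have "compact (closure {x. f x \<noteq> 0})"
    by (simp add: bounded_subset[OF bounded_closed_interval])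
  moreover have "f C1_differentiable_on UNIV"
    unfolding C1_differentiable_on_def
    using c d by (auto simp: has_real_derivative_iff_has_vector_derivative)
  ultimately show ?thesis
    by (simp add: test_function_def)
qed

lemma test_functionE:
  assumes "test_function f"
  obtains f' l h where "\<And>x. (f has_real_derivative f' x) (at x)" "continuous_on UNIV f'"
    "\<And>x. x \<notin> {l..h} \<Longrightarrow> f x = 0" "\<And>x. x \<notin> {l..h} \<Longrightarrow> f' x = 0" "deriv f = f'"
proof -
  obtain f' where d: "\<And>x. (f has_real_derivative f' x) (at x)" and c: "continuous_on UNIV f'"
    using assms unfolding test_function_def C1_differentiable_on_def
    by (auto simp: has_real_derivative_iff_has_vector_derivative)
  have "bounded {x. f x \<noteq> 0}"
    using assms by (simp add: test_function_def)
  then obtain B where B: "\<And>x. f x \<noteq> 0 \<Longrightarrow> \<bar>x\<bar> \<le> B"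
    by (auto simp: bounded_iff)
  have z: "f x = 0" if "x \<notin> {-B..B}" for x
    using B[of x] that by (cases "f x = 0") auto
  show thesis
  proof (rule that)
    show "f' x = 0" if "x \<notin> {-B..B}" for x
      using deriv_vanishes_outside[OF d z that] .
    show "deriv f = f'"
      using DERIV_imp_deriv[OF d] by blast
  qed (fact d c z)+
qed

lemma continuous_on_test:
  assumes d: "\<And>x. (f has_real_derivative f' x) (at x)"
  shows "continuous_on S f"
  by (meson DERIV_isCont assms continuous_at_imp_continuous_on)

lemma bounded_test:
  fixes k :: "real \<Rightarrow> real"
  assumes "continuous_on UNIV k" "\<And>x. x \<notin> {l..h} \<Longrightarrow> k x = 0"
  obtains K where "K > 0" "\<And>x. \<bar>k x\<bar> \<le> K" "\<And>x. \<bar>k x\<bar> \<le> K * indicator {l..h} x"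
proof -
  have "compact (k ` {l..h})"
    using assms(1) by (meson compact_Icc compact_continuous_image continuous_on_subset subset_UNIV)
  then obtain B where B: "\<And>x. x \<in> {l..h} \<Longrightarrow> \<bar>k x\<bar> \<le> B"
    using compact_imp_bounded by (force simp: bounded_iff)
  have "\<bar>k x\<bar> \<le> max 1 B * indicator {l..h} x" for x
    using B[of x] assms(2)[of x] by (cases "x \<in> {l..h}") auto
  moreover have "\<bar>k x\<bar> \<le> max 1 B" for x
    using B[of x] assms(2)[of x] by (cases "x \<in> {l..h}") (fastforce simp: max_def)+
  ultimately show thesis
    using that[of "max 1 B"] by auto
qed

lemma integrable_indicator_Icc: "integrable lborel (indicator {l..h::real} :: real \<Rightarrow> real)"
  using borel_integrable_atLeastAtMost'[of l h "\<lambda>_. 1::real"] by (simp add: set_integrable_def)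

text \<open>The inequality \<open>norm (f x) \<le> 1 + (norm (f x))\<^sup>2\<close> turns local
  square integrability into local integrability, and the continuous weight \<open>k\<close> is
  bounded with support in a bounded interval.\<close>

lemma L2loc_integrable:
  fixes f :: "real \<Rightarrow> 'a::euclidean_space" and k :: "real \<Rightarrow> real"
  assumes k: "continuous_on UNIV k" "\<And>x. x \<notin> {l..h} \<Longrightarrow> k x = 0"
    and f: "f \<in> L2loc"
  shows "integrable lborel (\<lambda>x. k x *\<^sub>R f x)"
proof -
  obtain K where K: "K > 0" "\<And>x. \<bar>k x\<bar> \<le> K" "\<And>x. \<bar>k x\<bar> \<le> K * indicator {l..h} x"
    using bounded_test[OF k] by blast
  define R where "R = \<bar>l\<bar> + \<bar>h\<bar> + 1"
  have R: "R > 0" "{l..h} \<subseteq> {-R..R}" by (auto simp: R_def)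
  have i2: "integrable lborel (\<lambda>x. indicator {-R..R} x * (norm (f x))\<^sup>2)"
    using f R by (auto simp: L2loc_def set_integrable_def)
  have i1: "integrable lborel (\<lambda>x. indicator {-R..R} x :: real)"
    by (rule integrable_indicator_Icc)
  have f_m: "f \<in> borel_measurable lborel"
    using f by (simp add: L2loc_def)
  have k_m: "k \<in> borel_measurable lborel"
    using k(1) borel_measurable_continuous_onI by auto
  have le: "norm (k x *\<^sub>R f x) \<le> K * (indicator {-R..R} x + indicator {-R..R} x * (norm (f x))\<^sup>2)" for x
  proof (cases "x \<in> {l..h}")
    case True
    have "norm (f x) \<le> 1 + (norm (f x))\<^sup>2"
      using sum_squares_ge_zero[of "norm (f x) - 1" 0] norm_ge_zero[of "f x"]
      by (simp add: power2_eq_square algebra_simps)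
        (smt (verit) mult_nonneg_nonneg norm_ge_zero)
    then have "\<bar>k x\<bar> * norm (f x) \<le> K * (1 + (norm (f x))\<^sup>2)"
      using K by (intro mult_mono) auto
    moreover have "x \<in> {-R..R}" using True R by blast
    ultimately show ?thesis
      by simp
  next
    case False
    then show ?thesis
      using k(2)[of x] K(1) by (simp add: indicator_def)
  qed
  show ?thesis
  proof (rule Bochner_Integration.integrable_bound)
    show "integrable lborel (\<lambda>x. K * (indicator {-R..R} x + indicator {-R..R} x * (norm (f x))\<^sup>2))"
      using i1 i2 by auto
    show "(\<lambda>x. k x *\<^sub>R f x) \<in> borel_measurable lborel"
      using f_m k_m by measurable
    show "AE x in lborel. norm (k x *\<^sub>R f x)
        \<le> norm (K * (indicator {-R..R} x + indicator {-R..R} x * (norm (f x))\<^sup>2))"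
      using order_trans[OF le abs_ge_self] by simp
  qed
qed

lemma continuous_L2loc:
  fixes f :: "real \<Rightarrow> 'a::euclidean_space"
  assumes "continuous_on UNIV f"
  shows "f \<in> L2loc"
  unfolding L2loc_def
proof (intro CollectI conjI allI impI)
  show "f \<in> borel_measurable lborel"
    using assms borel_measurable_continuous_onI by auto
  show "set_integrable lborel {-R..R} (\<lambda>x. (norm (f x))\<^sup>2)" for R
    by (intro borel_integrable_atLeastAtMost' continuous_intros continuous_on_subset[OF assms]) auto
qed

lemmas continuous_integrable = L2loc_integrable[OF _ _ continuous_L2loc]

lemma continuous_integrable_real:
  fixes k f :: "real \<Rightarrow> real"
  assumes "continuous_on UNIV k" "\<And>x. x \<notin> {l..h} \<Longrightarrow> k x = 0" "continuous_on UNIV f"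
  shows "integrable lborel (\<lambda>x. k x * f x)"
  using continuous_integrable[OF assms] by simp

lemma continuous_integrable_compact:
  fixes k :: "real \<Rightarrow> real"
  assumes "continuous_on UNIV k" "\<And>x. x \<notin> {l..h} \<Longrightarrow> k x = 0"
  shows "integrable lborel k"
  using continuous_integrable_real[of k l h "\<lambda>_. 1"] assms by simp

text \<open>Used with \<open>fst\<close> and \<open>snd\<close>: weak derivatives are taken of
  pair-valued functions, whereas the estimates are made for one component at a time. The operator
  bound of \<open>T\<close> gives the domination.\<close>

lemma L2loc_bounded_linear:
  fixes f :: "real \<Rightarrow> 'a::euclidean_space" and T :: "'a \<Rightarrow> 'b::euclidean_space"
  assumes T: "bounded_linear T" and f: "f \<in> L2loc"
  shows "(\<lambda>x. T (f x)) \<in> L2loc"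
  unfolding L2loc_def
proof (intro CollectI conjI allI impI)
  have fm: "f \<in> borel_measurable lborel"
    using f by (simp add: L2loc_def)
  have Tm: "T \<in> borel_measurable borel"
    by (intro borel_measurable_continuous_onI linear_continuous_on T)
  show m: "(\<lambda>x. T (f x)) \<in> borel_measurable lborel"
    using measurable_compose[OF fm Tm] by simp
  fix R :: real assume "R > 0"
  then have i: "integrable lborel (\<lambda>x. indicator {-R..R} x * (norm (f x))\<^sup>2)"
    using f by (auto simp: L2loc_def set_integrable_def)
  obtain K where K: "\<And>x. norm (T x) \<le> norm x * K"
    using T bounded_linear.bounded by blast
  show "set_integrable lborel {-R..R} (\<lambda>x. (norm (T (f x)))\<^sup>2)"
    unfolding set_integrable_def
  proof (rule Bochner_Integration.integrable_bound)
    show "integrable lborel (\<lambda>x. K\<^sup>2 * (indicator {-R..R} x * (norm (f x))\<^sup>2))"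
      using i by simp
    show "(\<lambda>x. indicat_real {-R..R} x *\<^sub>R (norm (T (f x)))\<^sup>2) \<in> borel_measurable lborel"
      using m by measurable
    have "(norm (T (f x)))\<^sup>2 \<le> K\<^sup>2 * (norm (f x))\<^sup>2" for x
      using power_mono[OF K norm_ge_zero, of "f x" 2] by (simp add: power_mult_distrib mult.commute)
    then show "AE x in lborel. norm (indicat_real {-R..R} x *\<^sub>R (norm (T (f x)))\<^sup>2)
        \<le> norm (K\<^sup>2 * (indicator {-R..R} x * (norm (f x))\<^sup>2))"
      by (auto simp: indicator_def)
  qed
qed

text \<open>Bounded linear maps commute with the integral, so the defining identity can be pushed
  through \<open>T\<close>; both integrands are integrable because test functions have compact
  support.\<close>

lemma is_weak_deriv_bounded_linear:
  fixes f g :: "real \<Rightarrow> 'a::euclidean_space" and T :: "'a \<Rightarrow> 'b::euclidean_space"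
  assumes T: "bounded_linear T" and f: "f \<in> L2loc" and g: "g \<in> L2loc" and w: "is_weak_deriv f g"
  shows "is_weak_deriv (\<lambda>x. T (f x)) (\<lambda>x. T (g x))"
  unfolding is_weak_deriv_def
proof (intro allI impI)
  interpret T: bounded_linear T by (rule T)
  fix \<phi> assume t: "test_function \<phi>"
  obtain \<phi>' l h where p: "\<And>x. (\<phi> has_real_derivative \<phi>' x) (at x)" "continuous_on UNIV \<phi>'"
    "\<And>x. x \<notin> {l..h} \<Longrightarrow> \<phi> x = 0" "\<And>x. x \<notin> {l..h} \<Longrightarrow> \<phi>' x = 0" "deriv \<phi> = \<phi>'"
    using test_functionE[OF t] by metis
  have c: "continuous_on UNIV \<phi>" using continuous_on_test[OF p(1)] .
  have "(LBINT x. deriv \<phi> x *\<^sub>R T (f x)) = (LBINT x. T (\<phi>' x *\<^sub>R f x))"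
    by (simp add: p(5) T.scaleR)
  also have "\<dots> = T (LBINT x. \<phi>' x *\<^sub>R f x)"
    by (intro integral_bounded_linear T L2loc_integrable[OF p(2,4) f])
  also have "\<dots> = T (- (LBINT x. \<phi> x *\<^sub>R g x))"
    using w t p(5) by (auto simp: is_weak_deriv_def)
  also have "\<dots> = - (LBINT x. T (\<phi> x *\<^sub>R g x))"
    by (subst integral_bounded_linear[OF T L2loc_integrable[OF c p(3) g]]) (simp_all add: T.neg)
  finally show "(LBINT x. deriv \<phi> x *\<^sub>R T (f x)) = - (LBINT x. \<phi> x *\<^sub>R T (g x))"
    by (simp add: T.scaleR)
qed

lemma is_weak_deriv_test:
  fixes f g :: "real \<Rightarrow> 'a::euclidean_space"
  assumes "is_weak_deriv f g" "\<And>x. (\<phi> has_real_derivative \<phi>' x) (at x)"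
    "continuous_on UNIV \<phi>'" "\<And>x. x \<notin> {l..h} \<Longrightarrow> \<phi> x = 0"
  shows "(LBINT x. \<phi>' x *\<^sub>R f x) = - (LBINT x. \<phi> x *\<^sub>R g x)"
proof -
  have "deriv \<phi> = \<phi>'"
    using assms(2) DERIV_imp_deriv by blast
  then show ?thesis
    using assms(1) test_functionI[OF assms(2-4)] by (auto simp: is_weak_deriv_def)
qed

lemma is_weak_deriv_diff:
  fixes f g :: "real \<Rightarrow> 'a::euclidean_space"
  assumes "f1 \<in> L2loc" "f2 \<in> L2loc" "g1 \<in> L2loc" "g2 \<in> L2loc"
    and "is_weak_deriv f1 g1" "is_weak_deriv f2 g2"
  shows "is_weak_deriv (\<lambda>x. f1 x - f2 x) (\<lambda>x. g1 x - g2 x)"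
  unfolding is_weak_deriv_def
proof (intro allI impI)
  fix \<phi> assume t: "test_function \<phi>"
  obtain \<phi>' l h where p: "\<And>x. (\<phi> has_real_derivative \<phi>' x) (at x)" "continuous_on UNIV \<phi>'"
    "\<And>x. x \<notin> {l..h} \<Longrightarrow> \<phi> x = 0" "\<And>x. x \<notin> {l..h} \<Longrightarrow> \<phi>' x = 0" "deriv \<phi> = \<phi>'"
    using test_functionE[OF t] by metis
  have c: "continuous_on UNIV \<phi>" using continuous_on_test[OF p(1)] .
  show "(LBINT x. deriv \<phi> x *\<^sub>R (f1 x - f2 x)) = - (LBINT x. \<phi> x *\<^sub>R (g1 x - g2 x))"
    using assms(5,6) t L2loc_integrable[OF p(2,4) assms(1)] L2loc_integrable[OF p(2,4) assms(2)]
      L2loc_integrable[OF c p(3) assms(3)] L2loc_integrable[OF c p(3) assms(4)] p(5)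
    by (auto simp: scaleR_diff_right is_weak_deriv_def)
qed

lemma is_weak_deriv_C1:
  fixes f g :: "real \<Rightarrow> 'a::euclidean_space"
  assumes d: "\<And>x. (f has_vector_derivative g x) (at x)" and g: "continuous_on UNIV g"
  shows "is_weak_deriv f g"
  unfolding is_weak_deriv_def
proof (intro allI impI)
  fix \<phi> assume t: "test_function \<phi>"
  obtain \<phi>' l h where p: "\<And>x. (\<phi> has_real_derivative \<phi>' x) (at x)" "continuous_on UNIV \<phi>'"
    "\<And>x. x \<notin> {l..h} \<Longrightarrow> \<phi> x = 0" "\<And>x. x \<notin> {l..h} \<Longrightarrow> \<phi>' x = 0" "deriv \<phi> = \<phi>'"
    using test_functionE[OF t] by metis
  \<comment> \<open>Both end points lie strictly outside \<open>{l..h}\<close>, so the boundary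
    terms of the fundamental theorem vanish. The maximum keeps \<open>L \<le> H\<close> when
    \<open>{l..h}\<close> is empty.\<close>
  define L H where "L = l - 1" and "H = max l h + 1"
  have c: "continuous_on UNIV \<phi>" using continuous_on_test[OF p(1)] .
  have cf: "continuous_on UNIV f"
    by (meson d continuous_at_imp_continuous_on has_vector_derivative_continuous)
  have "(LBINT x. indicator {L..H} x *\<^sub>R (\<phi> x *\<^sub>R g x + \<phi>' x *\<^sub>R f x))
      = \<phi> H *\<^sub>R f H - \<phi> L *\<^sub>R f L"
  proof (rule integral_FTC_atLeastAtMost)
    show "continuous_on {L..H} (\<lambda>x. \<phi> x *\<^sub>R g x + \<phi>' x *\<^sub>R f x)"
      using c cf p(2) g by (intro continuous_intros) (auto intro: continuous_on_subset)
    show "((\<lambda>x. \<phi> x *\<^sub>R f x) has_vector_derivative \<phi> x *\<^sub>R g x + \<phi>' x *\<^sub>R f x) (at x within {L..H})" for x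
      by (intro has_vector_derivative_scaleR)
        (use p(1) d in \<open>auto intro: has_vector_derivative_at_within has_field_derivative_at_within\<close>)
  qed (simp add: L_def H_def)
  moreover have "indicator {L..H} x *\<^sub>R (\<phi> x *\<^sub>R g x + \<phi>' x *\<^sub>R f x) = \<phi> x *\<^sub>R g x + \<phi>' x *\<^sub>R f x" for x
    using p(3,4)[of x] by (cases "x \<in> {l..h}") (auto simp: L_def H_def indicator_def)
  moreover have "\<phi> H = 0" "\<phi> L = 0"
    by (auto intro!: p(3) simp: H_def L_def)
  ultimately have "(LBINT x. \<phi> x *\<^sub>R g x + \<phi>' x *\<^sub>R f x) = 0"
    by simp
  moreover have "(LBINT x. \<phi> x *\<^sub>R g x + \<phi>' x *\<^sub>R f x) = (LBINT x. \<phi> x *\<^sub>R g x) + (LBINT x. \<phi>' x *\<^sub>R f x)"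
    using continuous_integrable[OF c p(3) g] continuous_integrable[OF p(2,4) cf]
    by (intro Bochner_Integration.integral_add) auto
  ultimately show "(LBINT x. deriv \<phi> x *\<^sub>R f x) = - (LBINT x. \<phi> x *\<^sub>R g x)"
    by (simp add: p(5) eq_neg_iff_add_eq_0 add.commute)
qed

lemma weak_deriv_H1loc:
  assumes "f \<in> H1loc"
  shows "weak_deriv f \<in> L2loc" "is_weak_deriv f (weak_deriv f)" "continuous_on UNIV f"
proof -
  have "\<exists>g. g \<in> L2loc \<and> is_weak_deriv f g"
    using assms by (auto simp: H1loc_def)
  from someI_ex[OF this] show "weak_deriv f \<in> L2loc" "is_weak_deriv f (weak_deriv f)"
    by (simp_all add: weak_deriv_def)
  show "continuous_on UNIV f"
    using assms by (simp add: H1loc_def)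
qed

section \<open>Positive integrals and compactly supported antiderivatives\<close>

lemma LBINT_pos:
  fixes k :: "real \<Rightarrow> real"
  assumes k: "continuous_on UNIV k" "\<And>x. x \<notin> {l..h} \<Longrightarrow> k x = 0" "\<And>x. k x \<ge> 0" "k y > 0"
  shows "(LBINT x. k x) > 0"
proof -
  have "(\<lambda>x. k x) \<midarrow>y\<rightarrow> k y"
    using k(1) by (simp add: continuous_on_eq_continuous_at isCont_def)
  then have "\<forall>\<^sub>F x in at y. k x > k y / 2"
    by (rule order_tendstoD) (use k(4) in simp)
  then obtain d where d: "d > 0" "\<And>x. \<lbrakk>x \<noteq> y; dist x y < d\<rbrakk> \<Longrightarrow> k x > k y / 2"
    by (auto simp: eventually_at)
  \<comment> \<open>By continuity \<open>k\<close> stays above half of its value at \<open>y\<close>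
    on a short interval to the right of \<open>y\<close>; this step function bounds the integral
    from below.\<close>
  have le: "k y / 2 * indicator {y..y + d/2} x \<le> k x" for x
    using d(2)[of x] d(1) k(3)[of x] k(4) by (cases "x = y") (auto simp: indicator_def dist_real_def)
  have "0 < k y / 2 * (d/2)"
    using d k by simp
  also have "\<dots> = (LBINT x. k y / 2 * indicator {y..y + d/2} x)"
    using d(1) by simp
  also have "\<dots> \<le> (LBINT x. k x)"
  proof (rule integral_mono[OF _ continuous_integrable_compact[OF k(1,2)] le])
    show "integrable lborel (\<lambda>x. k y / 2 * indicator {y..y + d/2} x)"
      by (intro integrable_mult_right integrable_indicator_Icc)
  qed
  finally show ?thesis .
qed

lemma antiderivative_exists:
  fixes k :: "real \<Rightarrow> real"
  assumes "continuous_on UNIV k"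
  obtains F where "\<And>x. (F has_real_derivative k x) (at x)"
proof -
  have "\<exists>F. \<forall>x :: real. -\<infinity> < ereal x \<longrightarrow> x < (\<infinity>::ereal) \<longrightarrow> (F has_vector_derivative k x) (at x)"
    by (rule einterval_antiderivative) (use assms in \<open>auto simp: continuous_on_eq_continuous_at\<close>)
  then show thesis
    using that by (auto simp: has_real_derivative_iff_has_vector_derivative)
qed

text \<open>Vanishing total mass is what gives the antiderivative compact support: normalized to be
  0 at \<open>l\<close>, it equals the whole integral of \<open>k\<close> beyond
  \<open>h\<close>.\<close>

lemma antiderivative_compact:
  fixes k :: "real \<Rightarrow> real"
  assumes k: "continuous_on UNIV k" "\<And>x. x \<notin> {l..h} \<Longrightarrow> k x = 0" and int: "(LBINT x. k x) = 0"
    and lh: "l \<le> h"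
  obtains H where "\<And>x. (H has_real_derivative k x) (at x)" "\<And>x. x \<notin> {l..h} \<Longrightarrow> H x = 0"
    "\<And>x. \<bar>H x\<bar> \<le> (LBINT x. \<bar>k x\<bar>)"
proof -
  obtain F where F: "\<And>x. (F has_real_derivative k x) (at x)"
    using antiderivative_exists[OF k(1)] by blast
  define H where "H x = F x - F l" for x
  have ftc: "(LBINT t. indicator {x..y} t * k t) = H y - H x" if "x \<le> y" for x y
    using integral_FTC_atLeastAtMost[OF that, of F k] F continuous_on_subset[OF k(1)]
    by (auto simp: H_def has_real_derivative_iff_has_vector_derivative has_vector_derivative_at_within)
  have Hl: "H l = 0" by (simp add: H_def)

  have low: "H x = 0" if "x < l" for x
  proof -
    \<comment> \<open>The interval \<open>{x..l}\<close> meets the support interval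
      \<open>{l..h}\<close> only in \<open>l\<close>, a null set.\<close>
    have "AE t in lborel. indicator {x..l} t * k t = 0"
      using AE_lborel_singleton[of l] by eventually_elim (auto simp: indicator_def k(2))
    then have "(LBINT t. indicator {x..l} t * k t) = 0"
      by (rule integral_eq_zero_AE)
    then show ?thesis
      using ftc[of x l] that Hl by simp
  qed
  have high: "H x = 0" if "x > h" for x
  proof -
    have "(\<lambda>t. indicator {l..x} t * k t) = k"
      using that k(2) by (force simp: indicator_def fun_eq_iff)
    then show ?thesis
      using ftc[of l x] that int Hl lh by simp
  qed
  have kint: "integrable lborel k"
    using continuous_integrable_compact[OF k] .
  have "\<bar>H x\<bar> \<le> (LBINT x. \<bar>k x\<bar>)" for x
  proof (cases "x < l")
    case True
    then show ?thesis using low by simp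
  next
    case False
    have "\<bar>H x\<bar> = \<bar>LBINT t. indicator {l..x} t * k t\<bar>"
      using ftc[of l x] False Hl by simp
    also have "\<dots> \<le> (LBINT t. \<bar>indicator {l..x} t * k t\<bar>)"
      by (rule integral_abs_bound)
    also have "\<dots> \<le> (LBINT t. \<bar>k t\<bar>)"
    proof (rule integral_mono)
      show "integrable lborel (\<lambda>t. \<bar>indicator {l..x} t * k t\<bar>)"
        using integrable_mult_indicator[OF _ kint, of "{l..x}"] by (intro integrable_abs) simp
    qed (use kint in \<open>auto simp: indicator_def\<close>)
    finally show ?thesis .
  qed
  moreover have "(H has_real_derivative k x) (at x)" for x
    unfolding H_def[abs_def] using F[of x] by (auto intro!: derivative_eq_intros)
  moreover have "H x = 0" if "x \<notin> {l..h}" for x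
    using that low high by force
  ultimately show thesis
    using that by blast
qed

subsection \<open>Local smallness\<close>

text \<open>The only consequence of an \<open>L\<^sup>2\<close> bound that is needed; unlike \<open>L2_enorm\<close> it
  satisfies the triangle inequality for trivial reasons.\<close>

definition loc_small :: "real \<Rightarrow> (real \<Rightarrow> 'a::euclidean_space) \<Rightarrow> bool" where
  "loc_small \<epsilon> d \<longleftrightarrow> d \<in> borel_measurable lborel \<and>
     (\<forall>l h. l \<le> h \<longrightarrow> integrable lborel (\<lambda>x. indicator {l..h} x * norm (d x)) \<and>
        (LBINT x. indicator {l..h} x * norm (d x)) \<le> \<epsilon> * (h - l + 1))"

lemma loc_smallD:
  assumes "loc_small \<epsilon> d" "l \<le> h"
  shows "integrable lborel (\<lambda>x. indicator {l..h} x * norm (d x))"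
    "(LBINT x. indicator {l..h} x * norm (d x)) \<le> \<epsilon> * (h - l + 1)"
  using assms by (auto simp: loc_small_def)

text \<open>Young's inequality \<open>norm (d x) \<le> \<epsilon> + (norm (d x))\<^sup>2 /
  \<epsilon>\<close>, integrated over \<open>{l..h}\<close>: the constant contributes
  \<open>\<epsilon> * (h - l)\<close> and the square at most \<open>\<epsilon>\<close>. This is
  where the factor \<open>h - l + 1\<close> comes from.\<close>

lemma loc_small_L2_enorm:
  fixes d :: "real \<Rightarrow> 'a::euclidean_space"
  assumes m: "d \<in> borel_measurable lborel" and e: "\<epsilon> > 0" and L: "L2_enorm d \<le> ennreal \<epsilon>"
  shows "loc_small \<epsilon> d"
  unfolding loc_small_def
proof (intro conjI m allI impI)
  define I where "I = (\<integral>\<^sup>+ x. ennreal ((norm (d x))\<^sup>2) \<partial>lborel)"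
  have Ifin: "I \<noteq> \<infinity>"
    using L by (auto simp: L2_enorm_def I_def[symmetric] top_unique)
  have "ennreal (sqrt (enn2real I)) \<le> ennreal \<epsilon>"
    using L Ifin by (simp add: L2_enorm_def I_def[symmetric])
  then have "sqrt (enn2real I) \<le> \<epsilon>"
    using e by simp
  then have Ile: "enn2real I \<le> \<epsilon>\<^sup>2"
    by (simp add: sqrt_le_D)
  have int: "integrable lborel (\<lambda>x. (norm (d x))\<^sup>2)"
    using m Ifin by (intro integrableI_nonneg) (auto simp: I_def[symmetric] top.not_eq_extremum)
  have le: "(LBINT x. (norm (d x))\<^sup>2) \<le> \<epsilon>\<^sup>2"
    using Ile m by (subst integral_eq_nn_integral) (auto simp: I_def)
  fix l h :: real assume lh: "l \<le> h"
  have p: "indicator {l..h} x * norm (d x) \<le> \<epsilon> * indicator {l..h} x + (norm (d x))\<^sup>2 / \<epsilon>" for x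
  proof -
    have "norm (d x) * \<epsilon> = (norm (d x))\<^sup>2 + \<epsilon>\<^sup>2/4 - (norm (d x) - \<epsilon>/2)\<^sup>2"
      by (simp add: power2_eq_square field_simps)
    then have "norm (d x) * \<epsilon> \<le> \<epsilon>\<^sup>2 + (norm (d x))\<^sup>2"
      using zero_le_power2[of "norm (d x) - \<epsilon>/2"] zero_le_power2[of \<epsilon>] by linarith
    then have "norm (d x) \<le> \<epsilon> + (norm (d x))\<^sup>2 / \<epsilon>"
      using e by (simp add: field_simps power2_eq_square)
    then show ?thesis
      using e by (auto simp: indicator_def)
  qed
  have int2: "integrable lborel (\<lambda>x. \<epsilon> * indicator {l..h} x + (norm (d x))\<^sup>2 / \<epsilon>)"
    using int integrable_indicator_Icc by auto
  show i: "integrable lborel (\<lambda>x. indicator {l..h} x * norm (d x))"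
  proof (rule Bochner_Integration.integrable_bound[OF int2])
    show "(\<lambda>x. indicat_real {l..h} x * norm (d x)) \<in> borel_measurable lborel"
      using m by measurable
    show "AE x in lborel. norm (indicat_real {l..h} x * norm (d x))
        \<le> norm (\<epsilon> * indicat_real {l..h} x + (norm (d x))\<^sup>2 / \<epsilon>)"
      using p by (intro AE_I2) (smt (verit) real_norm_def indicator_pos_le mult_nonneg_nonneg norm_ge_zero)
  qed
  have "(LBINT x. indicator {l..h} x * norm (d x))
      \<le> (LBINT x. \<epsilon> * indicator {l..h} x + (norm (d x))\<^sup>2 / \<epsilon>)"
    using p by (intro integral_mono i int2)
  also have "\<dots> = \<epsilon> * (h - l) + (LBINT x. (norm (d x))\<^sup>2) / \<epsilon>"
    using int integrable_indicator_Icc lh by (subst Bochner_Integration.integral_add) auto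
  also have "\<dots> \<le> \<epsilon> * (h - l) + \<epsilon>\<^sup>2 / \<epsilon>"
    using le e by (intro add_left_mono divide_right_mono) auto
  also have "\<dots> = \<epsilon> * (h - l + 1)"
    using e by (simp add: field_simps power2_eq_square)
  finally show "(LBINT x. indicator {l..h} x * norm (d x)) \<le> \<epsilon> * (h - l + 1)" .
qed

lemma loc_small_bound:
  assumes d: "loc_small \<epsilon> d" and m: "f \<in> borel_measurable lborel" and K: "K \<ge> 0"
    and b: "\<And>x. norm (f x) \<le> K * norm (d x)"
  shows "loc_small (K * \<epsilon>) f"
  unfolding loc_small_def
proof (intro conjI m allI impI)
  fix l h :: real assume lh: "l \<le> h"
  note D = loc_smallD[OF d lh]
  have p: "indicator {l..h} x * norm (f x) \<le> K * (indicator {l..h} x * norm (d x))" for x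
    using b[of x] by (simp add: indicator_def)
  show i: "integrable lborel (\<lambda>x. indicator {l..h} x * norm (f x))"
  proof (rule Bochner_Integration.integrable_bound[OF integrable_mult_right[OF D(1), of K]])
    show "(\<lambda>x. indicat_real {l..h} x * norm (f x)) \<in> borel_measurable lborel"
      using m by measurable
    show "AE x in lborel. norm (indicat_real {l..h} x * norm (f x))
        \<le> norm (K * (indicator {l..h} x * norm (d x)))"
      using p K by (intro AE_I2) (simp add: abs_mult)
  qed
  have "(LBINT x. indicator {l..h} x * norm (f x)) \<le> (LBINT x. K * (indicator {l..h} x * norm (d x)))"
    using p D(1) by (intro integral_mono i) auto
  also have "\<dots> \<le> K * (\<epsilon> * (h - l + 1))"
    using D(2) K by (simp add: mult_left_mono)
  finally show "(LBINT x. indicator {l..h} x * norm (f x)) \<le> K * \<epsilon> * (h - l + 1)"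
    by (simp add: mult.assoc)
qed

lemma loc_small_add:
  assumes "loc_small \<epsilon>1 f" "loc_small \<epsilon>2 g"
  shows "loc_small (\<epsilon>1 + \<epsilon>2) (\<lambda>x. f x + g x)"
  unfolding loc_small_def
proof (intro conjI allI impI)
  show m: "(\<lambda>x. f x + g x) \<in> borel_measurable lborel"
    using assms by (auto simp: loc_small_def)
  fix l h :: real assume lh: "l \<le> h"
  note D1 = loc_smallD[OF assms(1) lh] and D2 = loc_smallD[OF assms(2) lh]
  have p: "indicator {l..h} x * norm (f x + g x)
      \<le> indicator {l..h} x * norm (f x) + indicator {l..h} x * norm (g x)" for x
    by (auto simp: indicator_def norm_triangle_ineq)
  have i2: "integrable lborel (\<lambda>x. indicator {l..h} x * norm (f x) + indicator {l..h} x * norm (g x))"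
    using D1(1) D2(1) by auto
  show i: "integrable lborel (\<lambda>x. indicator {l..h} x * norm (f x + g x))"
  proof (rule Bochner_Integration.integrable_bound[OF i2])
    show "(\<lambda>x. indicat_real {l..h} x * norm (f x + g x)) \<in> borel_measurable lborel"
      using m by measurable
    show "AE x in lborel. norm (indicat_real {l..h} x * norm (f x + g x))
        \<le> norm (indicator {l..h} x * norm (f x) + indicator {l..h} x * norm (g x))"
      by (intro AE_I2) (auto simp: indicator_def norm_triangle_ineq)
  qed
  have "(LBINT x. indicator {l..h} x * norm (f x + g x))
      \<le> (LBINT x. indicator {l..h} x * norm (f x) + indicator {l..h} x * norm (g x))"
    using p by (intro integral_mono i i2)
  also have "\<dots> \<le> (\<epsilon>1 + \<epsilon>2) * (h - l + 1)"
    using D1 D2 by (simp add: ring_distribs)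
  finally show "(LBINT x. indicator {l..h} x * norm (f x + g x)) \<le> (\<epsilon>1 + \<epsilon>2) * (h - l + 1)" .
qed

lemma loc_small_minus: "loc_small \<epsilon> f \<Longrightarrow> loc_small \<epsilon> (\<lambda>x. - f x)"
  by (auto simp: loc_small_def)

lemma loc_small_diff:
  assumes "loc_small \<epsilon>1 f" "loc_small \<epsilon>2 g"
  shows "loc_small (\<epsilon>1 + \<epsilon>2) (\<lambda>x. f x - g x)"
  using loc_small_add[OF assms(1) loc_small_minus[OF assms(2)]] by simp

lemma loc_small_pairing:
  fixes d :: "real \<Rightarrow> 'a::euclidean_space" and k :: "real \<Rightarrow> real"
  assumes d: "loc_small \<epsilon> d" and lh: "l \<le> h" and K: "K \<ge> 0"
    and kb: "\<And>x. \<bar>k x\<bar> \<le> K * indicator {l..h} x"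
  shows "norm (LBINT x. k x *\<^sub>R d x) \<le> K * \<epsilon> * (h - l + 1)"
proof -
  note D = loc_smallD[OF d lh]
  have p: "norm (k x *\<^sub>R d x) \<le> K * (indicator {l..h} x * norm (d x))" for x
    using mult_right_mono[OF kb[of x] norm_ge_zero[of "d x"]] by (simp add: mult.assoc)
  have "norm (LBINT x. k x *\<^sub>R d x) \<le> (LBINT x. K * (indicator {l..h} x * norm (d x)))"
  proof (cases "integrable lborel (\<lambda>x. k x *\<^sub>R d x)")
    case True
    then show ?thesis
      using D(1) p by (intro Bochner_Integration.integral_norm_bound_integral) auto
  next
    \<comment> \<open>Without integrability the integral has the default value 0, and the bound is
      trivial.\<close>
    case False
    then show ?thesis
      using K by (simp add: not_integrable_integral_eq)
  qed
  also have "\<dots> \<le> K * (\<epsilon> * (h - l + 1))"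
    using D(2) K by (simp add: mult_left_mono)
  finally show ?thesis
    by (simp add: mult.assoc)
qed

text \<open>If the norm exceeded 3 on a whole unit interval, its integral there would be at least 3,
  while local smallness with \<open>\<epsilon> \<le> 1\<close> allows at most 2.\<close>

lemma loc_small_point:
  fixes d :: "real \<Rightarrow> 'a::euclidean_space"
  assumes d: "loc_small \<epsilon> d" and e: "\<epsilon> \<le> 1"
  shows "\<exists>y. x \<le> y \<and> y \<le> x + 1 \<and> norm (d y) \<le> 3"
proof (rule ccontr)
  assume "\<nexists>y. x \<le> y \<and> y \<le> x + 1 \<and> norm (d y) \<le> 3"
  then have n: "norm (d y) > 3" if "x \<le> y" "y \<le> x + 1" for y
    using that by (meson not_less)
  have "3 = (LBINT y. 3 * indicator {x..x+1} y :: real)"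
    by simp
  also have "\<dots> \<le> (LBINT y. indicator {x..x+1} y * norm (d y))"
  proof (rule integral_mono)
    show "integrable lborel (\<lambda>y. 3 * indicat_real {x..x + 1} y)"
      by (intro integrable_mult_right integrable_indicator_Icc)
    show "integrable lborel (\<lambda>y. indicat_real {x..x + 1} y * norm (d y))"
      by (rule loc_smallD[OF d]) simp
    show "3 * indicat_real {x..x + 1} y \<le> indicat_real {x..x + 1} y * norm (d y)" for y
      using n[of y] by (auto simp: indicator_def)
  qed
  also have "\<dots> \<le> \<epsilon> * 2"
    using loc_smallD(2)[OF d, of x "x+1"] by simp
  finally show False
    using e by simp
qed

text \<open>Test with the antiderivative of a difference of two approximate Dirac masses.\<close>

lemma weak_deriv_increment:
  fixes f g :: "real \<Rightarrow> 'a::euclidean_space"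
  assumes c: "continuous_on UNIV f" and w: "is_weak_deriv f g" and s: "loc_small \<epsilon> g"
    and e: "\<epsilon> \<ge> 0" and xy: "x \<le> y"
  shows "norm (f x - f y) \<le> 2 * \<epsilon> * (y - x + 3)"
proof (rule field_le_epsilon)
  fix e0 :: real assume e0: "e0 > 0"
  define e where "e = e0 / 2"
  have "e > 0" using e0 by (simp add: e_def)
  have "\<exists>h>0. \<forall>z'. dist z' z < h \<longrightarrow> dist (f z') (f z) < e" for z
    using c \<open>e > 0\<close> by (auto simp: continuous_on_iff)
  then obtain h1 h2 where h12: "h1 > 0" "h2 > 0"
    "\<And>z'. dist z' x < h1 \<Longrightarrow> dist (f z') (f x) < e" "\<And>z'. dist z' y < h2 \<Longrightarrow> dist (f z') (f y) < e"
    by metis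
  define h where "h = min 1 (min h1 h2)"
  have h: "h > 0" "h \<le> 1" "\<And>z'. dist z' x < h \<Longrightarrow> dist (f z') (f x) < e"
    "\<And>z'. dist z' y < h \<Longrightarrow> dist (f z') (f y) < e"
    using h12 by (auto simp: h_def)
  \<comment> \<open>The tent \<open>k z\<close>, divided by its mass \<open>N\<close>, becomes the
    approximate Dirac mass \<open>q z\<close>. The half-width \<open>h\<close> is so small that
    averaging \<open>f\<close> near \<open>x\<close> or \<open>y\<close> costs at most
    \<open>e\<close> each, and \<open>h \<le> 1\<close> keeps both tents inside
    \<open>{x-1..y+1}\<close>.\<close>
  define k where "k z t = max 0 (h - \<bar>t - z\<bar>)" for z t :: real
  define N where "N = (LBINT t. k 0 t)"
  have kc: "continuous_on UNIV (k z)" for z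
    unfolding k_def by (intro continuous_intros)
  have k0: "k z t \<ge> 0" for z t by (simp add: k_def)
  have ksupp: "k z t = 0" if "t \<notin> {z-h..z+h}" for z t
    using that by (auto simp: k_def)
  have k00: "k 0 0 > 0"
    using h(1) by (simp add: k_def)
  have Npos: "N > 0"
    unfolding N_def by (rule LBINT_pos[OF kc ksupp k0 k00])
  have kN: "(LBINT t. k z t) = N" for z
    using lborel_integral_real_affine[of 1 "k z" z] by (simp add: N_def k_def)
  define q where "q z t = k z t / N" for z t
  have qc: "continuous_on UNIV (q z)" for z
    unfolding q_def by (intro continuous_intros kc) (use Npos in auto)
  have q0: "q z t \<ge> 0" for z t using k0 Npos by (simp add: q_def)
  have qsupp: "q z t = 0" if "t \<notin> {z-h..z+h}" for z t
    using ksupp[OF that] by (simp add: q_def)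
  have qi: "integrable lborel (q z)" for z
    using continuous_integrable_compact[OF qc qsupp] .
  have q1: "(LBINT t. q z t) = 1" for z
    using Npos by (simp add: q_def[abs_def] kN)
  have appr: "norm ((LBINT t. q z t *\<^sub>R f t) - f z) \<le> e"
    if z: "\<And>z'. dist z' z < h \<Longrightarrow> dist (f z') (f z) < e" for z
  proof -
    have i1: "integrable lborel (\<lambda>t. q z t *\<^sub>R f t)"
      by (rule continuous_integrable[OF qc qsupp c])
    have i2: "integrable lborel (\<lambda>t. q z t *\<^sub>R f z)"
      using qi by auto
    have "(LBINT t. q z t *\<^sub>R f t) - f z = (LBINT t. q z t *\<^sub>R (f t - f z))"
      using i1 i2 q1[of z] qi by (simp add: scaleR_diff_right)
    moreover have "norm (LBINT t. q z t *\<^sub>R (f t - f z)) \<le> (LBINT t. q z t * e)"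
    proof (rule Bochner_Integration.integral_norm_bound_integral)
      show "integrable lborel (\<lambda>t. q z t *\<^sub>R (f t - f z))"
        using i1 i2 by (simp add: scaleR_diff_right)
      show "integrable lborel (\<lambda>t. q z t * e)"
        using qi by auto
      show "norm (q z t *\<^sub>R (f t - f z)) \<le> q z t * e" for t
      proof (cases "\<bar>t - z\<bar> < h")
        case True
        then have "norm (f t - f z) \<le> e"
          using z[of t] by (simp add: dist_norm dist_real_def)
        then show ?thesis
          using q0 by (simp add: mult_left_mono)
      next
        case False
        then have "q z t = 0" by (simp add: q_def k_def)
        then show ?thesis by simp
      qed
    qed
    moreover have "(LBINT t. q z t * e) = e"
      using q1[of z] by simp
    ultimately show ?thesis using \<open>e > 0\<close> by simp
  qed
  define p where "p t = q x t - q y t" for t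
  have pc: "continuous_on UNIV p"
    unfolding p_def by (intro continuous_intros qc)
  have psupp: "p t = 0" if "t \<notin> {x-1..y+1}" for t
    using that qsupp[of t x] qsupp[of t y] h(2) xy by (auto simp: p_def)
  have "(LBINT t. p t) = 0"
    using qi q1 by (simp add: p_def)
  moreover have "x - 1 \<le> y + 1" using xy by simp
  ultimately obtain H where H: "\<And>t. (H has_real_derivative p t) (at t)" "\<And>t. t \<notin> {x-1..y+1} \<Longrightarrow> H t = 0"
    "\<And>t. \<bar>H t\<bar> \<le> (LBINT t. \<bar>p t\<bar>)"
    using antiderivative_compact[OF pc psupp] by blast
  \<comment> \<open>Two unit masses bound the antiderivative \<open>H\<close> of \<open>p\<close> by
    2. Its support has length \<open>y - x + 2\<close>, and the extra one in
    \<open>loc_small\<close> makes this \<open>y - x + 3\<close>.\<close>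
  have "(LBINT t. \<bar>p t\<bar>) \<le> (LBINT t. q x t + q y t)"
    using qi q0 continuous_integrable_compact[OF pc psupp]
    by (intro integral_mono) (auto simp: p_def intro!: abs_triangle_ineq4[THEN order_trans])
  also have "\<dots> = 2"
    using qi q1 by simp
  finally have Hb: "\<bar>H t\<bar> \<le> 2 * indicator {x-1..y+1} t" for t
    using H(2)[of t] H(3)[of t] by (cases "t \<in> {x-1..y+1}") auto
  have "norm (LBINT t. p t *\<^sub>R f t) = norm (LBINT t. H t *\<^sub>R g t)"
    using is_weak_deriv_test[OF w H(1) pc H(2)] by simp
  also have "\<dots> \<le> 2 * \<epsilon> * (y + 1 - (x - 1) + 1)"
    using xy by (intro loc_small_pairing[OF s _ _ Hb]) auto
  finally have 1: "norm (LBINT t. p t *\<^sub>R f t) \<le> 2 * \<epsilon> * (y - x + 3)"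
    by (simp add: algebra_simps)
  have "(LBINT t. p t *\<^sub>R f t) = (LBINT t. q x t *\<^sub>R f t) - (LBINT t. q y t *\<^sub>R f t)"
    using continuous_integrable[OF qc qsupp c] by (simp add: p_def scaleR_diff_left)
  then have "f x - f y = ((LBINT t. p t *\<^sub>R f t) - ((LBINT t. q x t *\<^sub>R f t) - f x))
      + ((LBINT t. q y t *\<^sub>R f t) - f y)"
    by simp
  then have "norm (f x - f y) \<le> norm ((LBINT t. p t *\<^sub>R f t) - ((LBINT t. q x t *\<^sub>R f t) - f x))
      + norm ((LBINT t. q y t *\<^sub>R f t) - f y)"
    by (simp only: norm_triangle_ineq)
  with norm_triangle_ineq4[of "LBINT t. p t *\<^sub>R f t" "(LBINT t. q x t *\<^sub>R f t) - f x"]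
    1 appr[OF h(3)] appr[OF h(4)] have "norm (f x - f y) \<le> 2 * \<epsilon> * (y - x + 3) + e + e"
    by linarith
  then show "norm (f x - f y) \<le> 2 * \<epsilon> * (y - x + 3) + e0"
    by (simp add: e_def)
qed

subsection \<open>Choosing a test function\<close>

text \<open>\<open>C\<^sup>3\<close> rather than \<open>C\<^sup>1\<close>: the derivatives \<open>\<phi>\<close> and \<open>\<phi>'\<close> of a \<open>\<Phi>\<close> in this space will again
  serve as test functions for weak derivatives.\<close>

definition C3_test :: "(real \<Rightarrow> real) set" where
  "C3_test = {F. \<exists>F1 F2 F3 R. (\<forall>x. (F has_real_derivative F1 x) (at x) \<and>
      (F1 has_real_derivative F2 x) (at x) \<and> (F2 has_real_derivative F3 x) (at x)) \<and>
      continuous_on UNIV F3 \<and> (\<forall>x. x \<notin> {-R..R} \<longrightarrow> F x = 0)}"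

lemma C3_testE:
  assumes "F \<in> C3_test"
  obtains F1 F2 F3 R where "\<And>x. (F has_real_derivative F1 x) (at x)"
    "\<And>x. (F1 has_real_derivative F2 x) (at x)" "\<And>x. (F2 has_real_derivative F3 x) (at x)"
    "continuous_on UNIV F3" "\<And>x. x \<notin> {-R..R} \<Longrightarrow> F x = 0"
  using assms unfolding C3_test_def by blast

lemma C3_test_continuous: "F \<in> C3_test \<Longrightarrow> continuous_on UNIV F"
  by (erule C3_testE) (rule continuous_on_test)

lemma C3_test_lincomb:
  assumes "F \<in> C3_test" "G \<in> C3_test"
  shows "(\<lambda>x. F x + c * G x) \<in> C3_test"
proof -
  obtain F1 F2 F3 R where F: "\<And>x. (F has_real_derivative F1 x) (at x)"
    "\<And>x. (F1 has_real_derivative F2 x) (at x)" "\<And>x. (F2 has_real_derivative F3 x) (at x)"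
    "continuous_on UNIV F3" "\<And>x. x \<notin> {-R..R} \<Longrightarrow> F x = 0"
    using assms(1) by (rule C3_testE) blast
  obtain G1 G2 G3 S where G: "\<And>x. (G has_real_derivative G1 x) (at x)"
    "\<And>x. (G1 has_real_derivative G2 x) (at x)" "\<And>x. (G2 has_real_derivative G3 x) (at x)"
    "continuous_on UNIV G3" "\<And>x. x \<notin> {-S..S} \<Longrightarrow> G x = 0"
    using assms(2) by (rule C3_testE) blast
  show ?thesis
    unfolding C3_test_def
  proof (intro CollectI exI conjI allI impI)
    show "((\<lambda>x. F x + c * G x) has_real_derivative F1 x + c * G1 x) (at x)" for x
      using F(1)[of x] G(1)[of x] by (auto intro!: derivative_eq_intros)
    show "((\<lambda>x. F1 x + c * G1 x) has_real_derivative F2 x + c * G2 x) (at x)" for x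
      using F(2)[of x] G(2)[of x] by (auto intro!: derivative_eq_intros)
    show "((\<lambda>x. F2 x + c * G2 x) has_real_derivative F3 x + c * G3 x) (at x)" for x
      using F(3)[of x] G(3)[of x] by (auto intro!: derivative_eq_intros)
    show "continuous_on UNIV (\<lambda>x. F3 x + c * G3 x)"
      by (intro continuous_intros F G)
    show "F x + c * G x = 0" if "x \<notin> {-max R S..max R S}" for x
    proof -
      have "x \<notin> {-R..R}" "x \<notin> {-S..S}" using that by auto
      then show ?thesis using F(5) G(5) by simp
    qed
  qed
qed

text \<open>Only the corner at 0 needs an argument: the difference quotient there is at most
  \<open>\<bar>h\<bar> ^ n\<close>, which tends to 0 because \<open>n \<ge> 1\<close>.\<close>

lemma DERIV_pos_part_power:
  fixes x :: real
  assumes "n \<ge> 1"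
  shows "((\<lambda>x. (max 0 x) ^ Suc n) has_real_derivative real (Suc n) * (max 0 x) ^ n) (at x)"
proof -
  consider "x > 0" | "x < 0" | "x = 0" by linarith
  then show ?thesis
  proof cases
    case 1
    have "((\<lambda>x. x ^ Suc n) has_real_derivative real (Suc n) * x ^ n) (at x)"
      using DERIV_pow[of "Suc n" x] by simp
    then have "((\<lambda>x. (max 0 x) ^ Suc n) has_real_derivative real (Suc n) * x ^ n) (at x)"
      by (rule has_field_derivative_transform_within_open[where S = "{0<..}"]) (use 1 in auto)
    then show ?thesis using 1 by simp
  next
    case 2
    have "((\<lambda>x. 0) has_real_derivative 0) (at x)"
      by simp
    then have "((\<lambda>x. (max 0 x) ^ Suc n) has_real_derivative 0) (at x)"
      by (rule has_field_derivative_transform_within_open[where S = "{..<0}"]) (use 2 in auto)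
    then show ?thesis using 2 assms by (simp add: power_0_left)
  next
    case 3
    have "((\<lambda>h. (max 0 h) ^ Suc n / h) \<longlongrightarrow> 0) (at (0::real))"
    proof (rule Lim_null_comparison[where g = "\<lambda>h. \<bar>h\<bar> ^ n"])
      show "\<forall>\<^sub>F h in at (0::real). norm ((max 0 h) ^ Suc n / h) \<le> \<bar>h\<bar> ^ n"
        by (intro always_eventually allI) (auto simp: max_def abs_mult)
      have "((\<lambda>h::real. \<bar>h\<bar> ^ n) \<longlongrightarrow> \<bar>0\<bar> ^ n) (at 0)"
        by (intro tendsto_intros)
      then show "((\<lambda>h::real. \<bar>h\<bar> ^ n) \<longlongrightarrow> 0) (at 0)"
        using assms by (simp add: power_0_left)
    qed
    then show ?thesis
      using 3 assms by (simp add: DERIV_def power_0_left)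
  qed
qed

text \<open>Each differentiation costs one power of the truncated quadratic. Starting from the
  fourth power, every term of the third derivative still contains a factor \<open>?q x\<close>,
  which is continuous.\<close>

lemma C3_bump:
  assumes r: "r > 0"
  shows "(\<lambda>x. (max 0 (r\<^sup>2 - (x - y)\<^sup>2)) ^ 4) \<in> C3_test"
  unfolding C3_test_def
proof (intro CollectI exI conjI allI impI)
  let ?q = "\<lambda>x. max 0 (r\<^sup>2 - (x - y)\<^sup>2)"
  have d: "((\<lambda>x. (?q x) ^ Suc n) has_real_derivative real (Suc n) * (?q x) ^ n * (-2 * (x - y))) (at x)"
    if "n \<ge> 1" for n x
  proof -
    have i: "((\<lambda>x. r\<^sup>2 - (x - y)\<^sup>2) has_real_derivative -2 * (x - y)) (at x)"
      by (auto intro!: derivative_eq_intros)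
    show ?thesis
      using DERIV_chain2[OF DERIV_pos_part_power[OF that] i] .
  qed
  have d4: "((\<lambda>x. (?q x) ^ 4) has_real_derivative 4 * (?q x) ^ 3 * (-2 * (x - y))) (at x)" for x
    using d[of 3 x] by (simp add: eval_nat_numeral)
  have d3: "((\<lambda>x. (?q x) ^ 3) has_real_derivative 3 * (?q x) ^ 2 * (-2 * (x - y))) (at x)" for x
    using d[of 2 x] by (simp add: eval_nat_numeral)
  have d2: "((\<lambda>x. (?q x) ^ 2) has_real_derivative 2 * ?q x * (-2 * (x - y))) (at x)" for x
    using d[of 1 x] by (simp add: eval_nat_numeral)
  \<comment> \<open>Normal forms for the derivatives that the product and chain rules produce, with
    \<open>q\<close> for the truncated quadratic and \<open>w\<close> for
    \<open>x - y\<close>.\<close>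
  have alg: "-8 * (3 * q\<^sup>2 * (-2 * w) * w + 1 * q ^ 3) = 48 * (q\<^sup>2 * w\<^sup>2) - 8 * q ^ 3"
    "48 * (2 * q * (-2 * w) * w\<^sup>2 + 2 * w * q\<^sup>2) - 8 * (3 * q\<^sup>2 * (-2 * w)) = - 192 * (q * w ^ 3) + 144 * (q\<^sup>2 * w)"
    "4 * p * (-2 * w) = -8 * (p * w)"
    for p q w :: real
    by (simp_all add: power2_eq_square power3_eq_cube algebra_simps)
  show "((\<lambda>x. (?q x) ^ 4) has_real_derivative -8 * (?q x ^ 3 * (x - y))) (at x)" for x
    using d4[of x] by (simp only: alg(3))
  have e1: "((\<lambda>x. x - y) has_real_derivative 1) (at x)" for x
    by (auto intro!: derivative_eq_intros)
  have e2: "((\<lambda>x. (x - y)\<^sup>2) has_real_derivative 2 * (x - y)) (at x)" for x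
    using DERIV_power[OF e1, of 2 x] by simp
  show "((\<lambda>x. -8 * (?q x ^ 3 * (x - y))) has_real_derivative
      48 * (?q x ^ 2 * (x - y)\<^sup>2) - 8 * ?q x ^ 3) (at x)" for x
    using DERIV_cmult[OF DERIV_mult[OF d3 e1], of "-8"] by (simp only: alg(1))
  show "((\<lambda>x. 48 * (?q x ^ 2 * (x - y)\<^sup>2) - 8 * ?q x ^ 3) has_real_derivative
      - 192 * (?q x * (x - y) ^ 3) + 144 * (?q x ^ 2 * (x - y))) (at x)" for x
    using DERIV_diff[OF DERIV_cmult[OF DERIV_mult[OF d2 e2], of 48] DERIV_cmult[OF d3, of 8]]
    by (simp only: alg(2))
  show "continuous_on UNIV (\<lambda>x. - 192 * (?q x * (x - y) ^ 3) + 144 * (?q x ^ 2 * (x - y)))"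
    by (intro continuous_intros)
  fix x assume x: "x \<notin> {-(\<bar>y\<bar> + r)..\<bar>y\<bar> + r}"
  then have "\<bar>x - y\<bar> > r" by auto
  then have "(x - y)\<^sup>2 \<ge> r\<^sup>2"
    using r by (metis abs_le_square_iff abs_of_pos less_imp_le)
  then show "?q x ^ 4 = 0" by simp
qed

lemma C3_test_integrable:
  fixes g :: "real \<Rightarrow> real"
  assumes "F \<in> C3_test" "continuous_on UNIV g"
  shows "integrable lborel (\<lambda>x. F x * g x)"
proof -
  obtain R where "\<And>x. x \<notin> {-R..R} \<Longrightarrow> F x = 0"
    using assms(1) by (rule C3_testE) blast
  then show ?thesis
    using continuous_integrable_real[OF C3_test_continuous[OF assms(1)] _ assms(2)] by blast
qed

text \<open>The fundamental lemma of the calculus of variations: a bump at \<open>y\<close> so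
  narrow that \<open>g\<close> keeps its sign on the support. The factor \<open>s\<close> reduces to
  the case of a positive value.\<close>

lemma C3_test_detects:
  fixes g :: "real \<Rightarrow> real"
  assumes g: "continuous_on UNIV g" and y: "g y \<noteq> 0"
  shows "\<exists>F\<in>C3_test. (LBINT x. F x * g x) \<noteq> 0"
proof -
  obtain s :: real where s: "s * g y > 0"
    using y by (metis not_real_square_gt_zero)
  have gs: "continuous_on UNIV (\<lambda>x. s * g x)"
    by (intro continuous_intros g)
  have "(\<lambda>x. s * g x) \<midarrow>y\<rightarrow> s * g y"
    using gs by (simp add: continuous_on_eq_continuous_at isCont_def)
  then have "\<forall>\<^sub>F x in at y. s * g x > 0"
    by (rule order_tendstoD) (use s in simp)
  then obtain d where d: "d > 0" "\<And>x. \<lbrakk>x \<noteq> y; dist x y < d\<rbrakk> \<Longrightarrow> s * g x > 0"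
    by (auto simp: eventually_at)
  define F where "F x = (max 0 (d\<^sup>2 - (x - y)\<^sup>2)) ^ 4" for x
  have F: "F \<in> C3_test"
    unfolding F_def using C3_bump[OF d(1)] .
  have z: "F x = 0" if "\<bar>x - y\<bar> \<ge> d" for x
  proof -
    have "(x - y)\<^sup>2 \<ge> d\<^sup>2"
      using that d(1) by (metis abs_le_square_iff abs_of_pos)
    then show ?thesis by (simp add: F_def)
  qed
  have "(LBINT x. F x * (s * g x)) > 0"
  proof (rule LBINT_pos[where l = "y - d" and h = "y + d" and y = y])
    show "continuous_on UNIV (\<lambda>x. F x * (s * g x))"
      by (intro continuous_on_mult C3_test_continuous F gs)
    show "F x * (s * g x) = 0" if "x \<notin> {y - d..y + d}" for x
    proof -
      have "\<bar>x - y\<bar> \<ge> d" using that by auto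
      then show ?thesis using z by simp
    qed
    show "F x * (s * g x) \<ge> 0" for x
    proof (cases "\<bar>x - y\<bar> < d")
      case True
      then have "s * g x > 0"
        using d(2)[of x] s by (cases "x = y") (auto simp: dist_real_def)
      then show ?thesis by (simp add: F_def)
    next
      case False
      then show ?thesis using z by simp
    qed
    show "F y * (s * g y) > 0"
      using d(1) s by (simp add: F_def)
  qed
  moreover have "(LBINT x. F x * (s * g x)) = s * (LBINT x. F x * g x)"
    by (simp add: mult.left_commute)
  ultimately have "(LBINT x. F x * g x) \<noteq> 0"
    by auto
  with F show ?thesis by blast
qed

lemma C3_test_integral_lincomb:
  fixes g :: "real \<Rightarrow> real"
  assumes "F \<in> C3_test" "G \<in> C3_test" "continuous_on UNIV g"
  shows "(LBINT x. (F x + c * G x) * g x) = (LBINT x. F x * g x) + c * (LBINT x. G x * g x)"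
proof -
  have "(LBINT x. (F x + c * G x) * g x) = (LBINT x. F x * g x + c * (G x * g x))"
    by (simp add: algebra_simps)
  also have "\<dots> = (LBINT x. F x * g x) + (LBINT x. c * (G x * g x))"
    using C3_test_integrable assms by (intro Bochner_Integration.integral_add integrable_mult_right) auto
  finally show ?thesis by simp
qed

text \<open>Linear algebra of functionals: if pairing with \<open>g0\<close> is not identically
  zero, correct a function that detects \<open>g1 - c * g0\<close> by a multiple of a
  \<open>G\<close> that detects \<open>g0\<close>.\<close>

lemma C3_test_separates:
  fixes g0 g1 :: "real \<Rightarrow> real"
  assumes g: "continuous_on UNIV g0" "continuous_on UNIV g1"
    and ind: "\<And>c. \<exists>x. g1 x \<noteq> c * g0 x"
  shows "\<exists>F\<in>C3_test. (LBINT x. F x * g0 x) = 0 \<and> (LBINT x. F x * g1 x) \<noteq> 0"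
proof (cases "\<forall>F\<in>C3_test. (LBINT x. F x * g0 x) = 0")
  case True
  obtain y where "g1 y \<noteq> 0"
    using ind[of 0] by auto
  then show ?thesis
    using C3_test_detects[OF g(2)] True by blast
next
  case False
  then obtain G where G: "G \<in> C3_test" "(LBINT x. G x * g0 x) \<noteq> 0" by blast
  \<comment> \<open>With this \<open>c\<close> the function \<open>G\<close> pairs to 0 with
    \<open>g1 - c * g0\<close>, so adding multiples of \<open>G\<close> to \<open>F\<close> does not
    affect that pairing.\<close>
  define c where "c = (LBINT x. G x * g1 x) / (LBINT x. G x * g0 x)"
  have cont: "continuous_on UNIV (\<lambda>x. g1 x - c * g0 x)"
    by (intro continuous_intros g)
  obtain y where "g1 y - c * g0 y \<noteq> 0"
    using ind[of c] by auto
  then obtain F where F: "F \<in> C3_test" "(LBINT x. F x * (g1 x - c * g0 x)) \<noteq> 0"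
    using C3_test_detects[OF cont] by blast
  have "(LBINT x. F x * (g1 x - c * g0 x)) = (LBINT x. F x * g1 x - c * (F x * g0 x))"
    by (simp add: algebra_simps)
  also have "\<dots> = (LBINT x. F x * g1 x) - c * (LBINT x. F x * g0 x)"
    using C3_test_integrable[OF F(1) g(1)] C3_test_integrable[OF F(1) g(2)]
    by (subst Bochner_Integration.integral_diff) auto
  finally have nz: "(LBINT x. F x * g1 x) - c * (LBINT x. F x * g0 x) \<noteq> 0"
    using F(2) by simp
  \<comment> \<open>The multiple of \<open>G\<close> that makes the pairing of \<open>F\<close> with
    \<open>g0\<close> vanish.\<close>
  define k where "k = - (LBINT x. F x * g0 x) / (LBINT x. G x * g0 x)"
  have "(LBINT x. (F x + k * G x) * g0 x) = 0"
    unfolding C3_test_integral_lincomb[OF F(1) G(1) g(1)] using G(2) by (simp add: k_def)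
  moreover have "(LBINT x. (F x + k * G x) * g1 x) \<noteq> 0"
    unfolding C3_test_integral_lincomb[OF F(1) G(1) g(2)]
    using G(2) nz by (simp add: k_def c_def field_simps)
  ultimately show ?thesis
    using C3_test_lincomb[OF F(1) G(1), of k] by (intro bexI[of _ "\<lambda>x. F x + k * G x"] conjI)
qed

text \<open>Take one function for each condition. If each of them misses the other condition, their
  sum satisfies both; otherwise one of them already does.\<close>

lemma C3_test_separates2:
  fixes g0 g1 g2 :: "real \<Rightarrow> real"
  assumes g: "continuous_on UNIV g0" "continuous_on UNIV g1" "continuous_on UNIV g2"
    and ind: "\<And>c. \<exists>x. g1 x \<noteq> c * g0 x" "\<And>c. \<exists>x. g2 x \<noteq> c * g0 x"
  shows "\<exists>F\<in>C3_test. (LBINT x. F x * g0 x) = 0 \<and> (LBINT x. F x * g1 x) \<noteq> 0 \<and> (LBINT x. F x * g2 x) \<noteq> 0"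
proof -
  obtain F where F: "F \<in> C3_test" "(LBINT x. F x * g0 x) = 0" "(LBINT x. F x * g1 x) \<noteq> 0"
    using C3_test_separates[OF g(1,2) ind(1)] by blast
  obtain G where G: "G \<in> C3_test" "(LBINT x. G x * g0 x) = 0" "(LBINT x. G x * g2 x) \<noteq> 0"
    using C3_test_separates[OF g(1,3) ind(2)] by blast
  show ?thesis
  proof (cases "(LBINT x. F x * g2 x) = 0 \<and> (LBINT x. G x * g1 x) = 0")
    case True
    have "(\<lambda>x. F x + 1 * G x) \<in> C3_test"
      by (intro C3_test_lincomb F G)
    moreover have "(LBINT x. (F x + 1 * G x) * g0 x) = 0" "(LBINT x. (F x + 1 * G x) * g1 x) \<noteq> 0"
      "(LBINT x. (F x + 1 * G x) * g2 x) \<noteq> 0"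
      unfolding C3_test_integral_lincomb[OF F(1) G(1) g(1)] C3_test_integral_lincomb[OF F(1) G(1) g(2)]
        C3_test_integral_lincomb[OF F(1) G(1) g(3)]
      using F G True by auto
    ultimately show ?thesis by (intro bexI[of _ "\<lambda>x. F x + 1 * G x"] conjI)
  next
    case False
    then show ?thesis using F G by blast
  qed
qed

subsection \<open>The domain wall profile\<close>

lemma bounded_of_limits:
  fixes f :: "real \<Rightarrow> real"
  assumes c: "continuous_on UNIV f" and t: "(f \<longlongrightarrow> p) at_top" and b: "(f \<longlongrightarrow> q) at_bot"
  shows "\<exists>B>0. \<forall>x. \<bar>f x\<bar> \<le> B"
proof -
  have "\<forall>\<^sub>F x in at_top. \<bar>f x\<bar> < \<bar>p\<bar> + 1"
    by (rule order_tendstoD(2)[OF tendsto_rabs[OF t]]) simp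
  then obtain N where N: "\<And>x. x \<ge> N \<Longrightarrow> \<bar>f x\<bar> < \<bar>p\<bar> + 1"
    by (auto simp: eventually_at_top_linorder)
  have "\<forall>\<^sub>F x in at_bot. \<bar>f x\<bar> < \<bar>q\<bar> + 1"
    by (rule order_tendstoD(2)[OF tendsto_rabs[OF b]]) simp
  then obtain M where M: "\<And>x. x \<le> M \<Longrightarrow> \<bar>f x\<bar> < \<bar>q\<bar> + 1"
    by (auto simp: eventually_at_bot_linorder)
  have "compact (f ` {M..N})"
    by (intro compact_continuous_image continuous_on_subset[OF c]) auto
  then obtain B where B: "\<And>x. x \<in> {M..N} \<Longrightarrow> \<bar>f x\<bar> \<le> B"
    using compact_imp_bounded by (force simp: bounded_iff)
  have "\<bar>f x\<bar> \<le> \<bar>p\<bar> + \<bar>q\<bar> + \<bar>B\<bar> + 1" for x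
    using N[of x] M[of x] B[of x] by (cases "x \<ge> N"; cases "x \<le> M") auto
  then show ?thesis
    by (intro exI[of _ "\<bar>p\<bar> + \<bar>q\<bar> + \<bar>B\<bar> + 1"]) auto
qed

text \<open>The points come from the mean value theorem on \<open>[n, n + 1]\<close>. A sequence
  along which the derivative vanishes suffices to evaluate conserved quantities at infinity.\<close>

lemma derivative_small_at_top:
  fixes f f' :: "real \<Rightarrow> real"
  assumes d: "\<And>x. (f has_real_derivative f' x) (at x)" and t: "(f \<longlongrightarrow> p) at_top"
  shows "\<exists>X. filterlim X at_top sequentially \<and> (\<lambda>n. f' (X n)) \<longlonglongrightarrow> 0"
proof -
  have "\<exists>z. real n < z \<and> z < real n + 1 \<and> f (real n + 1) - f (real n) = f' z" for n
    using MVT2[of "real n" "real n + 1" f f'] d by auto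
  then obtain X where X: "\<And>n. real n < X n" "\<And>n. f (real n + 1) - f (real n) = f' (X n)"
    by metis
  have "filterlim X at_top sequentially"
    by (rule filterlim_at_top_mono[OF filterlim_real_sequentially]) (use X in \<open>auto intro!: always_eventually less_imp_le\<close>)
  moreover have "(\<lambda>n. f (real n + 1) - f (real n)) \<longlonglongrightarrow> p - p"
    by (intro tendsto_diff filterlim_compose[OF t]) real_asymp+
  ultimately show ?thesis
    using X(2) by auto
qed

lemma derivative_small_at_bot:
  fixes f f' :: "real \<Rightarrow> real"
  assumes d: "\<And>x. (f has_real_derivative f' x) (at x)" and b: "(f \<longlongrightarrow> p) at_bot"
  shows "\<exists>X. filterlim X at_bot sequentially \<and> (\<lambda>n. f' (X n)) \<longlonglongrightarrow> 0"
proof -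
  have "((\<lambda>x. f (- x)) has_real_derivative - f' (- x)) (at x)" for x
    using DERIV_chain2[OF d[of "- x"] DERIV_minus[OF DERIV_ident]] by simp
  moreover have "((\<lambda>x. f (- x)) \<longlongrightarrow> p) at_top"
    using b by (simp add: filterlim_at_bot_mirror)
  ultimately obtain X where X: "filterlim X at_top sequentially" "(\<lambda>n. - f' (- X n)) \<longlonglongrightarrow> 0"
    using derivative_small_at_top[of "\<lambda>x. f (- x)" "\<lambda>x. - f' (- x)" p] by blast
  show ?thesis
  proof (intro exI conjI)
    show "filterlim (\<lambda>n. - X n) at_bot sequentially"
      using X(1) by (simp add: filterlim_uminus_at_top)
    show "(\<lambda>n. f' (- X n)) \<longlonglongrightarrow> 0"
      using tendsto_minus[OF X(2)] by simp
  qed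
qed

text \<open>By \<open>gap\<close> the potential of the first equation has the positive limit
  \<open>g12 * b\<^sup>2 - g1 * a\<^sup>2\<close> at minus infinity, while its limit at plus
  infinity is 0. This asymmetry drives the two independence lemmas about \<open>V'\<close>.\<close>

locale wall_profile =
  fixes u v u' v' :: "real \<Rightarrow> real" and g1 g12 a b :: real
  assumes du: "(u has_real_derivative u' x) (at x)"
    and dv: "(v has_real_derivative v' x) (at x)"
    and du': "(u' has_real_derivative (g1 * ((u x)\<^sup>2 - a\<^sup>2) + g12 * (v x)\<^sup>2) * u x) (at x)"
    and cv': "continuous_on UNIV v'"
    and u_top: "(u \<longlongrightarrow> a) at_top" and u_bot: "(u \<longlongrightarrow> 0) at_bot"
    and v_top: "(v \<longlongrightarrow> 0) at_top" and v_bot: "(v \<longlongrightarrow> b) at_bot"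
    and a_pos: "a > 0" and g1_pos: "g1 > 0" and g12_pos: "g12 > 0"
    and gap: "g1 * a\<^sup>2 < g12 * b\<^sup>2"
begin

definition V :: "real \<Rightarrow> real" where
  "V x = g1 * ((u x)\<^sup>2 - a\<^sup>2) + g12 * (v x)\<^sup>2"

definition V' :: "real \<Rightarrow> real" where
  "V' x = 2 * g1 * u x * u' x + 2 * g12 * v x * v' x"

lemma cu: "continuous_on S u" and cv: "continuous_on S v" and cu': "continuous_on S u'"
  by (rule continuous_on_test, rule du dv du')+

lemma cV: "continuous_on S V"
  unfolding V_def[abs_def] by (intro continuous_intros cu cv)

lemma cV': "continuous_on S V'"
  unfolding V'_def[abs_def]
  by (intro continuous_intros cu cv cu' continuous_on_subset[OF cv']) auto

lemma dV: "(V has_real_derivative V' x) (at x)"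
  unfolding V_def[abs_def] V'_def
  by (rule derivative_eq_intros du dv refl)+ (simp add: algebra_simps)

lemma du'V: "(u' has_real_derivative V x * u x) (at x)"
  using du' by (simp add: V_def)

lemma V_top: "(V \<longlongrightarrow> 0) at_top"
proof -
  have "(V \<longlongrightarrow> g1 * (a\<^sup>2 - a\<^sup>2) + g12 * 0\<^sup>2) at_top"
    unfolding V_def[abs_def] by (intro tendsto_intros u_top v_top)
  then show ?thesis by simp
qed

lemma V_bot: "(V \<longlongrightarrow> g12 * b\<^sup>2 - g1 * a\<^sup>2) at_bot"
proof -
  have "(V \<longlongrightarrow> g1 * (0\<^sup>2 - a\<^sup>2) + g12 * b\<^sup>2) at_bot"
    unfolding V_def[abs_def] by (intro tendsto_intros u_bot v_bot)
  then show ?thesis by simp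
qed

lemma bounds: "\<exists>B>0. \<forall>x. \<bar>u x\<bar> \<le> B \<and> \<bar>v x\<bar> \<le> B \<and> \<bar>V x\<bar> \<le> B"
proof -
  obtain B1 B2 B3 where "B1 > 0" "\<forall>x. \<bar>u x\<bar> \<le> B1" "B2 > 0" "\<forall>x. \<bar>v x\<bar> \<le> B2"
      "B3 > 0" "\<forall>x. \<bar>V x\<bar> \<le> B3"
    using bounded_of_limits[OF cu u_top u_bot] bounded_of_limits[OF cv v_top v_bot]
      bounded_of_limits[OF cV V_top V_bot] by metis
  then show ?thesis
    by (intro exI[of _ "B1 + B2 + B3"]) (auto intro: order_trans)
qed

text \<open>If \<open>u' = c V'\<close>, the limits at infinity force \<open>V = L (1 - u / a)\<close>. Then \<open>u\<close> solves the
  autonomous equation \<open>u'' = L (1 - u / a) u\<close>, whose conserved energy differs at the two ends.\<close>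

lemma u'_not_multiple: "\<exists>x. u' x \<noteq> c * V' x"
proof (rule ccontr)
  assume "\<nexists>x. u' x \<noteq> c * V' x"
  then have eq: "u' x = c * V' x" for x by blast
  have "((\<lambda>x. u x - c * V x) has_real_derivative 0) (at x)" for x
    using du[of x] dV[of x] eq[of x] by (auto intro!: derivative_eq_intros)
  then obtain k where k: "\<And>x. u x - c * V x = k"
    using DERIV_isconst_all[of "\<lambda>x. u x - c * V x"] by metis
  define L where "L = g12 * b\<^sup>2 - g1 * a\<^sup>2"
  have L: "L > 0" using gap by (simp add: L_def)
  have "((\<lambda>x. u x - c * V x) \<longlongrightarrow> a - c * 0) at_top"
    by (intro tendsto_intros u_top V_top)
  then have ka: "k = a"
    by (simp add: k tendsto_const_iff)
  have "((\<lambda>x. u x - c * V x) \<longlongrightarrow> 0 - c * L) at_bot"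
    unfolding L_def by (intro tendsto_intros u_bot V_bot)
  then have kL: "k = - c * L"
    by (simp add: k tendsto_const_iff)
  have V: "V x = L * (1 - u x / a)" for x
  proof -
    have "c \<noteq> 0" using kL ka a_pos by auto
    have "a * V x = - c * L * V x" using ka kL by simp
    also have "\<dots> = L * (a - u x)" using k[of x] ka by (simp add: algebra_simps)
    finally show ?thesis using a_pos by (simp add: field_simps)
  qed
  \<comment> \<open>The mechanical energy of the autonomous equation: kinetic term minus a primitive
    of \<open>L * (1 - u / a) * u\<close>.\<close>
  define G where "G x = (u' x)\<^sup>2 / 2 - L * ((u x)\<^sup>2 / 2 - (u x) ^ 3 / (3 * a))" for x
  have "(G has_real_derivative 0) (at x)" for x
  proof -
    have "(G has_real_derivative real 2 * (V x * u x * u' x ^ (2 - Suc 0)) / 2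
        - L * (real 2 * (u' x * u x ^ (2 - Suc 0)) / 2 - real 3 * (u' x * u x ^ (3 - Suc 0)) / (3 * a))) (at x)"
      unfolding G_def[abs_def]
      by (intro DERIV_diff DERIV_cmult DERIV_cdivide DERIV_power du du'V)
    moreover have "real 2 * (V x * u x * u' x ^ (2 - Suc 0)) / 2
        - L * (real 2 * (u' x * u x ^ (2 - Suc 0)) / 2 - real 3 * (u' x * u x ^ (3 - Suc 0)) / (3 * a)) = 0"
      unfolding V using a_pos by (simp add: field_simps power2_eq_square)
    ultimately show ?thesis by simp
  qed
  then have G: "G x = G 0" for x
    using DERIV_isconst_all[of G x 0] by blast
  obtain X where X: "filterlim X at_top sequentially" "(\<lambda>n. u' (X n)) \<longlonglongrightarrow> 0"
    using derivative_small_at_top[OF du u_top] by blast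
  obtain Y where Y: "filterlim Y at_bot sequentially" "(\<lambda>n. u' (Y n)) \<longlonglongrightarrow> 0"
    using derivative_small_at_bot[OF du u_bot] by blast
  have "(\<lambda>n. G (X n)) \<longlonglongrightarrow> 0\<^sup>2 / 2 - L * (a\<^sup>2 / 2 - a ^ 3 / (3 * a))"
    unfolding G_def
    by (intro tendsto_intros X filterlim_compose[OF u_top X(1)]) (use a_pos in auto)
  then have "G 0 = - L * (a\<^sup>2 / 2 - a ^ 3 / (3 * a))"
    by (simp add: G[of "X _"] tendsto_const_iff)
  moreover have "(\<lambda>n. G (Y n)) \<longlonglongrightarrow> 0\<^sup>2 / 2 - L * (0\<^sup>2 / 2 - 0 ^ 3 / (3 * a))"
    unfolding G_def
    by (intro tendsto_intros Y filterlim_compose[OF u_bot Y(1)]) (use a_pos in auto)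
  then have "G 0 = 0"
    by (simp add: G[of "Y _"] tendsto_const_iff)
  \<comment> \<open>The left-hand side is \<open>a\<^sup>2 / 6\<close>, hence not 0.\<close>
  ultimately have "a\<^sup>2 / 2 - a ^ 3 / (3 * a) = 0"
    using L by simp
  then show False
    using a_pos by (simp add: power2_eq_square power3_eq_cube field_simps)
qed

text \<open>If \<open>u'' = c * V'\<close>, then \<open>u' - c * V\<close> is constant. Along
  sequences with \<open>u'\<close> tending to 0 its limits at the two ends are 0 and
  \<open>- c\<close> times a positive number, so \<open>c = 0\<close> and \<open>u\<close> is
  constant, against its limits \<open>a\<close> and 0.\<close>

lemma u''_not_multiple: "\<exists>x. V x * u x \<noteq> c * V' x"
proof (rule ccontr)
  assume "\<nexists>x. V x * u x \<noteq> c * V' x"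
  then have eq: "V x * u x = c * V' x" for x by blast
  have "((\<lambda>x. u' x - c * V x) has_real_derivative 0) (at x)" for x
    using du'V[of x] dV[of x] eq[of x] by (auto intro!: derivative_eq_intros)
  then obtain k where k: "\<And>x. u' x - c * V x = k"
    using DERIV_isconst_all[of "\<lambda>x. u' x - c * V x"] by metis
  obtain X where X: "filterlim X at_top sequentially" "(\<lambda>n. u' (X n)) \<longlonglongrightarrow> 0"
    using derivative_small_at_top[OF du u_top] by blast
  obtain Y where Y: "filterlim Y at_bot sequentially" "(\<lambda>n. u' (Y n)) \<longlonglongrightarrow> 0"
    using derivative_small_at_bot[OF du u_bot] by blast
  have "(\<lambda>n. u' (X n) - c * V (X n)) \<longlonglongrightarrow> 0 - c * 0"
    by (intro tendsto_intros X filterlim_compose[OF V_top X(1)])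
  then have k0: "k = 0"
    by (simp add: k tendsto_const_iff)
  have "(\<lambda>n. u' (Y n) - c * V (Y n)) \<longlonglongrightarrow> 0 - c * (g12 * b\<^sup>2 - g1 * a\<^sup>2)"
    by (intro tendsto_intros Y filterlim_compose[OF V_bot Y(1)])
  then have "k = - c * (g12 * b\<^sup>2 - g1 * a\<^sup>2)"
    by (simp add: k tendsto_const_iff)
  then have "c = 0"
    using k0 gap by simp
  then have "(u has_real_derivative 0) (at x)" for x
    using du[of x] k[of x] k0 by simp
  then have "u x = u 0" for x
    using DERIV_isconst_all[of u x 0] by blast
  then have "u = (\<lambda>x. u 0)" by blast
  then have "u 0 = a" "u 0 = 0"
    using u_top u_bot by (metis tendsto_const_iff trivial_limit_at_top_linorder trivial_limit_at_bot_linorder)+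
  then show False using a_pos by simp
qed

text \<open>With \<open>\<phi>\<close> the derivative of \<open>F\<close>, integration by parts and
  \<open>u'' = V * u\<close> translate the three conditions into: \<open>\<phi>\<close> is
  orthogonal to \<open>V\<close>, but neither to \<open>u\<close> nor to \<open>u'\<close>.\<close>

lemma test_function_exists:
  "\<exists>F\<in>C3_test. (LBINT x. F x * V' x) = 0 \<and> (LBINT x. F x * u' x) \<noteq> 0 \<and> (LBINT x. F x * (V x * u x)) \<noteq> 0"
  by (rule C3_test_separates2)
    (use u'_not_multiple u''_not_multiple in \<open>auto intro!: continuous_intros cu cu' cV cV'\<close>)

end

subsection \<open>States close to a modulated wall\<close>

lemma LBINT_shift:
  fixes f :: "real \<Rightarrow> 'a::{banach, second_countable_topology}"
  shows "(LBINT x. f (x + c)) = (LBINT x. f x)"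
  using lborel_integral_real_affine[of 1 f c] by (simp add: add.commute)

text \<open>At some \<open>y\<close> in \<open>[x, x + 1]\<close> the moduli of
  \<open>\<psi>\<close> and \<open>m\<close> differ by at most 3, so \<open>\<psi> - m\<close> is at
  most \<open>2 * B + 3\<close> there. Moving from \<open>y\<close> to \<open>x\<close> costs at
  most 8 by \<open>weak_deriv_increment\<close>, and adding back \<open>m\<close> costs
  \<open>B\<close>.\<close>

lemma modulus_bound:
  fixes \<psi> m d\<psi> dm :: "real \<Rightarrow> complex"
  assumes c: "continuous_on UNIV \<psi>" "continuous_on UNIV m"
    and L: "d\<psi> \<in> L2loc" "dm \<in> L2loc"
    and w: "is_weak_deriv \<psi> d\<psi>" "is_weak_deriv m dm"
    and s: "loc_small \<epsilon> (\<lambda>x. d\<psi> x - dm x)" "loc_small \<epsilon> (\<lambda>x. cmod (\<psi> x) - cmod (m x))"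
    and e: "0 \<le> \<epsilon>" "\<epsilon> \<le> 1" and B: "\<And>x. cmod (m x) \<le> B"
  shows "cmod (\<psi> x) \<le> 3 * B + 11"
proof -
  obtain y where y: "x \<le> y" "y \<le> x + 1" "norm (cmod (\<psi> y) - cmod (m y)) \<le> 3"
    using loc_small_point[OF s(2) e(2), of x] by blast
  have "is_weak_deriv (\<lambda>x. \<psi> x - m x) (\<lambda>x. d\<psi> x - dm x)"
    by (intro is_weak_deriv_diff continuous_L2loc c L w)
  moreover have "continuous_on UNIV (\<lambda>x. \<psi> x - m x)"
    by (intro continuous_intros c)
  ultimately have "norm ((\<psi> x - m x) - (\<psi> y - m y)) \<le> 2 * \<epsilon> * (y - x + 3)"
    using weak_deriv_increment[OF _ _ s(1) e(1) y(1)] by blast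
  also have "\<dots> \<le> 2 * 1 * 4"
    using e y by (intro mult_mono) auto
  finally have 1: "norm ((\<psi> x - m x) - (\<psi> y - m y)) \<le> 8" by simp
  have 2: "cmod (\<psi> y - m y) \<le> cmod (\<psi> y) + cmod (m y)"
    by (rule norm_triangle_ineq4)
  have 3: "cmod (\<psi> x - m x) \<le> cmod ((\<psi> x - m x) - (\<psi> y - m y)) + cmod (\<psi> y - m y)"
    using norm_triangle_ineq[of "(\<psi> x - m x) - (\<psi> y - m y)" "\<psi> y - m y"] by simp
  have 4: "cmod (\<psi> x) \<le> cmod (\<psi> x - m x) + cmod (m x)"
    using norm_triangle_ineq[of "\<psi> x - m x" "m x"] by simp
  show ?thesis
    using 1 2 3 4 y(3) B[of x] B[of y] by simp
qed

text \<open>The compactly supported \<open>H\<close> encodes that \<open>\<phi>\<close> is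
  orthogonal to \<open>V\<close>, just as \<open>\<Phi>\<close> encodes that \<open>\<phi>\<close>
  has mean zero. \<open>K\<close> bounds all weights, \<open>B\<close> the profile and its
  potential, and \<open>\<Lambda>\<close> is a Lipschitz constant of \<open>V\<close> near the
  supports.\<close>

locale wall_test = wall_profile +
  fixes \<Phi> \<phi> \<phi>1 \<phi>2 H :: "real \<Rightarrow> real" and R K B \<Lambda> :: real
  assumes d\<Phi>: "(\<Phi> has_real_derivative \<phi> x) (at x)"
    and d\<phi>: "(\<phi> has_real_derivative \<phi>1 x) (at x)"
    and d\<phi>1: "(\<phi>1 has_real_derivative \<phi>2 x) (at x)"
    and c\<phi>2: "continuous_on UNIV \<phi>2"
    and dH: "(H has_real_derivative \<phi> x * V x) (at x)"
    and R: "R > 0" and K: "K > 0" and B: "B > 0" and \<Lambda>: "\<Lambda> \<ge> 0"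
    and bounds_K: "\<bar>\<Phi> x\<bar> \<le> K * indicator {-R..R} x" "\<bar>\<phi> x\<bar> \<le> K * indicator {-R..R} x"
      "\<bar>\<phi>1 x\<bar> \<le> K * indicator {-R..R} x" "\<bar>\<phi>2 x\<bar> \<le> K * indicator {-R..R} x"
      "\<bar>H x\<bar> \<le> K * indicator {-R..R} x"
    and bounds_B: "\<bar>u x\<bar> \<le> B" "\<bar>v x\<bar> \<le> B" "\<bar>V x\<bar> \<le> B"
    and lip: "\<bar>x\<bar> \<le> R \<Longrightarrow> \<bar>\<beta>\<bar> \<le> 1 \<Longrightarrow> \<bar>V (x + \<beta>) - V x\<bar> \<le> \<Lambda> * \<bar>\<beta>\<bar>"
begin

lemma c\<phi>: "continuous_on S \<phi>" and c\<phi>1: "continuous_on S \<phi>1" and c\<Phi>: "continuous_on S \<Phi>"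
  by (rule continuous_on_test, rule d\<phi> d\<phi>1 d\<Phi>)+

lemma shift_cont: "continuous_on UNIV f \<Longrightarrow> continuous_on S (\<lambda>x::real. f (x + c))"
  by (rule continuous_on_compose2[of UNIV f]) (auto intro!: continuous_intros)

lemma shift_bound:
  assumes "\<And>x. \<bar>F x\<bar> \<le> k * indicator {-R..R} x"
  shows "\<bar>F (x + \<gamma>)\<bar> \<le> k * indicator {-R-\<gamma>..R-\<gamma>} x"
    and "x \<notin> {-R-\<gamma>..R-\<gamma>} \<Longrightarrow> F (x + \<gamma>) = (0::real)"
  using assms[of "x + \<gamma>"] by (auto simp: indicator_def)

text \<open>Tested against the derivative of a compactly supported \<open>F\<close>, a function is
  seen only through its own derivative, so an additive constant in \<open>r\<close> is invisible.
  Applied with \<open>\<Phi>\<close> and with \<open>H\<close>; the shift by \<open>\<gamma>\<close>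
  does not change the length of the support.\<close>

lemma pairing_by_parts:
  fixes r dr :: "real \<Rightarrow> complex"
  assumes F: "\<And>x. (F has_real_derivative f x) (at x)" "continuous_on UNIV f"
    "\<And>x. \<bar>F x\<bar> \<le> K * indicator {-R..R} x"
    and r: "is_weak_deriv r dr" "loc_small \<epsilon> dr"
  shows "norm (LBINT x. f (x + \<gamma>) *\<^sub>R r x) \<le> K * (2 * R + 1) * \<epsilon>"
proof -
  have "(LBINT x. f (x + \<gamma>) *\<^sub>R r x) = - (LBINT x. F (x + \<gamma>) *\<^sub>R dr x)"
  proof (rule is_weak_deriv_test[OF r(1)])
    show "((\<lambda>x. F (x + \<gamma>)) has_real_derivative f (x + \<gamma>)) (at x)" for x
      using F(1)[of "x + \<gamma>"] by (simp add: DERIV_shift)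
    show "F (x + \<gamma>) = 0" if "x \<notin> {-R-\<gamma>..R-\<gamma>}" for x
      using shift_bound(2)[OF F(3) that] .
  qed (rule shift_cont[OF F(2)])
  moreover have "norm (LBINT x. F (x + \<gamma>) *\<^sub>R dr x) \<le> K * \<epsilon> * (R - \<gamma> - (-R - \<gamma>) + 1)"
    using K R by (intro loc_small_pairing[OF r(2)] shift_bound(1) F(3)) auto
  ultimately show ?thesis
    by (simp add: algebra_simps)
qed

definition M :: "real \<Rightarrow> real" where
  "M \<beta> = (LBINT x. \<phi> x * u (x + \<beta>))"

text \<open>The right-hand side of the tested Schroedinger equation, evaluated on the displaced
  profile with the phase factored out and both derivatives moved onto \<open>\<phi>\<close>. What
  matters is that this number is real and bounded.\<close>

definition Q :: "real \<Rightarrow> real" where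
  "Q \<beta> = (LBINT x. \<phi> x * (V (x + \<beta>) * u (x + \<beta>))) - (LBINT x. \<phi>2 x * u (x + \<beta>))"

lemma shifted_integral:
  fixes f w :: "real \<Rightarrow> real" and e :: complex
  shows "(LBINT x. f (x + \<gamma>) *\<^sub>R (e * complex_of_real (w (x + \<alpha>))))
    = e * complex_of_real (LBINT x. f x * w (x + (\<alpha> - \<gamma>)))"
proof -
  have "(LBINT x. f (x + \<gamma>) *\<^sub>R (e * complex_of_real (w (x + \<alpha>))))
      = (LBINT x. e * complex_of_real (f (x + \<gamma>) * w ((x + \<gamma>) + (\<alpha> - \<gamma>))))"
    by (simp add: scaleR_conv_of_real algebra_simps)
  also have "\<dots> = e * (LBINT x. complex_of_real (f (x + \<gamma>) * w ((x + \<gamma>) + (\<alpha> - \<gamma>))))"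
    by (rule integral_mult_right_zero)
  also have "\<dots> = e * complex_of_real (LBINT x. f (x + \<gamma>) * w ((x + \<gamma>) + (\<alpha> - \<gamma>)))"
    by (simp only: integral_complex_of_real)
  also have "\<dots> = e * complex_of_real (LBINT x. f x * w (x + (\<alpha> - \<gamma>)))"
    by (simp only: LBINT_shift[of "\<lambda>x. f x * w (x + (\<alpha> - \<gamma>))" \<gamma>])
  finally show ?thesis .
qed

lemma weighted_bound:
  fixes f w :: "real \<Rightarrow> real"
  assumes "continuous_on UNIV f" "\<And>x. \<bar>f x\<bar> \<le> K * indicator {-R..R} x"
    "continuous_on UNIV w" "\<And>x. \<bar>w x\<bar> \<le> b'"
  shows "\<bar>LBINT x. f x * w x\<bar> \<le> K * b' * (2 * R)"
proof -
  have z: "f x = 0" if "x \<notin> {-R..R}" for x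
    using assms(2)[of x] that by (auto simp: indicator_def)
  have b': "b' \<ge> 0" using assms(4)[of 0] by auto
  have "\<bar>LBINT x. f x * w x\<bar> \<le> (LBINT x. (K * b') * indicator {-R..R} x)"
  proof (rule integral_abs_bound_integral)
    show "integrable lborel (\<lambda>x. f x * w x)"
      using continuous_integrable_real[OF assms(1) z assms(3)] .
    show "integrable lborel (\<lambda>x. (K * b') * indicat_real {-R..R} x)"
      by (intro integrable_mult_right integrable_indicator_Icc)
    fix x
    have "\<bar>f x\<bar> * \<bar>w x\<bar> \<le> (K * indicator {-R..R} x) * b'"
      using assms(2)[of x] assms(4)[of x] K by (intro mult_mono) auto
    then show "\<bar>f x * w x\<bar> \<le> (K * b') * indicat_real {-R..R} x"
      by (simp add: abs_mult mult_ac)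
  qed
  also have "\<dots> = K * b' * (2 * R)"
    using R by simp
  finally show ?thesis .
qed

lemma M_bound: "\<bar>M \<beta>\<bar> \<le> K * B * (2 * R)"
  unfolding M_def
  by (rule weighted_bound) (auto intro!: shift_cont cu c\<phi> bounds_K bounds_B)

lemma Q_bound: "\<bar>Q \<beta>\<bar> \<le> K * (B * B) * (2 * R) + K * B * (2 * R)"
proof -
  have "\<bar>LBINT x. \<phi> x * (V (x + \<beta>) * u (x + \<beta>))\<bar> \<le> K * (B * B) * (2 * R)"
  proof (rule weighted_bound)
    show "\<bar>V (x + \<beta>) * u (x + \<beta>)\<bar> \<le> B * B" for x
      unfolding abs_mult using B by (intro mult_mono bounds_B) auto
  qed (auto intro!: shift_cont cu cV c\<phi> bounds_K continuous_intros)
  moreover have "\<bar>LBINT x. \<phi>2 x * u (x + \<beta>)\<bar> \<le> K * B * (2 * R)"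
    by (rule weighted_bound) (auto intro!: shift_cont cu c\<phi>2 bounds_K bounds_B)
  ultimately show ?thesis
    unfolding Q_def by linarith
qed

text \<open>The uniform bound that \<open>modulus_bound\<close> gives for the components of a state
  near the wall.\<close>

definition S :: real where "S = 3 * B + 11"
definition C1 :: real where "C1 = K * (2 * R + 1)"
text \<open>The summand 2 accounts for the two errors controlled by the derivative of
  \<open>r\<close>, the next one for the change of potential, and the last for evaluating
  \<open>V\<close> at a displaced position.\<close>

definition C2 :: real where "C2 = C1 * (2 + (g1 + g12) * (S + B) * S) + K * \<Lambda> * (S + B) * (2 * R)"

end

section \<open>Estimates for a single state near the modulated wall\<close>

locale near_wall = wall_test +
  fixes \<psi>1 \<psi>2 d\<psi>1 d\<psi>2 dm1 dm2 :: "real \<Rightarrow> complex" and e1 e2 :: complex and \<alpha> \<epsilon> :: real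
  assumes c\<psi>: "continuous_on UNIV \<psi>1" "continuous_on UNIV \<psi>2"
    and L2: "d\<psi>1 \<in> L2loc" "d\<psi>2 \<in> L2loc" "dm1 \<in> L2loc" "dm2 \<in> L2loc"
    and w\<psi>: "is_weak_deriv \<psi>1 d\<psi>1" "is_weak_deriv \<psi>2 d\<psi>2"
    and wm: "is_weak_deriv (\<lambda>x. e1 * complex_of_real (u (x + \<alpha>))) dm1"
      "is_weak_deriv (\<lambda>x. e2 * complex_of_real (v (x + \<alpha>))) dm2"
    and e: "cmod e1 = 1" "cmod e2 = 1"
    and \<epsilon>: "0 < \<epsilon>" "\<epsilon> \<le> 1"
    and small_d: "loc_small \<epsilon> (\<lambda>x. d\<psi>1 x - dm1 x)" "loc_small \<epsilon> (\<lambda>x. d\<psi>2 x - dm2 x)"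
    and small_abs: "loc_small \<epsilon> (\<lambda>x. cmod (\<psi>1 x) - \<bar>u (x + \<alpha>)\<bar>)"
      "loc_small \<epsilon> (\<lambda>x. cmod (\<psi>2 x) - \<bar>v (x + \<alpha>)\<bar>)"
begin

definition m1 where "m1 x = e1 * complex_of_real (u (x + \<alpha>))"
definition m2 where "m2 x = e2 * complex_of_real (v (x + \<alpha>))"
definition r where "r x = \<psi>1 x - m1 x"

lemma cm: "continuous_on UNIV m1" "continuous_on UNIV m2"
  unfolding m1_def m2_def by (intro continuous_intros shift_cont cu cv)+

lemma cr: "continuous_on UNIV r"
  unfolding r_def by (intro continuous_intros c\<psi> cm)

lemma wr: "is_weak_deriv r (\<lambda>x. d\<psi>1 x - dm1 x)"
  unfolding r_def
  by (intro is_weak_deriv_diff continuous_L2loc c\<psi> cm L2 w\<psi> wm(1)[folded m1_def])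

lemma norm_m: "cmod (m1 x) = \<bar>u (x + \<alpha>)\<bar>" "cmod (m2 x) = \<bar>v (x + \<alpha>)\<bar>"
  by (simp_all add: m1_def m2_def norm_mult e)

lemma \<psi>_bound: "cmod (\<psi>1 x) \<le> S" "cmod (\<psi>2 x) \<le> S"
  unfolding S_def
  using \<epsilon> small_abs bounds_B
  by (auto intro!: modulus_bound[OF c\<psi>(1) cm(1) L2(1,3) w\<psi>(1) wm(1)[folded m1_def] small_d(1)]
     modulus_bound[OF c\<psi>(2) cm(2) L2(2,4) w\<psi>(2) wm(2)[folded m2_def] small_d(2)] simp: norm_m)

lemma r_bound: "cmod (r x) \<le> S + B"
  unfolding r_def using norm_triangle_ineq4[of "\<psi>1 x" "m1 x"] \<psi>_bound(1)[of x] bounds_B(1)[of "x + \<alpha>"]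
  by (simp add: norm_m)

lemma S_pos: "S > 0"
  using B by (simp add: S_def)

text \<open>The error is the pairing of \<open>r\<close> with a shifted \<open>\<phi>\<close>. As
  \<open>\<phi>\<close> is the derivative of \<open>\<Phi>\<close>, integration by parts leaves only
  the small derivative of \<open>r\<close>.\<close>

lemma functional_near:
  "norm ((LBINT x. \<phi> (x + \<gamma>) *\<^sub>R \<psi>1 x) - e1 * complex_of_real (M (\<alpha> - \<gamma>))) \<le> C1 * \<epsilon>"
proof -
  have z: "\<phi> (x + \<gamma>) = 0" if "x \<notin> {-R-\<gamma>..R-\<gamma>}" for x
    using shift_bound(2)[OF bounds_K(2) that] .
  have i: "integrable lborel (\<lambda>x. \<phi> (x + \<gamma>) *\<^sub>R f x)" if "continuous_on UNIV f" for f :: "real \<Rightarrow> complex"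
    by (rule continuous_integrable[OF shift_cont[OF c\<phi>] z that])
  have "(LBINT x. \<phi> (x + \<gamma>) *\<^sub>R \<psi>1 x) - e1 * complex_of_real (M (\<alpha> - \<gamma>))
      = (LBINT x. \<phi> (x + \<gamma>) *\<^sub>R \<psi>1 x) - (LBINT x. \<phi> (x + \<gamma>) *\<^sub>R m1 x)"
    unfolding m1_def shifted_integral M_def by simp
  also have "\<dots> = (LBINT x. \<phi> (x + \<gamma>) *\<^sub>R r x)"
    unfolding r_def scaleR_diff_right
    by (rule Bochner_Integration.integral_diff[OF i[OF c\<psi>(1)] i[OF cm(1)], symmetric])
  also have "norm \<dots> \<le> C1 * \<epsilon>"
    unfolding C1_def by (rule pairing_by_parts[OF d\<Phi> c\<phi> bounds_K(1) wr small_d(1)])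
  finally show ?thesis .
qed

definition W where "W x = g1 * ((cmod (\<psi>1 x))\<^sup>2 - a\<^sup>2) + g12 * (cmod (\<psi>2 x))\<^sup>2"

lemma cW: "continuous_on UNIV W"
  unfolding W_def by (intro continuous_intros c\<psi>)

text \<open>Both potentials depend on squared moduli only and the term with \<open>a\<^sup>2\<close>
  cancels. Factoring \<open>p\<^sup>2 - q\<^sup>2\<close> leaves a small difference of moduli times
  bounded factors.\<close>

lemma potential_small: "loc_small ((g1 + g12) * (S + B) * S * \<epsilon>) (\<lambda>x. (W x - V (x + \<alpha>)) *\<^sub>R \<psi>1 x)"
proof -
  define f1 where "f1 x = (g1 * ((cmod (\<psi>1 x))\<^sup>2 - (u (x + \<alpha>))\<^sup>2)) *\<^sub>R \<psi>1 x" for x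
  define f2 where "f2 x = (g12 * ((cmod (\<psi>2 x))\<^sup>2 - (v (x + \<alpha>))\<^sup>2)) *\<^sub>R \<psi>1 x" for x
  have sq: "\<bar>p\<^sup>2 - q\<^sup>2\<bar> \<le> (S + B) * \<bar>p - \<bar>q\<bar>\<bar>" if "0 \<le> p" "p \<le> S" "\<bar>q\<bar> \<le> B" for p q :: real
  proof -
    have "p\<^sup>2 - q\<^sup>2 = (p + \<bar>q\<bar>) * (p - \<bar>q\<bar>)"
      using square_diff_square_factored[of p "\<bar>q\<bar>"] by (simp add: power2_eq_square)
    then have "\<bar>p\<^sup>2 - q\<^sup>2\<bar> = (p + \<bar>q\<bar>) * \<bar>p - \<bar>q\<bar>\<bar>"
      using that by (simp add: abs_mult)
    also have "\<dots> \<le> (S + B) * \<bar>p - \<bar>q\<bar>\<bar>"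
      using that by (intro mult_right_mono) auto
    finally show ?thesis .
  qed
  have cc: "continuous_on UNIV f1" "continuous_on UNIV f2"
    unfolding f1_def f2_def by (intro continuous_intros c\<psi> shift_cont cu cv)+
  have "loc_small (g1 * (S + B) * S * \<epsilon>) f1"
  proof (rule loc_small_bound[OF small_abs(1)])
    show "f1 \<in> borel_measurable lborel"
      using borel_measurable_continuous_onI[OF cc(1)] by simp
    show "norm (f1 x) \<le> g1 * (S + B) * S * norm (cmod (\<psi>1 x) - \<bar>u (x + \<alpha>)\<bar>)" for x
    proof -
      have "norm (f1 x) = g1 * \<bar>(cmod (\<psi>1 x))\<^sup>2 - (u (x + \<alpha>))\<^sup>2\<bar> * cmod (\<psi>1 x)"
        using g1_pos by (simp add: f1_def abs_mult)
      also have "\<dots> \<le> g1 * ((S + B) * \<bar>cmod (\<psi>1 x) - \<bar>u (x + \<alpha>)\<bar>\<bar>) * S"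
        using g1_pos S_pos B by (intro mult_mono sq \<psi>_bound bounds_B) auto
      finally show ?thesis by (simp add: mult_ac)
    qed
  qed (use g1_pos S_pos B in auto)
  moreover have "loc_small (g12 * (S + B) * S * \<epsilon>) f2"
  proof (rule loc_small_bound[OF small_abs(2)])
    show "f2 \<in> borel_measurable lborel"
      using borel_measurable_continuous_onI[OF cc(2)] by simp
    show "norm (f2 x) \<le> g12 * (S + B) * S * norm (cmod (\<psi>2 x) - \<bar>v (x + \<alpha>)\<bar>)" for x
    proof -
      have "norm (f2 x) = g12 * \<bar>(cmod (\<psi>2 x))\<^sup>2 - (v (x + \<alpha>))\<^sup>2\<bar> * cmod (\<psi>1 x)"
        using g12_pos by (simp add: f2_def abs_mult)
      also have "\<dots> \<le> g12 * ((S + B) * \<bar>cmod (\<psi>2 x) - \<bar>v (x + \<alpha>)\<bar>\<bar>) * S"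
        using g12_pos S_pos B by (intro mult_mono sq \<psi>_bound bounds_B) auto
      finally show ?thesis by (simp add: mult_ac)
    qed
  qed (use g12_pos S_pos B in auto)
  ultimately have "loc_small (g1 * (S + B) * S * \<epsilon> + g12 * (S + B) * S * \<epsilon>) (\<lambda>x. f1 x + f2 x)"
    by (rule loc_small_add)
  moreover have "f1 x + f2 x = (W x - V (x + \<alpha>)) *\<^sub>R \<psi>1 x" for x
  proof -
    have "W x - V (x + \<alpha>) = g1 * ((cmod (\<psi>1 x))\<^sup>2 - (u (x + \<alpha>))\<^sup>2) + g12 * ((cmod (\<psi>2 x))\<^sup>2 - (v (x + \<alpha>))\<^sup>2)"
      by (simp add: W_def V_def algebra_simps)
    then show ?thesis
      by (simp add: f1_def f2_def scaleR_left.add)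
  qed
  ultimately show ?thesis
    by (simp add: algebra_simps)
qed

text \<open>The error splits into four terms: \<open>I1\<close> compares derivatives,
  \<open>I2\<close> replaces the potential of the state by that of the wall, \<open>I3\<close> is
  the remainder \<open>r\<close> against \<open>\<phi> * V\<close>, and \<open>I4\<close> pays for
  the mismatch of positions.\<close>

lemma velocity_near:
  assumes \<beta>: "\<bar>\<alpha> - \<gamma>\<bar> \<le> 1"
  shows "norm ((LBINT x. \<phi>1 (x + \<gamma>) *\<^sub>R d\<psi>1 x + \<phi> (x + \<gamma>) *\<^sub>R (complex_of_real (W x) * \<psi>1 x))
      - e1 * complex_of_real (Q (\<alpha> - \<gamma>))) \<le> C2 * (\<epsilon> + \<bar>\<alpha> - \<gamma>\<bar>)"
proof -
  have z: "\<phi> (x + \<gamma>) = 0" "\<phi>1 (x + \<gamma>) = 0" "\<phi>2 (x + \<gamma>) = 0" if "x \<notin> {-R-\<gamma>..R-\<gamma>}" for x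
    using shift_bound(2)[OF bounds_K(2) that] shift_bound(2)[OF bounds_K(3) that]
      shift_bound(2)[OF bounds_K(4) that] by auto
  have i: "integrable lborel (\<lambda>x. \<phi> (x + \<gamma>) *\<^sub>R f x)" if "continuous_on UNIV f" for f :: "real \<Rightarrow> complex"
    by (rule continuous_integrable[OF shift_cont[OF c\<phi>] z(1) that])
  have i1: "integrable lborel (\<lambda>x. \<phi>1 (x + \<gamma>) *\<^sub>R f x)" if "f \<in> L2loc" for f :: "real \<Rightarrow> complex"
    by (rule L2loc_integrable[OF shift_cont[OF c\<phi>1] z(2) that])
  have cVa: "continuous_on UNIV (\<lambda>x. V (x + c))" for c
    by (rule shift_cont[OF cV])
  define I1 where "I1 = (LBINT x. \<phi>1 (x + \<gamma>) *\<^sub>R (d\<psi>1 x - dm1 x))"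
  define I2 where "I2 = (LBINT x. \<phi> (x + \<gamma>) *\<^sub>R ((W x - V (x + \<alpha>)) *\<^sub>R \<psi>1 x))"
  \<comment> \<open>Here \<open>V\<close> must carry the same shift \<open>\<gamma>\<close> as
    \<open>\<phi>\<close>: it is their product that has the compactly supported primitive
    \<open>H\<close>. Passing from \<open>\<alpha>\<close> to \<open>\<gamma>\<close> produces
    \<open>I4\<close>, which is bounded by
    \<open>\<Lambda> * \<bar>\<alpha> - \<gamma>\<bar>\<close> and the crude bound on
    \<open>r\<close>.\<close>
  define I3 where "I3 = (LBINT x. (\<phi> (x + \<gamma>) * V (x + \<gamma>)) *\<^sub>R r x)"
  define I4 where "I4 = (LBINT x. \<phi> (x + \<gamma>) *\<^sub>R ((V (x + \<alpha>) - V (x + \<gamma>)) *\<^sub>R r x))"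
  have "(LBINT x. \<phi>1 (x + \<gamma>) *\<^sub>R dm1 x) = - (LBINT x. \<phi>2 (x + \<gamma>) *\<^sub>R m1 x)"
  proof -
    have "((\<lambda>x. \<phi>1 (x + \<gamma>)) has_real_derivative \<phi>2 (x + \<gamma>)) (at x)" for x
      using d\<phi>1[of "x + \<gamma>"] by (simp add: DERIV_shift)
    then have "(LBINT x. \<phi>2 (x + \<gamma>) *\<^sub>R m1 x) = - (LBINT x. \<phi>1 (x + \<gamma>) *\<^sub>R dm1 x)"
      by (rule is_weak_deriv_test[OF wm(1)[folded m1_def]])
        (rule shift_cont[OF c\<phi>2] z(2))+
    then show ?thesis by simp
  qed
  also have "\<dots> = - e1 * complex_of_real (LBINT x. \<phi>2 x * u (x + (\<alpha> - \<gamma>)))"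
    unfolding m1_def shifted_integral by simp
  finally have A: "(LBINT x. \<phi>1 (x + \<gamma>) *\<^sub>R d\<psi>1 x)
      = I1 - e1 * complex_of_real (LBINT x. \<phi>2 x * u (x + (\<alpha> - \<gamma>)))"
    unfolding I1_def scaleR_diff_right using i1[OF L2(1)] i1[OF L2(3)] by simp
  have split: "\<phi> (x + \<gamma>) *\<^sub>R (complex_of_real (W x) * \<psi>1 x)
      = \<phi> (x + \<gamma>) *\<^sub>R ((W x - V (x + \<alpha>)) *\<^sub>R \<psi>1 x)
        + \<phi> (x + \<gamma>) *\<^sub>R (e1 * complex_of_real (V (x + \<alpha>) * u (x + \<alpha>)))
        + (\<phi> (x + \<gamma>) * V (x + \<gamma>)) *\<^sub>R r x
        + \<phi> (x + \<gamma>) *\<^sub>R ((V (x + \<alpha>) - V (x + \<gamma>)) *\<^sub>R r x)" for x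
    by (simp add: r_def m1_def scaleR_conv_of_real algebra_simps)
  have j1: "integrable lborel (\<lambda>x. \<phi> (x + \<gamma>) *\<^sub>R ((W x - V (x + \<alpha>)) *\<^sub>R \<psi>1 x))"
    by (intro i continuous_intros cW cVa c\<psi>)
  have j2: "integrable lborel (\<lambda>x. \<phi> (x + \<gamma>) *\<^sub>R (e1 * complex_of_real (V (x + \<alpha>) * u (x + \<alpha>))))"
    by (intro i continuous_intros cVa shift_cont cu)
  have "integrable lborel (\<lambda>x. \<phi> (x + \<gamma>) *\<^sub>R (V (x + \<gamma>) *\<^sub>R r x))"
    by (intro i continuous_intros cVa cr)
  then have j3: "integrable lborel (\<lambda>x. (\<phi> (x + \<gamma>) * V (x + \<gamma>)) *\<^sub>R r x)"
    by simp
  have j4: "integrable lborel (\<lambda>x. \<phi> (x + \<gamma>) *\<^sub>R ((V (x + \<alpha>) - V (x + \<gamma>)) *\<^sub>R r x))"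
    by (intro i continuous_intros cVa cr)
  have jW: "integrable lborel (\<lambda>x. \<phi> (x + \<gamma>) *\<^sub>R (complex_of_real (W x) * \<psi>1 x))"
    by (intro i continuous_intros cW c\<psi>)
  have j23: "integrable lborel (\<lambda>x. \<phi> (x + \<gamma>) *\<^sub>R ((W x - V (x + \<alpha>)) *\<^sub>R \<psi>1 x)
        + \<phi> (x + \<gamma>) *\<^sub>R (e1 * complex_of_real (V (x + \<alpha>) * u (x + \<alpha>))))"
    using j1 j2 by (rule Bochner_Integration.integrable_add)
  have j234: "integrable lborel (\<lambda>x. \<phi> (x + \<gamma>) *\<^sub>R ((W x - V (x + \<alpha>)) *\<^sub>R \<psi>1 x)
        + \<phi> (x + \<gamma>) *\<^sub>R (e1 * complex_of_real (V (x + \<alpha>) * u (x + \<alpha>)))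
        + (\<phi> (x + \<gamma>) * V (x + \<gamma>)) *\<^sub>R r x)"
    using j23 j3 by (rule Bochner_Integration.integrable_add)
  have "(LBINT x. \<phi> (x + \<gamma>) *\<^sub>R (complex_of_real (W x) * \<psi>1 x))
      = I2 + (LBINT x. \<phi> (x + \<gamma>) *\<^sub>R (e1 * complex_of_real (V (x + \<alpha>) * u (x + \<alpha>)))) + I3 + I4"
    unfolding split I2_def I3_def I4_def
    by (simp only: Bochner_Integration.integral_add[OF j234 j4] Bochner_Integration.integral_add[OF j23 j3]
        Bochner_Integration.integral_add[OF j1 j2])
  also have "(LBINT x. \<phi> (x + \<gamma>) *\<^sub>R (e1 * complex_of_real (V (x + \<alpha>) * u (x + \<alpha>))))
      = e1 * complex_of_real (LBINT x. \<phi> x * (V (x + (\<alpha> - \<gamma>)) * u (x + (\<alpha> - \<gamma>))))"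
    by (rule shifted_integral[where w = "\<lambda>x. V x * u x"])
  finally have C: "(LBINT x. \<phi> (x + \<gamma>) *\<^sub>R (complex_of_real (W x) * \<psi>1 x))
      = I2 + e1 * complex_of_real (LBINT x. \<phi> x * (V (x + (\<alpha> - \<gamma>)) * u (x + (\<alpha> - \<gamma>)))) + I3 + I4" .
  have "(LBINT x. \<phi>1 (x + \<gamma>) *\<^sub>R d\<psi>1 x + \<phi> (x + \<gamma>) *\<^sub>R (complex_of_real (W x) * \<psi>1 x))
      - e1 * complex_of_real (Q (\<alpha> - \<gamma>)) = I1 + I2 + I3 + I4"
    unfolding Bochner_Integration.integral_add[OF i1[OF L2(1)] jW] A C Q_def
    by (simp add: algebra_simps)
  then have "norm ((LBINT x. \<phi>1 (x + \<gamma>) *\<^sub>R d\<psi>1 x + \<phi> (x + \<gamma>) *\<^sub>R (complex_of_real (W x) * \<psi>1 x))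
      - e1 * complex_of_real (Q (\<alpha> - \<gamma>))) \<le> norm I1 + norm I2 + norm I3 + norm I4"
    using norm_triangle_ineq[of "I1 + I2 + I3" I4] norm_triangle_ineq[of "I1 + I2" I3]
      norm_triangle_ineq[of I1 I2] by simp
  moreover have len: "R - \<gamma> - (- R - \<gamma>) + 1 = 2 * R + 1" by simp
  have "norm I1 \<le> K * \<epsilon> * (R - \<gamma> - (- R - \<gamma>) + 1)"
    unfolding I1_def using K R by (intro loc_small_pairing[OF small_d(1)] shift_bound(1) bounds_K) auto
  then have "norm I1 \<le> C1 * \<epsilon>"
    by (simp add: len C1_def mult_ac)
  moreover have "norm I2 \<le> K * ((g1 + g12) * (S + B) * S * \<epsilon>) * (R - \<gamma> - (- R - \<gamma>) + 1)"
    unfolding I2_def using K R by (intro loc_small_pairing[OF potential_small] shift_bound(1) bounds_K) auto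
  then have "norm I2 \<le> C1 * ((g1 + g12) * (S + B) * S) * \<epsilon>"
    by (simp add: len C1_def mult_ac)
  moreover have "norm I3 \<le> C1 * \<epsilon>"
    unfolding I3_def C1_def
    by (rule pairing_by_parts[OF dH _ bounds_K(5) wr small_d(1), where \<gamma> = \<gamma>])
      (intro continuous_intros c\<phi> cV)
  moreover have "norm I4 \<le> K * \<Lambda> * (S + B) * (2 * R) * \<bar>\<alpha> - \<gamma>\<bar>"
  proof -
    have "norm I4 \<le> (LBINT x. (K * \<Lambda> * \<bar>\<alpha> - \<gamma>\<bar> * (S + B)) * indicator {-R-\<gamma>..R-\<gamma>} x)"
      unfolding I4_def
    proof (rule Bochner_Integration.integral_norm_bound_integral[OF j4])
      show "integrable lborel (\<lambda>x. (K * \<Lambda> * \<bar>\<alpha> - \<gamma>\<bar> * (S + B)) * indicat_real {-R-\<gamma>..R-\<gamma>} x)"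
        by (intro integrable_mult_right integrable_indicator_Icc)
      fix x
      show "norm (\<phi> (x + \<gamma>) *\<^sub>R (V (x + \<alpha>) - V (x + \<gamma>)) *\<^sub>R r x)
          \<le> K * \<Lambda> * \<bar>\<alpha> - \<gamma>\<bar> * (S + B) * indicat_real {- R - \<gamma>..R - \<gamma>} x"
      proof (cases "x \<in> {-R-\<gamma>..R-\<gamma>}")
        case True
        then have "\<bar>x + \<gamma>\<bar> \<le> R" by auto
        from lip[OF this \<beta>] have l: "\<bar>V (x + \<alpha>) - V (x + \<gamma>)\<bar> \<le> \<Lambda> * \<bar>\<alpha> - \<gamma>\<bar>"
          by (simp add: algebra_simps)
        have "\<bar>\<phi> (x + \<gamma>)\<bar> \<le> K"
          by (rule order_trans[OF bounds_K(2)]) (use K in \<open>simp add: indicator_def\<close>)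
        then have "\<bar>\<phi> (x + \<gamma>)\<bar> * (\<bar>V (x + \<alpha>) - V (x + \<gamma>)\<bar> * norm (r x))
            \<le> K * ((\<Lambda> * \<bar>\<alpha> - \<gamma>\<bar>) * (S + B))"
          using l K \<Lambda> by (intro mult_mono r_bound mult_nonneg_nonneg abs_ge_zero norm_ge_zero) auto
        then show ?thesis
          using True by (simp add: mult_ac abs_mult)
      next
        case False
        then show ?thesis using z(1)[OF False] by simp
      qed
    qed
    also have "\<dots> = K * \<Lambda> * (S + B) * (2 * R) * \<bar>\<alpha> - \<gamma>\<bar>"
      using R by simp
    finally show ?thesis .
  qed
  ultimately have "norm ((LBINT x. \<phi>1 (x + \<gamma>) *\<^sub>R d\<psi>1 x + \<phi> (x + \<gamma>) *\<^sub>R (complex_of_real (W x) * \<psi>1 x))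
      - e1 * complex_of_real (Q (\<alpha> - \<gamma>)))
      \<le> C1 * (2 + (g1 + g12) * (S + B) * S) * \<epsilon> + K * \<Lambda> * (S + B) * (2 * R) * \<bar>\<alpha> - \<gamma>\<bar>"
    by (simp add: algebra_simps)
  also have "\<dots> \<le> C2 * (\<epsilon> + \<bar>\<alpha> - \<gamma>\<bar>)"
  proof -
    have "C1 * (2 + (g1 + g12) * (S + B) * S) \<ge> 0" "K * \<Lambda> * (S + B) * (2 * R) \<ge> 0"
      using K R B \<Lambda> S_pos g1_pos g12_pos by (auto simp: C1_def)
    then have "0 \<le> C1 * (2 + (g1 + g12) * (S + B) * S) * \<bar>\<alpha> - \<gamma>\<bar>" "0 \<le> K * \<Lambda> * (S + B) * (2 * R) * \<epsilon>"
      using \<epsilon> by auto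
    moreover have "p * \<epsilon> + q * \<bar>\<alpha> - \<gamma>\<bar> \<le> (p + q) * (\<epsilon> + \<bar>\<alpha> - \<gamma>\<bar>)"
      if "0 \<le> p * \<bar>\<alpha> - \<gamma>\<bar>" "0 \<le> q * \<epsilon>" for p q
      using that by (simp add: algebra_simps)
    ultimately show ?thesis
      unfolding C2_def by blast
  qed
  finally show ?thesis .
qed

end

section \<open>Behaviour of \<open>M\<close> near 0 and the constants of the evolution
  estimates\<close>

lemma LBINT_eq_integral:
  fixes k :: "real \<Rightarrow> real"
  assumes "continuous_on UNIV k" "\<And>x. x \<notin> {l..h} \<Longrightarrow> k x = 0"
  shows "(LBINT x. k x) = integral {l..h} k"
proof -
  have "(LBINT x. k x) = integral UNIV k"
    using integral_lborel[OF continuous_integrable_compact[OF assms]] by simp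
  moreover have "(\<lambda>x. if x \<in> {l..h} then k x else 0) = k"
    using assms(2) by auto
  ultimately show ?thesis
    using integral_restrict_UNIV[of "{l..h}" k] by simp
qed

context wall_test
begin

text \<open>Differentiation under the integral sign, through the Leibniz rule for gauge integrals
  over a box; the support of \<open>\<phi>\<close> allows passing to \<open>{-R..R}\<close> and
  back.\<close>

lemma M_deriv: "(M has_real_derivative (LBINT x. \<phi> x * u' (x + \<beta>))) (at \<beta>)"
proof -
  have z: "\<phi> x = 0" if "x \<notin> {-R..R}" for x
    using bounds_K(2)[of x] that by (auto simp: indicator_def)
  have c: "continuous_on UNIV (\<lambda>x. \<phi> x * u (x + \<beta>))" for \<beta>
    by (intro continuous_intros c\<phi> shift_cont cu)
  have c': "continuous_on UNIV (\<lambda>x. \<phi> x * u' (x + \<beta>))" for \<beta>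
    by (intro continuous_intros c\<phi> shift_cont cu')
  have "((\<lambda>\<beta>. integral (cbox (-R) R) (\<lambda>x. \<phi> x * u (x + \<beta>))) has_field_derivative
      integral (cbox (-R) R) (\<lambda>x. \<phi> x * u' (x + \<beta>))) (at \<beta> within UNIV)"
  proof (rule leibniz_rule_field_derivative)
    show "((\<lambda>\<beta>. \<phi> x * u (x + \<beta>)) has_field_derivative \<phi> x * u' (x + \<beta>)) (at \<beta> within UNIV)" for \<beta> x
    proof -
      have "((\<lambda>\<beta>. u (\<beta> + x)) has_real_derivative u' (\<beta> + x)) (at \<beta>)"
        using du[of "\<beta> + x"] by (simp add: DERIV_shift)
      from DERIV_cmult[OF this, of "\<phi> x"] show ?thesis
        by (simp add: add.commute)
    qed
    show "(\<lambda>x. \<phi> x * u (x + \<beta>)) integrable_on cbox (-R) R" for \<beta>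
      using c by (intro integrable_continuous continuous_on_subset[OF c]) auto
    show "continuous_on (UNIV \<times> cbox (-R) R) (\<lambda>(\<beta>, x). \<phi> x * u' (x + \<beta>))"
      unfolding split_beta
      by (intro continuous_intros continuous_on_compose2[OF c\<phi>[of UNIV]] continuous_on_compose2[OF cu'[of UNIV]]) auto
  qed auto
  moreover have "M \<beta> = integral (cbox (-R) R) (\<lambda>x. \<phi> x * u (x + \<beta>))" for \<beta>
    unfolding M_def cbox_interval by (rule LBINT_eq_integral[OF c]) (use z in auto)
  then have "M = (\<lambda>\<beta>. integral (cbox (-R) R) (\<lambda>x. \<phi> x * u (x + \<beta>)))"
    by blast
  moreover have "(LBINT x. \<phi> x * u' (x + \<beta>)) = integral (cbox (-R) R) (\<lambda>x. \<phi> x * u' (x + \<beta>))"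
    unfolding cbox_interval by (rule LBINT_eq_integral[OF c']) (use z in auto)
  ultimately show ?thesis
    by simp
qed

text \<open>The square of \<open>M\<close> has the nonzero derivative
  \<open>D = 2 * M 0 * M'(0)\<close> at 0, so its increment controls the displacement linearly. The
  square is used because the phase of the functional is unknown.\<close>

lemma M_squared_local:
  assumes nz: "M 0 \<noteq> 0" "(LBINT x. \<phi> x * u' x) \<noteq> 0"
  obtains \<eta> c where "0 < \<eta>" "\<eta> \<le> 1" "0 < c"
    "\<And>\<beta>. \<bar>\<beta>\<bar> \<le> \<eta> \<Longrightarrow> \<bar>\<beta>\<bar> \<le> c * \<bar>(M \<beta>)\<^sup>2 - (M 0)\<^sup>2\<bar>"
proof -
  define D where "D = 2 * M 0 * (LBINT x. \<phi> x * u' x)"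
  have D: "D \<noteq> 0" using nz by (simp add: D_def)
  have "((\<lambda>\<beta>. (M \<beta>)\<^sup>2) has_real_derivative D) (at 0)"
    using DERIV_power[OF M_deriv[of 0], of 2] by (simp add: D_def mult_ac)
  then have "(\<lambda>h. ((M h)\<^sup>2 - (M 0)\<^sup>2) / h) \<midarrow>0\<rightarrow> D"
    by (simp add: DERIV_def)
  then have "\<forall>\<^sub>F h in at 0. \<bar>((M h)\<^sup>2 - (M 0)\<^sup>2) / h\<bar> > \<bar>D\<bar> / 2"
    by (rule order_tendstoD(1)[OF tendsto_rabs]) (use D in simp)
  then obtain d where d: "d > 0" "\<And>h. \<lbrakk>h \<noteq> 0; \<bar>h\<bar> < d\<rbrakk> \<Longrightarrow> \<bar>((M h)\<^sup>2 - (M 0)\<^sup>2) / h\<bar> > \<bar>D\<bar> / 2"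
    by (auto simp: eventually_at dist_real_def)
  show thesis
  proof (rule that[of "min 1 (d / 2)" "2 / \<bar>D\<bar>"])
    fix \<beta> :: real assume \<beta>: "\<bar>\<beta>\<bar> \<le> min 1 (d / 2)"
    show "\<bar>\<beta>\<bar> \<le> 2 / \<bar>D\<bar> * \<bar>(M \<beta>)\<^sup>2 - (M 0)\<^sup>2\<bar>"
    proof (cases "\<beta> = 0")
      case False
      then have "\<bar>(M \<beta>)\<^sup>2 - (M 0)\<^sup>2\<bar> / \<bar>\<beta>\<bar> > \<bar>D\<bar> / 2"
        using d(2)[of \<beta>] \<beta> d(1) by (simp add: abs_divide)
      then show ?thesis
        using False D by (simp add: field_simps)
    qed simp
  qed (use d(1) D in auto)
qed

text \<open>Twice the Cauchy-Schwarz bound in \<open>Z_deriv\<close>: size of the profile functional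
  times the velocity error, plus the functional error times a bound for the whole velocity.\<close>

definition C3 :: real where
  "C3 = 2 * (K * B * (2 * R) * C2 + C1 * (K * (B * B) * (2 * R) + K * B * (2 * R) + 2 * C2))"

text \<open>For a difference of squares of norms: \<open>C1\<close> bounds the difference relative
  to \<open>\<epsilon>\<close>, the bracket bounds the sum.\<close>

definition C4 :: real where
  "C4 = C1 * (2 * (K * B * (2 * R)) + C1)"

lemma C_nonneg: "C1 \<ge> 0" "C2 \<ge> 0" "C3 \<ge> 0" "C4 \<ge> 0"
proof -
  have S: "S \<ge> 0" using B by (simp add: S_def)
  show 1: "C1 \<ge> 0" using K R by (simp add: C1_def)
  show 2: "C2 \<ge> 0"
    unfolding C2_def
    by (intro add_nonneg_nonneg mult_nonneg_nonneg 1 S) (use K R B \<Lambda> g1_pos g12_pos in auto)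
  show "C3 \<ge> 0" "C4 \<ge> 0"
    unfolding C3_def C4_def
    by (intro add_nonneg_nonneg mult_nonneg_nonneg 1 2 | use K R B in simp)+
qed

end

section \<open>Evolution of the position functional along the flow\<close>

locale near_wall_flow = wall_test +
  fixes \<psi>1 \<psi>2 d\<psi>1 d\<psi>2 dm1 dm2 :: "real \<Rightarrow> real \<Rightarrow> complex" and e1 e2 :: "real \<Rightarrow> complex"
    and \<alpha> :: "real \<Rightarrow> real" and \<epsilon> :: real
  assumes near: "near_wall u v u' v' g1 g12 a b \<Phi> \<phi> \<phi>1 \<phi>2 H R K B \<Lambda>
      (\<psi>1 t) (\<psi>2 t) (d\<psi>1 t) (d\<psi>2 t) (dm1 t) (dm2 t) (e1 t) (e2 t) (\<alpha> t) \<epsilon>"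
    and schroedinger: "weak_schroedinger \<psi>1 d\<psi>1
      (\<lambda>t x. complex_of_real (g1 * ((cmod (\<psi>1 t x))\<^sup>2 - a\<^sup>2) + g12 * (cmod (\<psi>2 t x))\<^sup>2) * \<psi>1 t x)"
begin

text \<open>The weight stays frozen at the position \<open>\<alpha> s\<close> while the state
  evolves, so differentiability in \<open>t\<close> comes from the equation alone and not from
  \<open>\<alpha>\<close>. The modulus removes the phase \<open>e1 t\<close>.\<close>

definition Z where "Z s t = (norm (LBINT x. \<phi> (x + \<alpha> s) *\<^sub>R \<psi>1 t x))\<^sup>2"

lemma Z_near: "\<bar>Z s t - (M (\<alpha> t - \<alpha> s))\<^sup>2\<bar> \<le> C4 * \<epsilon>"
proof -
  interpret n: near_wall u v u' v' g1 g12 a b \<Phi> \<phi> \<phi>1 \<phi>2 H R K B \<Lambda>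
      "\<psi>1 t" "\<psi>2 t" "d\<psi>1 t" "d\<psi>2 t" "dm1 t" "dm2 t" "e1 t" "e2 t" "\<alpha> t" \<epsilon>
    by (rule near)
  define z where "z = (LBINT x. \<phi> (x + \<alpha> s) *\<^sub>R \<psi>1 t x)"
  define m where "m = e1 t * complex_of_real (M (\<alpha> t - \<alpha> s))"
  have zm: "norm (z - m) \<le> C1 * \<epsilon>"
    using n.functional_near[of "\<alpha> s"] by (simp add: z_def m_def)
  have m: "norm m = \<bar>M (\<alpha> t - \<alpha> s)\<bar>"
    by (simp add: m_def norm_mult n.e)
  have mb: "norm m \<le> K * B * (2 * R)"
    unfolding m by (rule M_bound)
  have d: "\<bar>norm z - norm m\<bar> \<le> C1 * \<epsilon>"
    using zm norm_triangle_ineq3[of z m] by linarith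
  have le1: "C1 * \<epsilon> \<le> C1" using C_nonneg n.\<epsilon> by (simp add: mult_left_le)
  have "\<bar>Z s t - (M (\<alpha> t - \<alpha> s))\<^sup>2\<bar> = \<bar>(norm z)\<^sup>2 - (norm m)\<^sup>2\<bar>"
    by (simp add: Z_def z_def m)
  also have "\<dots> = \<bar>norm z - norm m\<bar> * (norm z + norm m)"
  proof -
    have "(norm z)\<^sup>2 - (norm m)\<^sup>2 = (norm z + norm m) * (norm z - norm m)"
      unfolding power2_eq_square by (rule square_diff_square_factored)
    then show ?thesis
      by (simp only: abs_mult abs_of_nonneg[OF add_nonneg_nonneg[OF norm_ge_zero norm_ge_zero]])
        (rule mult.commute)
  qed
  also have "\<dots> \<le> (C1 * \<epsilon>) * (2 * (K * B * (2 * R)) + C1)"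
    using d mb le1 C_nonneg n.\<epsilon> by (intro mult_mono) auto
  finally show ?thesis
    by (simp add: C4_def mult_ac)
qed

text \<open>The derivative is twice the inner product of the functional with its velocity. To
  leading order these are a real multiple of the phase and a real multiple of \<open>\<i>\<close>
  times the phase, hence orthogonal in the plane; every remaining term contains a small
  factor.\<close>

lemma Z_deriv:
  assumes \<beta>: "\<bar>\<alpha> t - \<alpha> s\<bar> \<le> 1"
  shows "\<exists>D. (Z s has_real_derivative D) (at t) \<and> \<bar>D\<bar> \<le> C3 * (\<epsilon> + \<bar>\<alpha> t - \<alpha> s\<bar>)"
proof -
  interpret n: near_wall u v u' v' g1 g12 a b \<Phi> \<phi> \<phi>1 \<phi>2 H R K B \<Lambda>
      "\<psi>1 t" "\<psi>2 t" "d\<psi>1 t" "d\<psi>2 t" "dm1 t" "dm2 t" "e1 t" "e2 t" "\<alpha> t" \<epsilon>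
    by (rule near)
  define \<gamma> where "\<gamma> = \<alpha> s"
  define z where "z \<tau> = (LBINT x. \<phi> (x + \<gamma>) *\<^sub>R \<psi>1 \<tau> x)" for \<tau>
  define w where "w = (LBINT x. \<phi>1 (x + \<gamma>) *\<^sub>R d\<psi>1 t x + \<phi> (x + \<gamma>) *\<^sub>R (complex_of_real (n.W x) * \<psi>1 t x))"
  have dsh: "((\<lambda>x. \<phi> (x + \<gamma>)) has_real_derivative \<phi>1 (x + \<gamma>)) (at x)" for x
    using d\<phi>[of "x + \<gamma>"] by (simp add: DERIV_shift)
  have tf: "test_function (\<lambda>x. \<phi> (x + \<gamma>))"
    by (rule test_functionI[OF dsh shift_cont[OF c\<phi>1] shift_bound(2)[OF bounds_K(2)]])
  have dd: "deriv (\<lambda>x. \<phi> (x + \<gamma>)) = (\<lambda>x. \<phi>1 (x + \<gamma>))"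
    using dsh DERIV_imp_deriv by blast
  obtain D where D: "(z has_vector_derivative D) (at t)" "\<i> * D = w"
    using schroedinger[unfolded weak_schroedinger_def, rule_format, OF tf, of t]
    unfolding z_def[abs_def] w_def n.W_def dd by blast
  have Dw: "D = - \<i> * w"
    by (simp flip: D(2))
  define E where "E = e1 t"
  define \<mu> where "\<mu> = M (\<alpha> t - \<gamma>)"
  define q where "q = Q (\<alpha> t - \<gamma>)"
  define z1 where "z1 = z t - E * complex_of_real \<mu>"
  define z2 where "z2 = w - E * complex_of_real q"
  have z1: "norm z1 \<le> C1 * \<epsilon>"
    using n.functional_near[of \<gamma>] by (simp add: z1_def z_def E_def \<mu>_def)
  have z2: "norm z2 \<le> C2 * (\<epsilon> + \<bar>\<alpha> t - \<gamma>\<bar>)"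
    using n.velocity_near[of \<gamma>] \<beta> by (simp add: z2_def w_def E_def q_def \<gamma>_def)
  have E: "norm E = 1" by (simp add: E_def n.e)
  have \<mu>: "\<bar>\<mu>\<bar> \<le> K * B * (2 * R)" unfolding \<mu>_def by (rule M_bound)
  have q: "\<bar>q\<bar> \<le> K * (B * B) * (2 * R) + K * B * (2 * R)" unfolding q_def by (rule Q_bound)
  have "(Z s has_real_derivative 2 * (z t \<bullet> D)) (at t)"
  proof -
    have "((\<lambda>\<tau>. z \<tau> \<bullet> z \<tau>) has_derivative (\<lambda>h. z t \<bullet> (h *\<^sub>R D) + (h *\<^sub>R D) \<bullet> z t)) (at t)"
      using D(1) unfolding has_vector_derivative_def by (intro has_derivative_inner)
    then have "((\<lambda>\<tau>. z \<tau> \<bullet> z \<tau>) has_real_derivative 2 * (z t \<bullet> D)) (at t)"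
      unfolding has_field_derivative_def by (rule has_derivative_eq_rhs) (auto simp: inner_commute)
    moreover have "Z s = (\<lambda>\<tau>. z \<tau> \<bullet> z \<tau>)"
      by (simp add: fun_eq_iff Z_def z_def \<gamma>_def power2_norm_eq_inner)
    ultimately show ?thesis by simp
  qed
  moreover have "\<bar>2 * (z t \<bullet> D)\<bar> \<le> C3 * (\<epsilon> + \<bar>\<alpha> t - \<alpha> s\<bar>)"
  proof -
    have zero: "(E * complex_of_real \<mu>) \<bullet> (- \<i> * (E * complex_of_real q)) = 0"
      by (simp add: inner_complex_def algebra_simps)
    \<comment> \<open>Split off the errors \<open>z1\<close> of the functional and \<open>z2\<close>
      of the velocity; the product of the two leading parts is the one that vanishes by
      \<open>zero\<close>.\<close>
    have dec: "z t \<bullet> D = (E * complex_of_real \<mu>) \<bullet> (- \<i> * z2) + z1 \<bullet> (- \<i> * w)"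
    proof -
      have "z t \<bullet> D = (E * complex_of_real \<mu>) \<bullet> (- \<i> * w) + z1 \<bullet> (- \<i> * w)"
        unfolding Dw z1_def by (simp add: inner_diff_left)
      moreover have "- \<i> * w = - \<i> * (E * complex_of_real q) + - \<i> * z2"
        by (simp add: z2_def algebra_simps)
      ultimately show ?thesis
        by (simp only: inner_add_right zero add_0_left)
    qed
    have nw: "norm w \<le> K * (B * B) * (2 * R) + K * B * (2 * R) + 2 * C2"
    proof -
      have "norm w \<le> norm z2 + \<bar>q\<bar>"
        using norm_triangle_ineq[of z2 "E * complex_of_real q"] by (simp add: z2_def norm_mult E)
      moreover have "C2 * (\<epsilon> + \<bar>\<alpha> t - \<gamma>\<bar>) \<le> C2 * 2"
        using \<beta> n.\<epsilon> C_nonneg by (intro mult_left_mono) (auto simp: \<gamma>_def)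
      ultimately show ?thesis using z2 q by simp
    qed
    have 1: "\<bar>(E * complex_of_real \<mu>) \<bullet> (- \<i> * z2)\<bar> \<le> (K * B * (2 * R)) * (C2 * (\<epsilon> + \<bar>\<alpha> t - \<gamma>\<bar>))"
    proof (rule order_trans[OF Cauchy_Schwarz_ineq2])
      show "norm (E * complex_of_real \<mu>) * norm (- \<i> * z2) \<le> (K * B * (2 * R)) * (C2 * (\<epsilon> + \<bar>\<alpha> t - \<gamma>\<bar>))"
      proof -
        have "\<bar>\<mu>\<bar> * norm z2 \<le> (K * B * (2 * R)) * (C2 * (\<epsilon> + \<bar>\<alpha> t - \<gamma>\<bar>))"
          by (rule mult_mono[OF \<mu> z2]) (use K B R in auto)
        then show ?thesis
          by (simp add: norm_mult E)
      qed
    qed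
    have 2: "\<bar>z1 \<bullet> (- \<i> * w)\<bar> \<le> (C1 * (\<epsilon> + \<bar>\<alpha> t - \<gamma>\<bar>)) * (K * (B * B) * (2 * R) + K * B * (2 * R) + 2 * C2)"
    proof (rule order_trans[OF Cauchy_Schwarz_ineq2])
      have "C1 * \<epsilon> \<le> C1 * (\<epsilon> + \<bar>\<alpha> t - \<gamma>\<bar>)"
        using C_nonneg by (intro mult_left_mono) auto
      then show "norm z1 * norm (- \<i> * w) \<le> (C1 * (\<epsilon> + \<bar>\<alpha> t - \<gamma>\<bar>)) * (K * (B * B) * (2 * R) + K * B * (2 * R) + 2 * C2)"
        using z1 nw C_nonneg n.\<epsilon> by (intro mult_mono) (auto simp: norm_mult)
    qed
    have "\<bar>z t \<bullet> D\<bar> \<le> (K * B * (2 * R)) * (C2 * (\<epsilon> + \<bar>\<alpha> t - \<gamma>\<bar>))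
        + (C1 * (\<epsilon> + \<bar>\<alpha> t - \<gamma>\<bar>)) * (K * (B * B) * (2 * R) + K * B * (2 * R) + 2 * C2)"
      unfolding dec using 1 2 by linarith
    also have "\<dots> = C3 / 2 * (\<epsilon> + \<bar>\<alpha> t - \<gamma>\<bar>)"
      unfolding C3_def by (simp add: algebra_simps)
    finally show ?thesis
      by (simp add: \<gamma>_def abs_mult)
  qed
  ultimately show ?thesis by blast
qed

end

section \<open>Existence of the weights, and rigidity of the wall under translation\<close>

context wall_profile
begin

text \<open>Take \<open>\<phi>\<close> to be the derivative of the function from
  \<open>test_function_exists\<close>. Orthogonality to \<open>V\<close> allows the compactly
  supported primitive \<open>H\<close> of \<open>\<phi> * V\<close>; compactness supplies the
  constants.\<close>

lemma wall_test_exists: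
  "\<exists>\<Phi> \<phi> \<phi>1 \<phi>2 H R K B \<Lambda>. wall_test u v u' v' g1 g12 a b \<Phi> \<phi> \<phi>1 \<phi>2 H R K B \<Lambda> \<and>
     (LBINT x. \<phi> x * u x) \<noteq> 0 \<and> (LBINT x. \<phi> x * u' x) \<noteq> 0"
proof -
  obtain \<Phi> where \<Phi>: "\<Phi> \<in> C3_test" "(LBINT x. \<Phi> x * V' x) = 0" "(LBINT x. \<Phi> x * u' x) \<noteq> 0"
    "(LBINT x. \<Phi> x * (V x * u x)) \<noteq> 0"
    using test_function_exists by blast
  obtain \<phi> \<phi>1 \<phi>2 R0 where d: "\<And>x. (\<Phi> has_real_derivative \<phi> x) (at x)"
    "\<And>x. (\<phi> has_real_derivative \<phi>1 x) (at x)" "\<And>x. (\<phi>1 has_real_derivative \<phi>2 x) (at x)"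
    "continuous_on UNIV \<phi>2" "\<And>x. x \<notin> {-R0..R0} \<Longrightarrow> \<Phi> x = 0"
    using \<Phi>(1) by (rule C3_testE) blast
  define R where "R = \<bar>R0\<bar> + 1"
  have R: "R > 0" by (simp add: R_def)
  have z: "\<Phi> x = 0" if "x \<notin> {-R..R}" for x
  proof -
    have "x \<notin> {-R0..R0}" using that by (auto simp: R_def)
    then show ?thesis by (rule d(5))
  qed
  have z0: "\<phi> x = 0" if "x \<notin> {-R..R}" for x
    using deriv_vanishes_outside[OF d(1) z that] .
  have z1: "\<phi>1 x = 0" if "x \<notin> {-R..R}" for x
    using deriv_vanishes_outside[OF d(2) z0 that] .
  have z2: "\<phi>2 x = 0" if "x \<notin> {-R..R}" for x
    using deriv_vanishes_outside[OF d(3) z1 that] .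
  have c: "continuous_on UNIV \<Phi>" "continuous_on UNIV \<phi>" "continuous_on UNIV \<phi>1"
    by (rule continuous_on_test, rule d)+
  have parts: "(LBINT x. \<phi> x * f x) = - (LBINT x. \<Phi> x * f' x)"
    if "\<And>x. (f has_real_derivative f' x) (at x)" "continuous_on UNIV f'" for f f' :: "real \<Rightarrow> real"
    using is_weak_deriv_test[OF is_weak_deriv_C1 d(1) c(2) z, of f f'] that
    by (simp add: has_real_derivative_iff_has_vector_derivative)
  have cVu: "continuous_on UNIV (\<lambda>x. V x * u x)"
    by (intro continuous_intros cV cu)
  have n1: "(LBINT x. \<phi> x * u x) \<noteq> 0"
    using parts[OF du cu'] \<Phi>(3) by simp
  have n2: "(LBINT x. \<phi> x * u' x) \<noteq> 0"
    using parts[OF du'V cVu] \<Phi>(4) by simp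
  have n3: "(LBINT x. \<phi> x * V x) = 0"
    using parts[OF dV cV'] \<Phi>(2) by simp
  have cfV: "continuous_on UNIV (\<lambda>x. \<phi> x * V x)"
    by (intro continuous_intros c cV)
  have zfV: "\<phi> x * V x = 0" if "x \<notin> {-R..R}" for x
    using z0[OF that] by simp
  have lR: "-R \<le> R"
    using R by simp
  obtain H where H: "\<And>x. (H has_real_derivative \<phi> x * V x) (at x)" "\<And>x. x \<notin> {-R..R} \<Longrightarrow> H x = 0"
    using antiderivative_compact[OF cfV zfV n3 lR] by metis
  have cH: "continuous_on UNIV H"
    by (rule continuous_on_test, rule H)
  obtain K0 where K0: "K0 > 0" "\<And>x. \<bar>\<Phi> x\<bar> \<le> K0 * indicator {-R..R} x" using bounded_test[OF c(1) z] by metis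
  obtain K1 where K1: "K1 > 0" "\<And>x. \<bar>\<phi> x\<bar> \<le> K1 * indicator {-R..R} x" using bounded_test[OF c(2) z0] by metis
  obtain K2 where K2: "K2 > 0" "\<And>x. \<bar>\<phi>1 x\<bar> \<le> K2 * indicator {-R..R} x" using bounded_test[OF c(3) z1] by metis
  obtain K3 where K3: "K3 > 0" "\<And>x. \<bar>\<phi>2 x\<bar> \<le> K3 * indicator {-R..R} x" using bounded_test[OF d(4) z2] by metis
  obtain K4 where K4: "K4 > 0" "\<And>x. \<bar>H x\<bar> \<le> K4 * indicator {-R..R} x" using bounded_test[OF cH H(2)] by metis
  define K where "K = K0 + K1 + K2 + K3 + K4"
  have Kle: "k * indicator {-R..R} x \<le> K * indicator {-R..R} x" if "k \<le> K" for k x :: real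
    using that by (intro mult_right_mono) auto
  obtain B where B: "B > 0" "\<And>x. \<bar>u x\<bar> \<le> B" "\<And>x. \<bar>v x\<bar> \<le> B" "\<And>x. \<bar>V x\<bar> \<le> B"
    using bounds by blast
  \<comment> \<open>The margin 1 on each side leaves room for displacements \<open>\<beta>\<close>
    with \<open>\<bar>\<beta>\<bar> \<le> 1\<close>.\<close>
  have "compact (V' ` {-R-1..R+1})"
    by (intro compact_continuous_image cV') auto
  then obtain L where L: "\<And>x. x \<in> {-R-1..R+1} \<Longrightarrow> \<bar>V' x\<bar> \<le> L"
    using compact_imp_bounded by (force simp: bounded_iff)
  have lip: "\<bar>V (x + \<beta>) - V x\<bar> \<le> \<bar>L\<bar> * \<bar>\<beta>\<bar>" if "\<bar>x\<bar> \<le> R" "\<bar>\<beta>\<bar> \<le> 1" for x \<beta>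
  proof -
    have "norm (V (x + \<beta>) - V x) \<le> \<bar>L\<bar> * norm ((x + \<beta>) - x)"
    proof (rule field_differentiable_bound)
      show "convex {-R-1..R+1}" by simp
      show "(V has_field_derivative V' z) (at z within {-R-1..R+1})" for z
        using dV by (rule has_field_derivative_at_within)
      show "norm (V' z) \<le> \<bar>L\<bar>" if "z \<in> {-R-1..R+1}" for z
        using L[OF that] by simp
    qed (use that in auto)
    then show ?thesis by simp
  qed
  have "wall_test u v u' v' g1 g12 a b \<Phi> \<phi> \<phi>1 \<phi>2 H R K B \<bar>L\<bar>"
  proof (unfold_locales)
    show "K > 0" using K0(1) K1(1) K2(1) K3(1) K4(1) by (simp add: K_def)
    fix x
    show "\<bar>\<Phi> x\<bar> \<le> K * indicator {-R..R} x" "\<bar>\<phi> x\<bar> \<le> K * indicator {-R..R} x"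
      "\<bar>\<phi>1 x\<bar> \<le> K * indicator {-R..R} x" "\<bar>\<phi>2 x\<bar> \<le> K * indicator {-R..R} x"
      "\<bar>H x\<bar> \<le> K * indicator {-R..R} x"
      by (rule order_trans[OF K0(2) Kle] order_trans[OF K1(2) Kle] order_trans[OF K2(2) Kle]
          order_trans[OF K3(2) Kle] order_trans[OF K4(2) Kle],
          use K0(1) K1(1) K2(1) K3(1) K4(1) in \<open>simp add: K_def\<close>)+
  qed (use d H R B lip in auto)
  then show ?thesis
    using n1 n2 by blast
qed

text \<open>The integral of the difference over a long window telescopes: with
  \<open>\<beta>\<close> the displacement, it is the integral of \<open>\<bar>u\<bar>\<close> over
  an interval of length \<open>\<beta>\<close> on the far right minus one on the far left, hence at
  least \<open>\<beta> * (3 * a / 4 - a / 4)\<close>.\<close>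

lemma shift_rigidity:
  obtains C \<nu> where "C > 0" "\<nu> > 0"
    "\<And>\<epsilon> \<alpha>1 \<alpha>2. \<lbrakk>0 < \<epsilon>; \<epsilon> \<le> \<nu>; loc_small \<epsilon> (\<lambda>x. \<bar>u (x + \<alpha>1)\<bar> - \<bar>u (x + \<alpha>2)\<bar>)\<rbrakk>
      \<Longrightarrow> \<bar>\<alpha>1 - \<alpha>2\<bar> \<le> C * \<epsilon>"
proof -
  have "\<forall>\<^sub>F x in at_top. \<bar>u x\<bar> > 3 * a / 4"
    by (rule order_tendstoD(1)[OF tendsto_rabs[OF u_top]]) (use a_pos in simp)
  then obtain N1 where N1: "\<And>x. x \<ge> N1 \<Longrightarrow> \<bar>u x\<bar> > 3 * a / 4"
    by (auto simp: eventually_at_top_linorder)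
  have "\<forall>\<^sub>F x in at_bot. \<bar>u x\<bar> < a / 4"
    by (rule order_tendstoD(2)[OF tendsto_rabs[OF u_bot]]) (use a_pos in simp)
  then obtain N2 where N2: "\<And>x. x \<le> N2 \<Longrightarrow> \<bar>u x\<bar> < a / 4"
    by (auto simp: eventually_at_bot_linorder)
  define R where "R = \<bar>N1\<bar> + \<bar>N2\<bar>"
  have R: "R \<ge> 0" "\<And>x. x \<ge> R \<Longrightarrow> \<bar>u x\<bar> > 3 * a / 4" "\<And>x. x \<le> - R \<Longrightarrow> \<bar>u x\<bar> < a / 4"
    using N1 N2 by (auto simp: R_def)
  have cau: "continuous_on S (\<lambda>x. \<bar>u x\<bar>)" for S
    by (intro continuous_intros cu)
  obtain F where F: "\<And>x. (F has_real_derivative \<bar>u x\<bar>) (at x)"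
    using antiderivative_exists[OF cau] by blast
  have main: "\<alpha>1 - \<alpha>2 \<le> (4 / a) * (2 * R + 1) * \<epsilon>"
    if e: "0 < \<epsilon>" "\<epsilon> \<le> a / 4" and s: "loc_small \<epsilon> (\<lambda>x. \<bar>u (x + \<alpha>1)\<bar> - \<bar>u (x + \<alpha>2)\<bar>)"
      and le: "\<alpha>1 \<ge> \<alpha>2" for \<epsilon> \<alpha>1 \<alpha>2
  proof (cases "\<alpha>1 = \<alpha>2")
    case True
    then show ?thesis using e a_pos R by simp
  next
    case False
    define \<beta> where "\<beta> = \<alpha>1 - \<alpha>2"
    have \<beta>: "\<beta> > 0" using le False by (simp add: \<beta>_def)
    \<comment> \<open>After the shifts by \<open>\<alpha>1\<close> and \<open>\<alpha>2\<close> the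
      end points become \<open>R + \<beta>\<close>, \<open>R\<close>, \<open>- R\<close> and
      \<open>- R - \<beta>\<close>, in the regions where \<open>\<bar>u\<bar>\<close> is close to
      its limits.\<close>
    define l h where "l = - R - \<beta> - \<alpha>2" and "h = R - \<alpha>2"
    have lh: "l \<le> h" using R \<beta> by (simp add: l_def h_def)
    have "(LBINT x. indicator {l..h} x *\<^sub>R (\<bar>u (x + \<alpha>1)\<bar> - \<bar>u (x + \<alpha>2)\<bar>))
        = (F (h + \<alpha>1) - F (h + \<alpha>2)) - (F (l + \<alpha>1) - F (l + \<alpha>2))"
    proof (rule integral_FTC_atLeastAtMost[OF lh])
      show "continuous_on {l..h} (\<lambda>x. \<bar>u (x + \<alpha>1)\<bar> - \<bar>u (x + \<alpha>2)\<bar>)"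
        by (intro continuous_intros continuous_on_compose2[OF cu[of UNIV]]) auto
      have "((\<lambda>x. F (x + c)) has_real_derivative \<bar>u (x + c)\<bar>) (at x)" for x c
        using F[of "x + c"] by (simp add: DERIV_shift)
      then show "((\<lambda>x. F (x + \<alpha>1) - F (x + \<alpha>2)) has_vector_derivative \<bar>u (x + \<alpha>1)\<bar> - \<bar>u (x + \<alpha>2)\<bar>) (at x within {l..h})" for x
        unfolding has_real_derivative_iff_has_vector_derivative[symmetric]
        by (intro DERIV_diff) (auto intro: has_field_derivative_at_within)
    qed
    moreover have "h + \<alpha>1 = R + \<beta>" "h + \<alpha>2 = R" "l + \<alpha>1 = - R" "l + \<alpha>2 = - R - \<beta>"
      by (simp_all add: l_def h_def \<beta>_def)
    ultimately have int: "(LBINT x. indicator {l..h} x *\<^sub>R (\<bar>u (x + \<alpha>1)\<bar> - \<bar>u (x + \<alpha>2)\<bar>))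
        = (F (R + \<beta>) - F R) - (F (- R) - F (- R - \<beta>))"
      by simp
    obtain x1 where x1: "R < x1" "F (R + \<beta>) - F R = \<beta> * \<bar>u x1\<bar>"
      using MVT2[of R "R + \<beta>" F "\<lambda>x. \<bar>u x\<bar>"] F \<beta> by auto
    obtain x2 where x2: "x2 < - R" "F (- R) - F (- R - \<beta>) = \<beta> * \<bar>u x2\<bar>"
      using MVT2[of "- R - \<beta>" "- R" F "\<lambda>x. \<bar>u x\<bar>"] F \<beta> by auto
    have "\<beta> * (3 * a / 4) \<le> \<beta> * \<bar>u x1\<bar>" "\<beta> * \<bar>u x2\<bar> \<le> \<beta> * (a / 4)"
      using R(2)[of x1] R(3)[of x2] x1 x2 \<beta> by (auto intro!: mult_left_mono)
    then have "\<beta> * (a / 2) \<le> (LBINT x. indicator {l..h} x *\<^sub>R (\<bar>u (x + \<alpha>1)\<bar> - \<bar>u (x + \<alpha>2)\<bar>))"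
      unfolding int x1(2) x2(2) by (simp add: field_simps)
    also have "\<dots> \<le> norm (LBINT x. indicator {l..h} x *\<^sub>R (\<bar>u (x + \<alpha>1)\<bar> - \<bar>u (x + \<alpha>2)\<bar>))"
      by simp
    also have "\<dots> \<le> 1 * \<epsilon> * (h - l + 1)"
      by (rule loc_small_pairing[OF s lh]) auto
    also have "\<dots> = \<epsilon> * (2 * R + 1) + \<epsilon> * \<beta>"
      by (simp add: l_def h_def algebra_simps)
    \<comment> \<open>The window grows with \<open>\<beta>\<close>; since
      \<open>\<epsilon> \<le> a / 4\<close>, its contribution can be absorbed by half of the lower
      bound.\<close>
    also have "\<dots> \<le> \<epsilon> * (2 * R + 1) + (a / 4) * \<beta>"
      using e \<beta> by simp
    finally have "\<beta> * (a / 4) \<le> \<epsilon> * (2 * R + 1)"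
      by (simp add: algebra_simps)
    then show ?thesis
      using a_pos by (simp add: \<beta>_def[symmetric] field_simps)
  qed
  show thesis
  proof (rule that[of "(4 / a) * (2 * R + 1)" "a / 4"])
    fix \<epsilon> \<alpha>1 \<alpha>2
    assume e: "0 < \<epsilon>" "\<epsilon> \<le> a / 4" and s: "loc_small \<epsilon> (\<lambda>x. \<bar>u (x + \<alpha>1)\<bar> - \<bar>u (x + \<alpha>2)\<bar>)"
    show "\<bar>\<alpha>1 - \<alpha>2\<bar> \<le> (4 / a) * (2 * R + 1) * \<epsilon>"
    proof (cases "\<alpha>1 \<ge> \<alpha>2")
      case True
      then show ?thesis using main[OF e s] by simp
    next
      case False
      have "loc_small \<epsilon> (\<lambda>x. \<bar>u (x + \<alpha>2)\<bar> - \<bar>u (x + \<alpha>1)\<bar>)"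
        using loc_small_minus[OF s] by simp
      from main[OF e this] show ?thesis using False by simp
    qed
  qed (use a_pos R in \<open>auto intro!: mult_pos_pos add_nonneg_pos\<close>)
qed

end

subsection \<open>Slow motion\<close>

text \<open>The function \<open>\<alpha>\<close> need not be continuous, but \<open>J\<close> bounds its jumps, which is enough for a
  continuity argument on \<open>[s, s + h]\<close>.\<close>

lemma slow_motion_step:
  fixes \<alpha> :: "real \<Rightarrow> real" and Z :: "real \<Rightarrow> real \<Rightarrow> real"
  assumes D: "\<And>s t. \<bar>\<alpha> t - \<alpha> s\<bar> \<le> \<eta> \<Longrightarrow>
      \<exists>D. (Z s has_real_derivative D) (at t) \<and> \<bar>D\<bar> \<le> C * (\<epsilon> + \<bar>\<alpha> t - \<alpha> s\<bar>)"
    and I: "\<And>s t. \<bar>\<alpha> t - \<alpha> s\<bar> \<le> \<eta> \<Longrightarrow> \<bar>\<alpha> t - \<alpha> s\<bar> \<le> c * (\<bar>Z s t - Z s s\<bar> + \<epsilon>)"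
    and J: "\<And>t. \<exists>d>0. \<forall>t'. \<bar>t' - t\<bar> < d \<longrightarrow> \<bar>\<alpha> t' - \<alpha> t\<bar> \<le> j * \<epsilon>"
    and pos: "C > 0" "c > 0" "j > 0" "\<epsilon> > 0" and small: "(2 * c + 2 * j) * \<epsilon> \<le> \<eta>"
    and h: "h = 1 / (C * (1 + 2 * c + 2 * j))"
    and t: "s \<le> t" "t \<le> s + h"
  shows "\<bar>\<alpha> t - \<alpha> s\<bar> \<le> 2 * c * \<epsilon>"
proof -
  have hpos: "h > 0" using pos h by simp
  \<comment> \<open>The bootstrap: the weak bound keeps \<open>\<alpha>\<close> in the range of
    \<open>D\<close> and \<open>I\<close>. The choice of \<open>h\<close> makes the change of
    \<open>Z s\<close> at most \<open>\<epsilon>\<close>, and then \<open>I\<close> returns the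
    strong bound.\<close>
  have improve: "\<bar>\<alpha> t - \<alpha> s\<bar> \<le> 2 * c * \<epsilon>"
    if t: "s \<le> t" "t \<le> s + h" and b: "\<And>\<tau>. \<lbrakk>s \<le> \<tau>; \<tau> \<le> t\<rbrakk> \<Longrightarrow> \<bar>\<alpha> \<tau> - \<alpha> s\<bar> \<le> (2 * c + 2 * j) * \<epsilon>" for t
  proof -
    have "\<exists>D. (Z s has_real_derivative D) (at \<tau>) \<and> \<bar>D\<bar> \<le> C * (1 + 2 * c + 2 * j) * \<epsilon>"
      if \<tau>: "s \<le> \<tau>" "\<tau> \<le> t" for \<tau>
    proof -
      obtain D where "(Z s has_real_derivative D) (at \<tau>)" "\<bar>D\<bar> \<le> C * (\<epsilon> + \<bar>\<alpha> \<tau> - \<alpha> s\<bar>)"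
        using D[of \<tau> s] order_trans[OF b[OF \<tau>] small] by blast
      moreover have "C * (\<epsilon> + \<bar>\<alpha> \<tau> - \<alpha> s\<bar>) \<le> C * (\<epsilon> + (2 * c + 2 * j) * \<epsilon>)"
        using pos b[OF \<tau>] by (intro mult_left_mono add_left_mono) auto
      ultimately show ?thesis
        by (intro exI[of _ D]) (auto simp: algebra_simps)
    qed
    then obtain D where D: "\<And>\<tau>. s \<le> \<tau> \<Longrightarrow> \<tau> \<le> t \<Longrightarrow> (Z s has_real_derivative D \<tau>) (at \<tau>)"
      "\<And>\<tau>. s \<le> \<tau> \<Longrightarrow> \<tau> \<le> t \<Longrightarrow> \<bar>D \<tau>\<bar> \<le> C * (1 + 2 * c + 2 * j) * \<epsilon>"
      by metis
    have "norm (Z s t - Z s s) \<le> C * (1 + 2 * c + 2 * j) * \<epsilon> * norm (t - s)"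
    proof (rule field_differentiable_bound)
      show "convex {s..t}" by simp
      show "(Z s has_field_derivative D \<tau>) (at \<tau> within {s..t})" if "\<tau> \<in> {s..t}" for \<tau>
        using D(1)[of \<tau>] that by (auto intro: has_field_derivative_at_within)
      show "norm (D \<tau>) \<le> C * (1 + 2 * c + 2 * j) * \<epsilon>" if "\<tau> \<in> {s..t}" for \<tau>
        using D(2)[of \<tau>] that by auto
    qed (use t in auto)
    also have "\<dots> \<le> C * (1 + 2 * c + 2 * j) * \<epsilon> * h"
      using t pos by (intro mult_left_mono) auto
    also have "\<dots> = \<epsilon>"
    proof -
      have "1 + 2 * c + 2 * j > 0" using pos by simp
      then show ?thesis unfolding h using pos by simp
    qed
    finally have "\<bar>Z s t - Z s s\<bar> \<le> \<epsilon>" by simp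
    then have "c * (\<bar>Z s t - Z s s\<bar> + \<epsilon>) \<le> c * (\<epsilon> + \<epsilon>)"
      using pos by (intro mult_left_mono) auto
    moreover have "\<bar>\<alpha> t - \<alpha> s\<bar> \<le> c * (\<bar>Z s t - Z s s\<bar> + \<epsilon>)"
      using I[of t s] order_trans[OF b small] t by auto
    ultimately show ?thesis by simp
  qed
  define T where "T = {\<tau>. s \<le> \<tau> \<and> \<tau> \<le> s + h \<and> (\<forall>t\<in>{s..\<tau>}. \<bar>\<alpha> t - \<alpha> s\<bar> \<le> 2 * c * \<epsilon>)}"
  have sT: "s \<in> T" using hpos pos by (simp add: T_def)
  have bdd: "bdd_above T" by (auto simp: T_def bdd_above_def)
  define \<sigma> where "\<sigma> = Sup T"
  have s\<sigma>: "s \<le> \<sigma>" unfolding \<sigma>_def using sT bdd by (rule cSup_upper)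
  obtain d where d: "d > 0" "\<And>t'. \<bar>t' - \<sigma>\<bar> < d \<Longrightarrow> \<bar>\<alpha> t' - \<alpha> \<sigma>\<bar> \<le> j * \<epsilon>"
    using J[of \<sigma>] by blast
  obtain \<tau> where \<tau>: "\<tau> \<in> T" "\<sigma> - d < \<tau>"
    using less_cSup_iff[of T "\<sigma> - d"] sT bdd d(1) by (auto simp: \<sigma>_def)
  have \<tau>\<sigma>: "\<tau> \<le> \<sigma>" unfolding \<sigma>_def using \<tau>(1) bdd by (rule cSup_upper)
  define \<rho> where "\<rho> = min (\<sigma> + d / 2) (s + h)"
  \<comment> \<open>Past the supremum the strong bound at \<open>\<tau>\<close> is followed by two
    jumps through \<open>\<sigma>\<close>, each at most \<open>j * \<epsilon>\<close>; hence the
    \<open>2 * j\<close>.\<close>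
  have weak: "\<bar>\<alpha> t - \<alpha> s\<bar> \<le> (2 * c + 2 * j) * \<epsilon>" if "s \<le> t" "t \<le> \<rho>" for t
  proof (cases "t \<le> \<tau>")
    case True
    then have "\<bar>\<alpha> t - \<alpha> s\<bar> \<le> 2 * c * \<epsilon>" using \<tau>(1) that by (auto simp: T_def)
    also have "\<dots> \<le> (2 * c + 2 * j) * \<epsilon>" using pos by simp
    finally show ?thesis .
  next
    case False
    then have "\<bar>t - \<sigma>\<bar> < d" "\<bar>\<tau> - \<sigma>\<bar> < d"
      using \<tau> \<tau>\<sigma> that d(1) by (auto simp: \<rho>_def)
    from d(2)[OF this(1)] d(2)[OF this(2)]
    have "\<bar>\<alpha> t - \<alpha> \<tau>\<bar> \<le> 2 * j * \<epsilon>" by simp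
    moreover have "\<bar>\<alpha> \<tau> - \<alpha> s\<bar> \<le> 2 * c * \<epsilon>"
      using \<tau>(1) by (auto simp: T_def)
    ultimately show ?thesis by (simp add: algebra_simps)
  qed
  have strong: "\<bar>\<alpha> t - \<alpha> s\<bar> \<le> 2 * c * \<epsilon>" if "s \<le> t" "t \<le> \<rho>" for t
    using that weak by (intro improve) (auto simp: \<rho>_def)
  have "\<rho> \<in> T"
    using strong s\<sigma> d(1) hpos by (auto simp: T_def \<rho>_def)
  then have "\<rho> \<le> \<sigma>"
    unfolding \<sigma>_def using bdd by (intro cSup_upper)
  \<comment> \<open>Otherwise \<open>\<rho>\<close> would be \<open>\<sigma> + d / 2\<close>, which
    exceeds the supremum.\<close>
  then have "\<rho> = s + h"
    using d(1) by (auto simp: \<rho>_def min_def split: if_splits)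
  then show ?thesis
    using strong t by simp
qed

text \<open>Cover the way from 0 to \<open>t\<close> by equal steps of length at most
  \<open>h\<close>; the ceiling of \<open>\<bar>t\<bar> / h\<close> many suffice.\<close>

lemma slow_motion:
  fixes \<alpha> :: "real \<Rightarrow> real"
  assumes step: "\<And>s t. \<lbrakk>s \<le> t; t \<le> s + h\<rbrakk> \<Longrightarrow> \<bar>\<alpha> t - \<alpha> s\<bar> \<le> k" and h: "h > 0" and k: "k \<ge> 0"
  shows "\<bar>\<alpha> t - \<alpha> 0\<bar> \<le> k * (\<bar>t\<bar> / h + 1)"
proof -
  have step': "\<bar>\<alpha> t - \<alpha> s\<bar> \<le> k" if "\<bar>t - s\<bar> \<le> h" for s t
    using step[of s t] step[of t s] that by (cases "s \<le> t") auto
  have n: "\<bar>\<alpha> t - \<alpha> 0\<bar> \<le> k * real n" if "\<bar>t\<bar> \<le> real n * h" for n t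
    using that
  proof (induction n arbitrary: t)
    case 0
    then show ?case by simp
  next
    case (Suc n)
    \<comment> \<open>The point reached before the last of \<open>Suc n\<close> equal steps.\<close>
    define t' where "t' = t * (real n / real (Suc n))"
    have "\<bar>t\<bar> / real (Suc n) \<le> h"
      using Suc.prems by (simp add: field_simps)
    moreover have "t - t' = t / real (Suc n)"
      by (simp add: t'_def field_simps)
    ultimately have "\<bar>t - t'\<bar> \<le> h" by simp
    then have 1: "\<bar>\<alpha> t - \<alpha> t'\<bar> \<le> k" by (rule step')
    have "\<bar>t'\<bar> = (\<bar>t\<bar> / real (Suc n)) * real n"
      by (simp add: t'_def abs_mult)
    also have "\<dots> \<le> h * real n"
      using \<open>\<bar>t\<bar> / real (Suc n) \<le> h\<close> by (intro mult_right_mono) auto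
    finally have "\<bar>\<alpha> t' - \<alpha> 0\<bar> \<le> k * real n"
      by (intro Suc.IH) (simp add: mult.commute)
    with 1 show ?case by (simp add: algebra_simps)
  qed
  define n where "n = nat \<lceil>\<bar>t\<bar> / h\<rceil>"
  have "\<bar>t\<bar> / h \<le> real n" "real n \<le> \<bar>t\<bar> / h + 1"
    using h by (auto simp: n_def of_nat_ceiling)
  then have "\<bar>\<alpha> t - \<alpha> 0\<bar> \<le> k * real n"
    using h by (intro n) (simp add: field_simps)
  also have "\<dots> \<le> k * (\<bar>t\<bar> / h + 1)"
    using k \<open>real n \<le> \<bar>t\<bar> / h + 1\<close> by (intro mult_left_mono)
  finally show ?thesis .
qed

subsection \<open>The distance \<open>\<rho>\<^sub>A\<close> and the conclusion\<close>

lemma rho_component_le: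
  assumes "rho_component A pr \<Psi> \<Phi> \<le> c"
  shows "L2_enorm (\<lambda>x. pr (weak_deriv \<Psi> x) - pr (weak_deriv \<Phi> x)) \<le> c"
    "L2_enorm (\<lambda>x. cmod (pr (\<Psi> x)) - cmod (pr (\<Phi> x))) \<le> c"
proof -
  show "L2_enorm (\<lambda>x. pr (weak_deriv \<Psi> x) - pr (weak_deriv \<Phi> x)) \<le> c"
    using assms unfolding rho_component_def
    by (meson add_increasing2 order_refl order_trans zero_le)
  show "L2_enorm (\<lambda>x. cmod (pr (\<Psi> x)) - cmod (pr (\<Phi> x))) \<le> c"
    using assms unfolding rho_component_def
    by (meson add_increasing add_increasing2 order_refl order_trans zero_le)
qed

lemma rho_component_loc_small:
  assumes H: "\<Psi> \<in> H1loc" "\<Phi> \<in> H1loc" and pr: "bounded_linear pr"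
    and le: "rho_component A pr \<Psi> \<Phi> \<le> ennreal \<epsilon>" and e: "\<epsilon> > 0"
  shows "loc_small \<epsilon> (\<lambda>x. pr (weak_deriv \<Psi> x) - pr (weak_deriv \<Phi> x))"
    "loc_small \<epsilon> (\<lambda>x. cmod (pr (\<Psi> x)) - cmod (pr (\<Phi> x)))"
proof -
  have m: "(\<lambda>x. pr (weak_deriv \<Psi> x)) \<in> borel_measurable lborel"
      "(\<lambda>x. pr (weak_deriv \<Phi> x)) \<in> borel_measurable lborel"
    using L2loc_bounded_linear[OF pr weak_deriv_H1loc(1)[OF H(1)]]
      L2loc_bounded_linear[OF pr weak_deriv_H1loc(1)[OF H(2)]] by (auto simp: L2loc_def)
  have c: "continuous_on UNIV (\<lambda>x. pr (\<Psi> x))" "continuous_on UNIV (\<lambda>x. pr (\<Phi> x))"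
    by (rule bounded_linear.continuous_on[OF pr weak_deriv_H1loc(3)[OF H(1)]]
        bounded_linear.continuous_on[OF pr weak_deriv_H1loc(3)[OF H(2)]])+
  have c': "continuous_on UNIV (\<lambda>x. cmod (pr (\<Psi> x)) - cmod (pr (\<Phi> x)))"
    by (intro continuous_intros c)
  show "loc_small \<epsilon> (\<lambda>x. pr (weak_deriv \<Psi> x) - pr (weak_deriv \<Phi> x))"
    by (intro loc_small_L2_enorm e rho_component_le(1)[OF le] borel_measurable_diff m)
  show "loc_small \<epsilon> (\<lambda>x. cmod (pr (\<Psi> x)) - cmod (pr (\<Phi> x)))"
    using borel_measurable_continuous_onI[OF c']
    by (intro loc_small_L2_enorm e rho_component_le(2)[OF le]) simp
qed

lemma rho_le:
  assumes "rho A \<Psi> \<Phi> \<le> c"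
  shows "rho_component A fst \<Psi> \<Phi> \<le> c" "rho_component A snd \<Psi> \<Phi> \<le> c"
  using assms unfolding rho_def
  by (meson add_increasing add_increasing2 order_refl order_trans zero_le)+

lemma modulated_H1loc:
  assumes du: "\<And>x. ((\<lambda>x. fst (U x)) has_real_derivative u' x) (at x)"
    and dv: "\<And>x. ((\<lambda>x. snd (U x)) has_real_derivative v' x) (at x)"
    and c: "continuous_on UNIV u'" "continuous_on UNIV v'"
  shows "modulated s t \<alpha> U \<in> H1loc"
proof -
  define g where "g x = (exp (\<i> * complex_of_real s) * complex_of_real (u' (x + \<alpha>)),
      exp (\<i> * complex_of_real t) * complex_of_real (v' (x + \<alpha>)))" for x
  have comp: "((\<lambda>x. e * complex_of_real (w (x + \<alpha>))) has_vector_derivative e * complex_of_real (w' (x + \<alpha>))) (at x)"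
    if "\<And>x. (w has_real_derivative w' x) (at x)" for e w w' x
  proof -
    have "((\<lambda>x. w (x + \<alpha>)) has_real_derivative w' (x + \<alpha>)) (at x)"
      using that[of "x + \<alpha>"] by (simp add: DERIV_shift)
    then have "((\<lambda>x. w (x + \<alpha>)) has_vector_derivative w' (x + \<alpha>)) (at x)"
      by (simp add: has_real_derivative_iff_has_vector_derivative)
    from bounded_linear.has_vector_derivative[OF bounded_linear_of_real this]
    show ?thesis
      by (rule has_vector_derivative_mult_right)
  qed
  have d: "(modulated s t \<alpha> U has_vector_derivative g x) (at x)" for x
    unfolding modulated_def[abs_def] g_def
    by (intro has_vector_derivative_Pair comp[where w = "\<lambda>x. fst (U x)"] comp[where w = "\<lambda>x. snd (U x)"] du dv)
  have cg: "continuous_on UNIV g"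
    unfolding g_def
    by (intro continuous_intros continuous_on_compose2[OF c(1)] continuous_on_compose2[OF c(2)]) auto
  have cm: "continuous_on UNIV (modulated s t \<alpha> U)"
    using d by (meson continuous_at_imp_continuous_on has_vector_derivative_continuous)
  show ?thesis
    unfolding H1loc_def
    using cm continuous_L2loc[OF cm] continuous_L2loc[OF cg] is_weak_deriv_C1[OF d cg] by blast
qed

lemma H1loc_component:
  fixes \<Psi> :: "real \<Rightarrow> 'a::euclidean_space" and pr :: "'a \<Rightarrow> 'b::euclidean_space"
  assumes "\<Psi> \<in> H1loc" "bounded_linear pr"
  shows "continuous_on UNIV (\<lambda>x. pr (\<Psi> x))" "(\<lambda>x. pr (weak_deriv \<Psi> x)) \<in> L2loc"
    "is_weak_deriv (\<lambda>x. pr (\<Psi> x)) (\<lambda>x. pr (weak_deriv \<Psi> x))"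
proof -
  show "continuous_on UNIV (\<lambda>x. pr (\<Psi> x))"
    by (rule bounded_linear.continuous_on[OF assms(2) weak_deriv_H1loc(3)[OF assms(1)]])
  show "(\<lambda>x. pr (weak_deriv \<Psi> x)) \<in> L2loc"
    by (rule L2loc_bounded_linear[OF assms(2) weak_deriv_H1loc(1)[OF assms(1)]])
  show "is_weak_deriv (\<lambda>x. pr (\<Psi> x)) (\<lambda>x. pr (weak_deriv \<Psi> x))"
    by (rule is_weak_deriv_bounded_linear[OF assms(2) continuous_L2loc[OF weak_deriv_H1loc(3)[OF assms(1)]]
        weak_deriv_H1loc(1,2)[OF assms(1)]])
qed

text \<open>Since \<open>g11 * a\<^sup>2 = \<mu> * sqrt g11\<close> and
  \<open>g12 * b\<^sup>2 = \<mu> * g12 / sqrt g22\<close>, the gap is exactly the condition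
  \<open>g12 > sqrt (g11 * g22)\<close>.\<close>

lemma wall_amplitudes_gap:
  assumes "g11 > 0" "g22 > 0" "\<mu> > 0" "g12 > sqrt (g11 * g22)"
    and "a = sqrt \<mu> / root 4 g11" "b = sqrt \<mu> / root 4 g22"
  shows "a > 0" "g11 * a\<^sup>2 < g12 * b\<^sup>2"
proof -
  show "a > 0" using assms by simp
  have r4: "(root 4 g)\<^sup>2 = sqrt g" if "g > 0" for g :: real
  proof -
    have "root 4 g = root 2 (root 2 g)"
      using real_root_mult_exp[of 2 2 g] by simp
    then show ?thesis
      using that by (simp add: sqrt_def[symmetric])
  qed
  have a2: "a\<^sup>2 = \<mu> / sqrt g11" and b2: "b\<^sup>2 = \<mu> / sqrt g22"
    using assms r4 by (simp_all add: power_divide)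
  have "g11 * a\<^sup>2 = \<mu> * sqrt g11"
    using assms(1) real_div_sqrt[of g11] unfolding a2 by (simp add: field_simps)
  also have "\<dots> = \<mu> / sqrt g22 * sqrt (g11 * g22)"
    using assms(2) by (simp add: real_sqrt_mult)
  also have "\<dots> < \<mu> / sqrt g22 * g12"
    using assms by (intro mult_strict_left_mono) auto
  also have "\<dots> = g12 * b\<^sup>2"
    unfolding b2 by simp
  finally show "g11 * a\<^sup>2 < g12 * b\<^sup>2" .
qed

section \<open>Choice of the constants and the linear bound on the position\<close>

theorem theorem1p5:
  fixes g11 g22 g12 \<mu> A a b :: real
    and U :: "real \<Rightarrow> real \<times> real"
  assumes "g11 > 0" and "g22 > 0" and "\<mu> > 0"
    and "g12 > sqrt (g11 * g22)"
    and "A > 0"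
    and "a = sqrt \<mu> / root 4 g11"
    and "b = sqrt \<mu> / root 4 g22"
    and "U \<in> wall_space a b"
    and "energy_minimizing g11 g22 g12 \<mu> a b U"
    and "wall_ode g11 g22 g12 a b (\<lambda>x. fst (U x)) (\<lambda>x. snd (U x))"
  shows "\<exists>C::real. \<exists>\<epsilon>0>0. \<forall>\<epsilon>::real. 0 < \<epsilon> \<and> \<epsilon> < \<epsilon>0 \<longrightarrow>
    (\<exists>\<delta>>0. \<forall>(\<Psi>0 :: real \<Rightarrow> complex \<times> complex) (\<Psi> :: real \<Rightarrow> real \<Rightarrow> complex \<times> complex)
        (\<alpha> :: real \<Rightarrow> real) (\<theta>1 :: real \<Rightarrow> real) (\<theta>2 :: real \<Rightarrow> real).
      \<Psi>0 \<in> finite_energy_space g11 g22 g12 \<mu> \<inter> Linf \<longrightarrow>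
      rho A \<Psi>0 (modulated 0 0 0 U) \<le> ennreal \<delta> \<longrightarrow>
      hamiltonian_solution g11 g22 g12 \<mu> a b \<Psi>0 \<Psi> \<longrightarrow>
      (SUP t. rho A (\<Psi> t) (modulated (\<theta>1 t) (\<theta>2 t) (\<alpha> t) U)) \<le> ennreal \<epsilon> \<longrightarrow>
      (\<forall>t. \<bar>\<alpha> t\<bar> \<le> C * \<epsilon> * max 1 \<bar>t\<bar>))"
proof -
  define u where "u = (\<lambda>x. fst (U x))"
  define v where "v = (\<lambda>x. snd (U x))"
  obtain u' v' u'' v'' where ode: "\<And>x. (u has_real_derivative u' x) (at x)"
    "\<And>x. (u' has_real_derivative u'' x) (at x)" "\<And>x. (v has_real_derivative v' x) (at x)"
    "\<And>x. (v' has_real_derivative v'' x) (at x)"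
    "\<And>x. - u'' x + g11 * ((u x)\<^sup>2 - a\<^sup>2) * u x + g12 * u x * (v x)\<^sup>2 = 0"
    using assms(10) unfolding wall_ode_def u_def v_def by blast
  have u''_eq: "u'' x = (g11 * ((u x)\<^sup>2 - a\<^sup>2) + g12 * (v x)\<^sup>2) * u x" for x
    using ode(5)[of x] by (simp add: algebra_simps)
  have du': "(u' has_real_derivative (g11 * ((u x)\<^sup>2 - a\<^sup>2) + g12 * (v x)\<^sup>2) * u x) (at x)" for x
    using ode(2)[of x] by (simp only: u''_eq)
  have cu': "continuous_on UNIV u'" and cv': "continuous_on UNIV v'"
    by (rule continuous_on_test, rule ode)+
  have lim: "(U \<longlongrightarrow> (a, 0)) at_top" "(U \<longlongrightarrow> (0, b)) at_bot"
    using assms(8) by (auto simp: wall_space_def)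
  have "g12 > 0"
    using assms(1,2,4) by (meson less_imp_le mult_pos_pos order_le_less_trans real_sqrt_ge_zero)
  then interpret wall_profile u v u' v' g11 g12 a b
    using ode(1,3) du' cv' tendsto_fst[OF lim(1)] tendsto_snd[OF lim(1)] tendsto_fst[OF lim(2)]
      tendsto_snd[OF lim(2)] assms(1) wall_amplitudes_gap[OF assms(1-4,6,7)]
    by unfold_locales (simp_all add: u_def v_def)
  obtain \<Phi> \<phi> \<phi>1 \<phi>2 H R K B \<Lambda> where wt: "wall_test u v u' v' g11 g12 a b \<Phi> \<phi> \<phi>1 \<phi>2 H R K B \<Lambda>"
    and nz: "(LBINT x. \<phi> x * u x) \<noteq> 0" "(LBINT x. \<phi> x * u' x) \<noteq> 0"
    using wall_test_exists by blast
  interpret w: wall_test u v u' v' g11 g12 a b \<Phi> \<phi> \<phi>1 \<phi>2 H R K B \<Lambda>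
    by (rule wt)
  have "w.M 0 \<noteq> 0" using nz(1) by (simp add: w.M_def)
  then obtain \<eta> c0 where \<eta>: "0 < \<eta>" "\<eta> \<le> 1" "0 < c0"
    "\<And>\<beta>. \<bar>\<beta>\<bar> \<le> \<eta> \<Longrightarrow> \<bar>\<beta>\<bar> \<le> c0 * \<bar>(w.M \<beta>)\<^sup>2 - (w.M 0)\<^sup>2\<bar>"
    by (rule w.M_squared_local[OF _ nz(2)]) blast
  obtain Cs \<nu> where Cs: "Cs > 0" "\<nu> > 0"
    "\<And>\<epsilon> \<alpha>1 \<alpha>2. \<lbrakk>0 < \<epsilon>; \<epsilon> \<le> \<nu>; loc_small \<epsilon> (\<lambda>x. \<bar>u (x + \<alpha>1)\<bar> - \<bar>u (x + \<alpha>2)\<bar>)\<rbrakk>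
      \<Longrightarrow> \<bar>\<alpha>1 - \<alpha>2\<bar> \<le> Cs * \<epsilon>"
    by (rule shift_rigidity) blast
  \<comment> \<open>\<open>Z_near\<close> is used at two times, so comparing increments of
    \<open>Z\<close> and of the square of \<open>M\<close> costs
    \<open>2 * w.C4 * \<epsilon>\<close>.\<close>
  define c where "c = c0 * (1 + 2 * w.C4)"
  define j where "j = 3 * Cs"
  \<comment> \<open>The step length required by \<open>slow_motion_step\<close>; adding 1 to
    \<open>w.C3\<close> makes the rate strictly positive. It does not depend on
    \<open>\<epsilon>\<close>.\<close>
  define h where "h = 1 / ((w.C3 + 1) * (1 + 2 * c + 2 * j))"
  \<comment> \<open>The three caps give \<open>\<epsilon> \<le> 1\<close>, admit
    \<open>3 * \<epsilon>\<close> in the rigidity lemma, and keep the bootstrap range below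
    \<open>\<eta>\<close>.\<close>
  define \<epsilon>0 where "\<epsilon>0 = min 1 (min (\<nu> / 3) (\<eta> / (2 * c + 2 * j)))"
  \<comment> \<open>The first summand bounds the initial position, the second the drift.\<close>
  define C where "C = 2 * Cs + 2 * c * (1 / h + 1)"
  have c: "c > 0" using \<eta>(3) w.C_nonneg by (simp add: c_def add_pos_nonneg)
  have j: "j > 0" using Cs(1) by (simp add: j_def)
  have h: "h > 0" using c j w.C_nonneg by (simp add: h_def add_nonneg_pos)
  have \<epsilon>0: "\<epsilon>0 > 0" using Cs(2) \<eta>(1) c j by (simp add: \<epsilon>0_def)
  have main: "\<bar>\<alpha> t\<bar> \<le> C * \<epsilon> * max 1 \<bar>t\<bar>"
    if \<epsilon>: "0 < \<epsilon>" "\<epsilon> < \<epsilon>0" and init: "rho A \<Psi>0 (modulated 0 0 0 U) \<le> ennreal \<epsilon>"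
      and sol: "hamiltonian_solution g11 g22 g12 \<mu> a b \<Psi>0 \<Psi>"
      and orbit: "(SUP t. rho A (\<Psi> t) (modulated (\<theta>1 t) (\<theta>2 t) (\<alpha> t) U)) \<le> ennreal \<epsilon>"
    for \<epsilon> \<Psi>0 \<Psi> \<alpha> \<theta>1 \<theta>2 t
  proof -
    have \<epsilon>1: "\<epsilon> \<le> 1" "3 * \<epsilon> \<le> \<nu>"
      using \<epsilon>(2) by (auto simp: \<epsilon>0_def)
    have "\<epsilon> \<le> \<eta> / (2 * c + 2 * j)"
      using \<epsilon>(2) by (auto simp: \<epsilon>0_def)
    then have \<epsilon>2: "(2 * c + 2 * j) * \<epsilon> \<le> \<eta>"
      using c j by (simp add: pos_le_divide_eq mult.commute)
    have H\<Psi>: "\<Psi> t \<in> H1loc" for t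
      using sol by (auto simp: hamiltonian_solution_def finite_energy_space_def)
    have Hm: "modulated s1 s2 s3 U \<in> H1loc" for s1 s2 s3
      by (rule modulated_H1loc[OF ode(1,3)[unfolded u_def v_def] cu' cv'])
    have rho_t: "rho A (\<Psi> t) (modulated (\<theta>1 t) (\<theta>2 t) (\<alpha> t) U) \<le> ennreal \<epsilon>" for t
      by (rule order_trans[OF SUP_upper orbit]) simp
    note near1 = rho_component_loc_small[OF H\<Psi> Hm bounded_linear_fst rho_le(1)[OF rho_t] \<epsilon>(1)]
    note near2 = rho_component_loc_small[OF H\<Psi> Hm bounded_linear_snd rho_le(2)[OF rho_t] \<epsilon>(1)]
    have fst_mod: "fst (modulated s1 s2 s3 U x) = exp (\<i> * complex_of_real s1) * complex_of_real (u (x + s3))"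
      and snd_mod: "snd (modulated s1 s2 s3 U x) = exp (\<i> * complex_of_real s2) * complex_of_real (v (x + s3))"
      for s1 s2 s3 x
      by (simp_all add: modulated_def u_def v_def)
    have abs1: "loc_small \<epsilon> (\<lambda>x. cmod (fst (\<Psi> t x)) - \<bar>u (x + \<alpha> t)\<bar>)" for t
      using near1(2)[of t] by (simp add: fst_mod norm_mult)
    have abs2: "loc_small \<epsilon> (\<lambda>x. cmod (snd (\<Psi> t x)) - \<bar>v (x + \<alpha> t)\<bar>)" for t
      using near2(2)[of t] by (simp add: snd_mod norm_mult)
    note comp1 = H1loc_component[OF H\<Psi> bounded_linear_fst] and comp2 = H1loc_component[OF H\<Psi> bounded_linear_snd]
    note mod1 = H1loc_component[OF Hm bounded_linear_fst] and mod2 = H1loc_component[OF Hm bounded_linear_snd]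
    have nw: "near_wall u v u' v' g11 g12 a b \<Phi> \<phi> \<phi>1 \<phi>2 H R K B \<Lambda>
        (\<lambda>x. fst (\<Psi> t x)) (\<lambda>x. snd (\<Psi> t x))
        (\<lambda>x. fst (weak_deriv (\<Psi> t) x)) (\<lambda>x. snd (weak_deriv (\<Psi> t) x))
        (\<lambda>x. fst (weak_deriv (modulated (\<theta>1 t) (\<theta>2 t) (\<alpha> t) U) x))
        (\<lambda>x. snd (weak_deriv (modulated (\<theta>1 t) (\<theta>2 t) (\<alpha> t) U) x))
        (exp (\<i> * complex_of_real (\<theta>1 t))) (exp (\<i> * complex_of_real (\<theta>2 t))) (\<alpha> t) \<epsilon>" for t
      by (intro near_wall.intro near_wall_axioms.intro wt)
        (rule comp1 comp2 mod1 mod2 mod1[unfolded fst_mod] mod2[unfolded snd_mod] near1(1) near2(1)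
          abs1 abs2 \<epsilon> \<epsilon>1 norm_exp_i_times)+
    have ws: "weak_schroedinger (\<lambda>t x. fst (\<Psi> t x)) (\<lambda>t x. fst (weak_deriv (\<Psi> t) x))
        (\<lambda>t x. complex_of_real (g11 * ((cmod (fst (\<Psi> t x)))\<^sup>2 - a\<^sup>2) + g12 * (cmod (snd (\<Psi> t x)))\<^sup>2) * fst (\<Psi> t x))"
      using sol by (simp add: hamiltonian_solution_def nonlinearity_def)
    interpret f: near_wall_flow u v u' v' g11 g12 a b \<Phi> \<phi> \<phi>1 \<phi>2 H R K B \<Lambda>
      "\<lambda>t x. fst (\<Psi> t x)" "\<lambda>t x. snd (\<Psi> t x)"
      "\<lambda>t x. fst (weak_deriv (\<Psi> t) x)" "\<lambda>t x. snd (weak_deriv (\<Psi> t) x)"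
      "\<lambda>t x. fst (weak_deriv (modulated (\<theta>1 t) (\<theta>2 t) (\<alpha> t) U) x)"
      "\<lambda>t x. snd (weak_deriv (modulated (\<theta>1 t) (\<theta>2 t) (\<alpha> t) U) x)"
      "\<lambda>t. exp (\<i> * complex_of_real (\<theta>1 t))" "\<lambda>t. exp (\<i> * complex_of_real (\<theta>2 t))" \<alpha> \<epsilon>
      by (intro near_wall_flow.intro near_wall_flow_axioms.intro wt nw ws)
    \<comment> \<open>Nearby states have moduli within \<open>\<epsilon>\<close> by continuity of
      the flow; comparing each state with its own wall adds \<open>\<epsilon>\<close> twice.
      Rigidity with \<open>3 * \<epsilon>\<close> then yields \<open>j = 3 * Cs\<close>.\<close>
    have J: "\<exists>d>0. \<forall>t'. \<bar>t' - t\<bar> < d \<longrightarrow> \<bar>\<alpha> t' - \<alpha> t\<bar> \<le> j * \<epsilon>" for t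
    proof -
      have "((\<lambda>s. rho 1 (\<Psi> s) (\<Psi> t)) \<longlongrightarrow> 0) (at t)"
        using sol by (simp add: hamiltonian_solution_def)
      then have "\<forall>\<^sub>F s in at t. rho 1 (\<Psi> s) (\<Psi> t) < ennreal \<epsilon>"
        by (rule order_tendstoD(2)) (use \<epsilon> in simp)
      then obtain d where d: "d > 0" "\<And>s. \<lbrakk>s \<noteq> t; \<bar>s - t\<bar> < d\<rbrakk> \<Longrightarrow> rho 1 (\<Psi> s) (\<Psi> t) < ennreal \<epsilon>"
        by (auto simp: eventually_at dist_real_def)
      have "\<bar>\<alpha> s - \<alpha> t\<bar> \<le> j * \<epsilon>" if s: "\<bar>s - t\<bar> < d" for s
      proof (cases "s = t")
        case True
        then show ?thesis using j \<epsilon>(1) by simp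
      next
        case False
        note rl = rho_le(1)[OF less_imp_le[OF d(2)[OF False s]]]
        have st: "loc_small \<epsilon> (\<lambda>x. cmod (fst (\<Psi> s x)) - cmod (fst (\<Psi> t x)))"
          by (rule rho_component_loc_small(2)[OF H\<Psi> H\<Psi> bounded_linear_fst rl \<epsilon>(1)])
        have "loc_small (\<epsilon> + \<epsilon> + \<epsilon>) (\<lambda>x. (cmod (fst (\<Psi> s x)) - cmod (fst (\<Psi> t x)))
            - (cmod (fst (\<Psi> s x)) - \<bar>u (x + \<alpha> s)\<bar>) + (cmod (fst (\<Psi> t x)) - \<bar>u (x + \<alpha> t)\<bar>))"
          by (intro loc_small_add loc_small_diff st abs1)
        then have "loc_small (3 * \<epsilon>) (\<lambda>x. \<bar>u (x + \<alpha> s)\<bar> - \<bar>u (x + \<alpha> t)\<bar>)"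
          by simp
        from Cs(3)[OF _ \<epsilon>1(2) this] show ?thesis
          using \<epsilon>(1) by (simp add: j_def)
      qed
      then show ?thesis using d(1) by blast
    qed
    have D: "\<exists>D. (f.Z s has_real_derivative D) (at t) \<and> \<bar>D\<bar> \<le> (w.C3 + 1) * (\<epsilon> + \<bar>\<alpha> t - \<alpha> s\<bar>)"
      if b: "\<bar>\<alpha> t - \<alpha> s\<bar> \<le> \<eta>" for s t
    proof -
      have "w.C3 * (\<epsilon> + \<bar>\<alpha> t - \<alpha> s\<bar>) \<le> (w.C3 + 1) * (\<epsilon> + \<bar>\<alpha> t - \<alpha> s\<bar>)"
        using \<epsilon>(1) by (intro mult_right_mono) auto
      then show ?thesis
        using f.Z_deriv[OF order_trans[OF b \<eta>(2)]] order_trans by blast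
    qed
    have I: "\<bar>\<alpha> t - \<alpha> s\<bar> \<le> c * (\<bar>f.Z s t - f.Z s s\<bar> + \<epsilon>)" if b: "\<bar>\<alpha> t - \<alpha> s\<bar> \<le> \<eta>" for s t
    proof -
      have "\<bar>(w.M (\<alpha> t - \<alpha> s))\<^sup>2 - (w.M 0)\<^sup>2\<bar> \<le> \<bar>f.Z s t - f.Z s s\<bar> + 2 * w.C4 * \<epsilon>"
        using f.Z_near[of s t] f.Z_near[of s s] by simp
      also have "\<dots> \<le> (1 + 2 * w.C4) * (\<bar>f.Z s t - f.Z s s\<bar> + \<epsilon>)"
      proof -
        have "0 \<le> w.C4 * \<bar>f.Z s t - f.Z s s\<bar>" using w.C_nonneg by simp
        then show ?thesis using \<epsilon>(1) by (simp add: algebra_simps)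
      qed
      finally have "c0 * \<bar>(w.M (\<alpha> t - \<alpha> s))\<^sup>2 - (w.M 0)\<^sup>2\<bar> \<le> c * (\<bar>f.Z s t - f.Z s s\<bar> + \<epsilon>)"
        unfolding c_def mult.assoc using \<eta>(3) by (intro mult_left_mono) auto
      then show ?thesis
        using \<eta>(4)[OF b] by linarith
    qed
    have C3: "w.C3 + 1 > 0" using w.C_nonneg(3) by simp
    have "\<bar>\<alpha> t - \<alpha> 0\<bar> \<le> 2 * c * \<epsilon> * (\<bar>t\<bar> / h + 1)"
    proof (rule slow_motion[OF _ h])
      show "\<bar>\<alpha> t - \<alpha> s\<bar> \<le> 2 * c * \<epsilon>" if "s \<le> t" "t \<le> s + h" for s t
        by (rule slow_motion_step[OF D I J C3 c j \<epsilon>(1) \<epsilon>2 h_def that])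
      show "0 \<le> 2 * c * \<epsilon>" using c \<epsilon>(1) by simp
    qed
    also have "\<dots> \<le> 2 * c * \<epsilon> * ((1 / h + 1) * max 1 \<bar>t\<bar>)"
    proof (rule mult_left_mono)
      have "\<bar>t\<bar> / h \<le> (1 / h) * max 1 \<bar>t\<bar>"
        using h by (simp add: field_simps)
      then show "\<bar>t\<bar> / h + 1 \<le> (1 / h + 1) * max 1 \<bar>t\<bar>"
        by (simp add: ring_distribs)
      show "0 \<le> 2 * c * \<epsilon>" using c \<epsilon>(1) by simp
    qed
    finally have drift: "\<bar>\<alpha> t - \<alpha> 0\<bar> \<le> 2 * c * (1 / h + 1) * \<epsilon> * max 1 \<bar>t\<bar>"
      by (simp add: mult_ac)
    have "\<Psi> 0 = \<Psi>0"
      using sol by (simp add: hamiltonian_solution_def)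
    then have init': "rho A (\<Psi> 0) (modulated 0 0 0 U) \<le> ennreal \<epsilon>"
      using init by simp
    have "loc_small \<epsilon> (\<lambda>x. cmod (fst (\<Psi> 0 x)) - \<bar>u (x + 0)\<bar>)"
      using rho_component_loc_small(2)[OF H\<Psi> Hm bounded_linear_fst rho_le(1)[OF init'] \<epsilon>(1)]
      by (simp add: fst_mod norm_mult)
    \<comment> \<open>At time 0 the state is close both to \<open>U\<close> and to its translate by
      \<open>\<alpha> 0\<close>, so rigidity applies with \<open>2 * \<epsilon>\<close>.\<close>
    from loc_small_diff[OF this abs1[of 0]]
    have "loc_small (2 * \<epsilon>) (\<lambda>x. \<bar>u (x + \<alpha> 0)\<bar> - \<bar>u (x + 0)\<bar>)"
      by simp
    from Cs(3)[OF _ _ this] have start: "\<bar>\<alpha> 0\<bar> \<le> 2 * Cs * \<epsilon>"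
      using \<epsilon>(1) \<epsilon>1(2) by simp
    also have "\<dots> \<le> 2 * Cs * \<epsilon> * max 1 \<bar>t\<bar>"
      using Cs(1) \<epsilon>(1) mult_left_mono[of 1 "max 1 \<bar>t\<bar>" "2 * Cs * \<epsilon>"] by simp
    finally have "\<bar>\<alpha> t\<bar> \<le> 2 * Cs * \<epsilon> * max 1 \<bar>t\<bar> + 2 * c * (1 / h + 1) * \<epsilon> * max 1 \<bar>t\<bar>"
      using drift by linarith
    also have "\<dots> = C * \<epsilon> * max 1 \<bar>t\<bar>"
      unfolding C_def by (simp only: ring_distribs)
    finally show ?thesis .
  qed
  show ?thesis
  proof (rule exI[of _ C], rule exI[of _ \<epsilon>0], intro conjI allI impI \<epsilon>0)
    fix \<epsilon> :: real assume e: "0 < \<epsilon> \<and> \<epsilon> < \<epsilon>0"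
    show "\<exists>\<delta>>0. \<forall>(\<Psi>0 :: real \<Rightarrow> complex \<times> complex) (\<Psi> :: real \<Rightarrow> real \<Rightarrow> complex \<times> complex)
        (\<alpha> :: real \<Rightarrow> real) (\<theta>1 :: real \<Rightarrow> real) (\<theta>2 :: real \<Rightarrow> real).
      \<Psi>0 \<in> finite_energy_space g11 g22 g12 \<mu> \<inter> Linf \<longrightarrow>
      rho A \<Psi>0 (modulated 0 0 0 U) \<le> ennreal \<delta> \<longrightarrow>
      hamiltonian_solution g11 g22 g12 \<mu> a b \<Psi>0 \<Psi> \<longrightarrow>
      (SUP t. rho A (\<Psi> t) (modulated (\<theta>1 t) (\<theta>2 t) (\<alpha> t) U)) \<le> ennreal \<epsilon> \<longrightarrow>
      (\<forall>t. \<bar>\<alpha> t\<bar> \<le> C * \<epsilon> * max 1 \<bar>t\<bar>)"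
      \<comment> \<open>The witness for \<open>\<delta>\<close> is \<open>\<epsilon>\<close>
        itself.\<close>
      using e main by (intro exI[of _ \<epsilon>] conjI allI impI) auto
  qed
qed

end
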